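(* Let $k \geq 1$ be an integer, let $\ell \in \{1,2,3\}$, and let $G$ be a connected graph with exactly $m$ edges that is not a $k$-clique (i.e. not isomorphic to $K_k$). Then \[\iota(G, \mathcal{F}_{\ell,k}) \leq \frac{m+1}{\binom{k}{2}+2}.\] Moreover: (i) Equality holds if and only if $G$ is a pure $(m,k)$-special graph, or $k=2$ and $G$ is a $5$-cycle, or $k=3$, $\ell \in \{1,3\}$ and $G$ is a $4$-cycle. (ii) If $G$ is an $(m,k)$-special graph, then $\iota(G,\mathcal{F}_{\ell,k}) = \left\lfloor (m+1)/\left(\binom{k}{2}+2\right)\right\rfloor$.
   Context: All graphs are finite and simple. For a graph $G$ and $X \subseteq V(G)$, $N_G[X]$ is the closed neighbourhood $\bigcup_{v\in X}(\{v\}\cup N_G(v))$, and $G - N_G[X]$ is the graph obtained from $G$ by deleting the vertices of $N_G[X]$. For a set $\mathcal{F}$ of graphs, an $\mathcal{F}$-graph is a graph isomorphic to a member of $\mathcal{F}$; a set $D \subseteq V(G)$ is $\mathcal{F}$-isolating if $G - N_G[D]$ has no subgraph that is an $\mathcal{F}$-graph; $\iota(G,\mathcal{F})$ is the minimum size of an $\mathcal{F}$-isolating set of $G$. For an integer $k\ge 1$: $\mathcal{F}_{1,k}$ is the set of (nonempty) regular graphs whose degree is at least $k-1$; $\mathcal{F}_{2,k}$ is the set of graphs with chromatic number at least $k$; $\mathcal{F}_{3,k}=\mathcal{F}_{1,k}\cup\mathcal{F}_{2,k}$. A $k$-clique is a copy of $K_k$; an $n$-cycle is a copy of $C_n$.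 $(m,k)$-special graphs: let $m,k\in\mathbb{N}$, $t_k=\binom{k}{2}+2$, and write $m+1 = q t_k + r$ with integers $q\ge 0$, $0\le r\le t_k-1$. If $q\ge1$, let $v_1,\dots,v_q$ be distinct vertices, let $U_1,\dots,U_q$ be pairwise disjoint $k$-element sets disjoint from $\{v_1,\dots,v_q\}$, and for each $i$ let $u_i^1\in U_i$ and let $G_i$ be the graph with vertex set $U_i\cup\{v_i\}$ and edge set $\binom{U_i}{2}\cup\{u_i^1v_i\}$ (a $k$-clique plus a pendant edge to $v_i$). A graph $G$ is an $(m,k)$-special graph if either $q=0$ and $G$ is a tree with $r$ edges, or $q\ge 1$ and $G$ has vertex set $V(T')\cup\bigcup_{i=1}^q V(G_i)$ and edge set $E(T)\cup E(T')\cup\bigcup_{i=1}^q E(G_i)$, where $T$ is a tree with vertex set $\{v_1,\dots,v_q\}$ and $T'$ is a tree with $r$ edges such that $V(T')\cap\bigcup_{i=1}^q V(G_i)=\{v_q\}$. The $G_i$ are called the $k$-clique constituents of $G$. It is pure if $r=0$. *)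

theory Defs
  imports Complex_Main "HOL-Library.Ramsey" "HOL-Library.Disjoint_Sets"
begin

text \<open>
  A graph is a vertex set with a set of edges, each edge being a two-element set of vertices.
  The graph without vertices is admitted, since deleting a closed neighbourhood may produce it.
  Throughout, \<open>nsets A n\<close> is the library's set of all \<open>n\<close>-element subsets of \<open>A\<close>.
\<close>

datatype 'a graph = Graph (verts: "'a set") (edges: "'a set set")

definition simple_graph :: "'a graph \<Rightarrow> bool" where
  "simple_graph G \<longleftrightarrow> finite (verts G) \<and> edges G \<subseteq> nsets (verts G) 2"

definition subgraph :: "'a graph \<Rightarrow> 'a graph \<Rightarrow> bool" where
  "subgraph H G \<longleftrightarrow> simple_graph H \<and> verts H \<subseteq> verts G \<and> edges H \<subseteq> edges G"

definition isomorphic :: "'a graph \<Rightarrow> 'b graph \<Rightarrow> bool" where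
  "isomorphic G H \<longleftrightarrow>
     (\<exists>f. bij_betw f (verts G) (verts H) \<and>
          (\<forall>u\<in>verts G. \<forall>v\<in>verts G. {u, v} \<in> edges G \<longleftrightarrow> {f u, f v} \<in> edges H))"

definition complete_graph :: "nat \<Rightarrow> nat graph" where
  "complete_graph k = Graph {..<k} (nsets {..<k} 2)"

text \<open>Only meaningful for \<open>n \<ge> 3\<close>.\<close>
definition cycle_graph :: "nat \<Rightarrow> nat graph" where
  "cycle_graph n = Graph {..<n} {{i, Suc i mod n} |i. i < n}"

definition neighbours :: "'a graph \<Rightarrow> 'a \<Rightarrow> 'a set" where
  "neighbours G v = {w. {v, w} \<in> edges G}"

definition closed_nbhd :: "'a graph \<Rightarrow> 'a set \<Rightarrow> 'a set" where
  "closed_nbhd G X = (\<Union>v\<in>X. {v} \<union> neighbours G v)"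

definition delete_verts :: "'a graph \<Rightarrow> 'a set \<Rightarrow> 'a graph" where
  "delete_verts G X = Graph (verts G - X) {e \<in> edges G. e \<inter> X = {}}"

definition degree :: "'a graph \<Rightarrow> 'a \<Rightarrow> nat" where
  "degree G v = card (neighbours G v)"

definition connected_graph :: "'a graph \<Rightarrow> bool" where
  "connected_graph G \<longleftrightarrow> verts G \<noteq> {} \<and>
     (\<forall>u\<in>verts G. \<forall>v\<in>verts G. (u, v) \<in> {(x, y). {x, y} \<in> edges G}\<^sup>*)"

definition tree :: "'a graph \<Rightarrow> bool" where
  "tree G \<longleftrightarrow> simple_graph G \<and> connected_graph G \<and>
     \<not> (\<exists>H n. 3 \<le> n \<and> subgraph H G \<and> isomorphic H (cycle_graph n))"

definition proper_colouring :: "'a graph \<Rightarrow> nat \<Rightarrow> ('a \<Rightarrow> nat) \<Rightarrow> bool" where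
  "proper_colouring G n c \<longleftrightarrow> c ` verts G \<subseteq> {..<n} \<and>
     (\<forall>u\<in>verts G. \<forall>v\<in>verts G. {u, v} \<in> edges G \<longrightarrow> c u \<noteq> c v)"

definition chromatic_number :: "'a graph \<Rightarrow> nat" where
  "chromatic_number G = (LEAST n. \<exists>c. proper_colouring G n c)"

definition isolating :: "'a graph \<Rightarrow> 'b graph set \<Rightarrow> 'a set \<Rightarrow> bool" where
  "isolating G \<F> D \<longleftrightarrow> D \<subseteq> verts G \<and>
     \<not> (\<exists>H. subgraph H (delete_verts G (closed_nbhd G D)) \<and> (\<exists>F\<in>\<F>. isomorphic H F))"

text \<open>
  The minimum is attained whenever no member of \<open>\<F>\<close> has an empty vertex set, because then
  \<open>verts G\<close> is isolating; this is the case for the families below when \<open>k \<ge> 1\<close>.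
\<close>
definition iota :: "'a graph \<Rightarrow> 'b graph set \<Rightarrow> nat" where
  "iota G \<F> = (LEAST n. \<exists>D. isolating G \<F> D \<and> card D = n)"

definition regular_family :: "nat \<Rightarrow> 'a graph set" where
  "regular_family k = {H. simple_graph H \<and> verts H \<noteq> {} \<and>
     (\<exists>d\<ge>k - 1. \<forall>v\<in>verts H. degree H v = d)}"

definition chromatic_family :: "nat \<Rightarrow> 'a graph set" where
  "chromatic_family k = {H. simple_graph H \<and> chromatic_number H \<ge> k}"

text \<open>The families \<open>\<F>\<^sub>l\<^sub>,\<^sub>k\<close>; only \<open>l \<in> {1, 2, 3}\<close> is meaningful.\<close>
definition family :: "nat \<Rightarrow> nat \<Rightarrow> 'a graph set" where
  "family l k =
     (if l = 1 then regular_family k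
      else if l = 2 then chromatic_family k
      else regular_family k \<union> chromatic_family k)"

definition clique_constituent :: "'a set \<Rightarrow> 'a \<Rightarrow> 'a \<Rightarrow> 'a graph" where
  "clique_constituent U u v = Graph (U \<union> {v}) (nsets U 2 \<union> {{u, v}})"

text \<open>
  The structure of a special graph with \<open>q\<close> clique constituents and a tree \<open>T'\<close> with \<open>r\<close> edges.
  Indices run through \<open>{1..q}\<close>.
\<close>
definition special_structure :: "nat \<Rightarrow> nat \<Rightarrow> nat \<Rightarrow> 'a graph \<Rightarrow> bool" where
  "special_structure k q r G \<longleftrightarrow>
     (q = 0 \<and> tree G \<and> card (edges G) = r) \<or>
     (q \<ge> 1 \<and>
      (\<exists>(v :: nat \<Rightarrow> 'a) U u T T'.
         inj_on v {1..q} \<and>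
         disjoint_family_on U {1..q} \<and>
         (\<forall>i\<in>{1..q}. finite (U i) \<and> card (U i) = k \<and> U i \<inter> v ` {1..q} = {} \<and> u i \<in> U i) \<and>
         tree T \<and> verts T = v ` {1..q} \<and>
         tree T' \<and> card (edges T') = r \<and>
         verts T' \<inter> (\<Union>i\<in>{1..q}. verts (clique_constituent (U i) (u i) (v i))) = {v q} \<and>
         verts G = verts T' \<union> (\<Union>i\<in>{1..q}. verts (clique_constituent (U i) (u i) (v i))) \<and>
         edges G = edges T \<union> edges T' \<union>
           (\<Union>i\<in>{1..q}. edges (clique_constituent (U i) (u i) (v i)))))"

definition special_graph :: "nat \<Rightarrow> nat \<Rightarrow> 'a graph \<Rightarrow> bool" where
  "special_graph m k G \<longleftrightarrow>
     (let t = (k choose 2) + 2 in special_structure k ((m + 1) div t) ((m + 1) mod t) G)"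

definition pure_special_graph :: "nat \<Rightarrow> nat \<Rightarrow> 'a graph \<Rightarrow> bool" where
  "pure_special_graph m k G \<longleftrightarrow>
     special_graph m k G \<and> (m + 1) mod ((k choose 2) + 2) = 0"

end

theory Submission
  imports Defs
begin

text \<open>
  An \<open>\<F>\<close>-graph of any of the three families contains a nonempty set of vertices each having at least
  \<open>k - 1\<close> neighbours in the set, and every family contains \<open>K\<^sub>k\<close>. So upper bounds are proved for
  the stronger demand that \<open>G - N[D]\<close> be \<open>(k - 2)\<close>-degenerate, lower bounds by counting disjoint
  pendant cliques.

  The upper bound is an induction over connected induced subgraphs. Put a vertex \<open>v\<close> into \<open>D\<close>, delete
  a set \<open>Y\<close> with \<open>v \<in> Y \<subseteq> N[v]\<close>, and sum the bounds for the components of the rest. A component that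
  is not a \<open>k\<close>-clique pays for itself with one of its edges to \<open>Y\<close>; a \<open>k\<close>-clique needs two edges or,
  if it is adjacent to \<open>v\<close>, is already destroyed by \<open>v\<close>. If some \<open>G - x\<close> has a clique component, take
  \<open>Y = {x}\<close>. If not, but \<open>G\<close> has a \<open>k\<close>-clique, take \<open>Y = N[v]\<close> for a vertex \<open>v\<close> of it with a
  neighbour outside. If \<open>G\<close> has no \<open>k\<close>-clique, take \<open>Y = N[v]\<close> for a vertex \<open>v\<close> of degree at least \<open>k\<close>
  in a set of minimum degree \<open>k - 1\<close>; then every component satisfies the strict bound, unless
  \<open>k = 3\<close> and it is a \<open>4\<close>-cycle. Equality can only persist in the first case, where \<open>x\<close> becomes the
  foot of a new pendant clique, and for the two exceptional cycles.
\<close>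

text \<open>The tracked quantity is the excess \<open>ecount W + 1 - t * io W\<close>. It is -1 for
  a k-clique, so cliques are what a plain induction trips over. Putting v into D costs
  \<open>t\<close>, to be recovered from the edges inside Y, the edges leaving Y and the slack of
  the components; \<open>surplus\<close> keeps this account for each component separately.

  The constant: a clique constituent has \<open>(k choose 2) + 1\<close> edges, and one further edge
  joins its foot to the tree of feet. That tree has one edge less than vertices, whence m + 1.

  When Y is smaller than N[v], the components still contain vertices dominated by v. Therefore the
  isolation number carries a set \<open>Z\<close> of such vertices, and tight components must be
  analysed by how much they profit from an outside neighbour x: if x saves nothing, the structure of
  the component is forced.

  Asking for degeneracy treats the three families alike. Its price shows in one place: for k = 3 the
  4-cycle is not degenerate although it is 2-colourable, so it is extremal in the induction and is
  discarded for l = 2 only at the end.\<close>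

locale isolation =
  fixes E :: "'a set set" and k :: nat
  assumes card_edge: "e \<in> E \<Longrightarrow> card e = 2"
    and k_pos: "1 \<le> k"
begin

definition t :: nat where "t = (k choose 2) + 2"

definition nb :: "'a \<Rightarrow> 'a set" where "nb a = {b. {a, b} \<in> E}"

definition cnb :: "'a set \<Rightarrow> 'a set" where "cnb D = (\<Union>v\<in>D. insert v (nb v))"

text \<open>An edge with both ends in the intersection of \<open>A\<close> and \<open>B\<close> is
  counted twice, so \<open>links A A\<close> is the degree sum of the subgraph induced by
  \<open>A\<close>.\<close>

definition links :: "'a set \<Rightarrow> 'a set \<Rightarrow> nat" where
  "links A B = (\<Sum>a\<in>A. card (nb a \<inter> B))"

definition ecount :: "'a set \<Rightarrow> nat" where "ecount A = card {e \<in> E. e \<subseteq> A}"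

text \<open>For \<open>k = 1\<close> only the empty set is degenerate.\<close>
definition degenerate :: "'a set \<Rightarrow> bool" where
  "degenerate A \<longleftrightarrow> (\<forall>H. H \<subseteq> A \<longrightarrow> H \<noteq> {} \<longrightarrow> (\<exists>h\<in>H. card (nb h \<inter> H) < k - 1))"

text \<open>Connectedness is expressed by cuts instead of walks. This fits sets that are closed
  under neighbours and sets that grow vertex by vertex, the two uses below.\<close>

definition conn :: "'a set \<Rightarrow> bool" where
  "conn A \<longleftrightarrow> A \<noteq> {} \<and> (\<forall>B. B \<subseteq> A \<longrightarrow> B \<noteq> {} \<longrightarrow> B \<noteq> A \<longrightarrow> (\<exists>a\<in>B. \<exists>b\<in>A - B. b \<in> nb a))"

definition comps :: "'a set \<Rightarrow> 'a set set" where
  "comps A = {C. C \<subseteq> A \<and> conn C \<and> (\<forall>a\<in>C. nb a \<inter> A \<subseteq> C)}"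

definition clq :: "'a set \<Rightarrow> bool" where
  "clq Q \<longleftrightarrow> finite Q \<and> card Q = k \<and> (\<forall>a\<in>Q. \<forall>b\<in>Q. a \<noteq> b \<longrightarrow> b \<in> nb a)"

text \<open>The vertices of \<open>Z\<close> count as already dominated.\<close>
definition iso_num :: "'a set \<Rightarrow> 'a set \<Rightarrow> nat" where
  "iso_num Z W = (LEAST n. \<exists>D\<subseteq>W. degenerate (W - Z - cnb D) \<and> card D = n)"

abbreviation io :: "'a set \<Rightarrow> nat" where "io W \<equiv> iso_num {} W"

lemma nb_sym: "b \<in> nb a \<longleftrightarrow> a \<in> nb b"
  by (simp add: nb_def insert_commute)

lemma nb_irrefl [simp]: "a \<notin> nb a"
  using card_edge[of "{a}"] by (auto simp: nb_def)

section \<open>Counting edges inside and between vertex sets\<close>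

lemma links_Un_left:
  assumes "finite A" "finite B" "A \<inter> B = {}"
  shows "links (A \<union> B) C = links A C + links B C"
  using assms by (simp add: links_def sum.union_disjoint)

lemma links_Un_right:
  assumes "finite B" "finite C" "B \<inter> C = {}"
  shows "links A (B \<union> C) = links A B + links A C"
proof -
  have "card (nb a \<inter> (B \<union> C)) = card (nb a \<inter> B) + card (nb a \<inter> C)" for a
    using assms by (subst card_Un_disjoint[symmetric]) (auto simp: Int_Un_distrib)
  then show ?thesis by (simp add: links_def sum.distrib)
qed

lemma links_sym:
  assumes "finite A" "finite B"
  shows "links A B = links B A"
proof -
  have c: "card (nb a \<inter> S) = (\<Sum>b\<in>S. if b \<in> nb a then 1 else 0)" if "finite S" for a S
    using that by (simp add: sum.If_cases Int_def conj_commute)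
  have "links A B = (\<Sum>a\<in>A. \<Sum>b\<in>B. if b \<in> nb a then 1 else 0)"
    using assms by (simp add: links_def c)
  also have "\<dots> = (\<Sum>b\<in>B. \<Sum>a\<in>A. if b \<in> nb a then 1 else 0)" by (rule sum.swap)
  also have "\<dots> = links B A"
    using assms by (simp add: links_def c nb_sym)
  finally show ?thesis .
qed

lemma links_insert_left:
  "finite A \<Longrightarrow> a \<notin> A \<Longrightarrow> links (insert a A) B = card (nb a \<inter> B) + links A B"
  by (simp add: links_def)

lemma links_singleton_left [simp]: "links {a} B = card (nb a \<inter> B)"
  by (simp add: links_def)

lemma links_singleton_right: "finite A \<Longrightarrow> links A {a} = card (nb a \<inter> A)"
  by (subst links_sym) auto

lemma links_eq_0_iff:
  assumes "finite A" "finite B"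
  shows "links A B = 0 \<longleftrightarrow> (\<forall>a\<in>A. \<forall>b\<in>B. b \<notin> nb a)"
  using assms by (auto simp: links_def)

lemma links_mono:
  assumes "finite A'" "finite B'" "A \<subseteq> A'" "B \<subseteq> B'"
  shows "links A B \<le> links A' B'"
proof -
  have "links A B \<le> links A B'" unfolding links_def
    using assms by (intro sum_mono card_mono) auto
  also have "\<dots> \<le> links A' B'" unfolding links_def
    using assms by (intro sum_mono2) auto
  finally show ?thesis .
qed

lemma card_le_links:
  assumes "finite A" "finite B" "\<And>a. a \<in> A \<Longrightarrow> nb a \<inter> B \<noteq> {}"
  shows "card A \<le> links A B"
proof -
  have "(\<Sum>a\<in>A. 1) \<le> links A B" unfolding links_def
    using assms by (intro sum_mono) (auto simp: Suc_le_eq card_gt_0_iff)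
  then show ?thesis by simp
qed

lemma ecount_mono: "finite B \<Longrightarrow> A \<subseteq> B \<Longrightarrow> ecount A \<le> ecount B"
  unfolding ecount_def by (rule card_mono) (auto intro: finite_subset[of _ "Pow B"])

lemma ecount_empty [simp]: "ecount {} = 0"
proof -
  have "{e \<in> E. e \<subseteq> {}} = {}" using card_edge by force
  then show ?thesis by (simp add: ecount_def)
qed

lemma ecount_insert:
  assumes "finite A" "a \<notin> A"
  shows "ecount (insert a A) = ecount A + card (nb a \<inter> A)"
proof -
  have "{e \<in> E. e \<subseteq> insert a A} = {e \<in> E. e \<subseteq> A} \<union> (\<lambda>b. {a, b}) ` (nb a \<inter> A)"
  proof (intro equalityI subsetI)
    fix e assume e: "e \<in> {e \<in> E. e \<subseteq> insert a A}"
    then have "card e = 2" using card_edge by auto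
    then obtain x y where xy: "e = {x, y}" "x \<noteq> y" by (meson card_2_iff)
    show "e \<in> {e \<in> E. e \<subseteq> A} \<union> (\<lambda>b. {a, b}) ` (nb a \<inter> A)"
    proof (cases "a \<in> e")
      case True
      then obtain b where b: "e = {a, b}" "b \<noteq> a" using xy by auto
      then have "b \<in> nb a \<inter> A" using e by (auto simp: nb_def)
      then show ?thesis using b by blast
    qed (use e in auto)
  next
    fix e assume "e \<in> {e \<in> E. e \<subseteq> A} \<union> (\<lambda>b. {a, b}) ` (nb a \<inter> A)"
    then show "e \<in> {e \<in> E. e \<subseteq> insert a A}" by (auto simp: nb_def)
  qed
  moreover have "card ((\<lambda>b. {a, b}) ` (nb a \<inter> A)) = card (nb a \<inter> A)"
    by (rule card_image) (auto simp: inj_on_def doubleton_eq_iff)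
  moreover have "{e \<in> E. e \<subseteq> A} \<inter> (\<lambda>b. {a, b}) ` (nb a \<inter> A) = {}"
    using assms by auto
  moreover have "finite {e \<in> E. e \<subseteq> A}"
    by (rule finite_subset[of _ "Pow A"]) (use assms in auto)
  ultimately show ?thesis
    unfolding ecount_def using assms by (simp add: card_Un_disjoint)
qed

lemma ecount_singleton [simp]: "ecount {a} = 0"
  using ecount_insert[of "{}" a] by simp

lemma ecount_Un:
  assumes "finite A" "finite B" "A \<inter> B = {}"
  shows "ecount (A \<union> B) = ecount A + ecount B + links A B"
  using assms(2,3)
proof (induction B)
  case empty
  then show ?case by (simp add: links_def)
next
  case (insert b B)
  have "ecount (A \<union> insert b B) = ecount (A \<union> B) + card (nb b \<inter> (A \<union> B))"
    using insert assms(1) ecount_insert[of "A \<union> B" b] by simp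
  also have "card (nb b \<inter> (A \<union> B)) = card (nb b \<inter> A) + card (nb b \<inter> B)"
    using insert assms(1) by (subst card_Un_disjoint[symmetric]) (auto simp: Int_Un_distrib)
  finally have "ecount (A \<union> insert b B)
      = ecount A + (ecount B + card (nb b \<inter> B)) + (links A B + card (nb b \<inter> A))"
    using insert by simp
  moreover have "links A (insert b B) = links A {b} + links A B"
    using insert links_Un_right[of "{b}" B A] by simp
  ultimately show ?case
    using insert assms(1) by (simp add: ecount_insert links_singleton_right)
qed

lemma handshake: "finite A \<Longrightarrow> links A A = 2 * ecount A"
proof (induction A rule: finite_induct)
  case empty
  then show ?case by (simp add: links_def)
next
  case (insert a A)
  have "links (insert a A) (insert a A) = card (nb a \<inter> insert a A) + links A (insert a A)"
    using insert by (simp add: links_insert_left)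
  also have "links A (insert a A) = links A {a} + links A A"
    using insert links_Un_right[of "{a}" A A] by simp
  also have "card (nb a \<inter> insert a A) = card (nb a \<inter> A)" by simp
  finally show ?case
    using insert by (simp add: ecount_insert links_singleton_right)
qed

section \<open>Degenerate sets\<close>

lemma degenerate_mono: "degenerate B \<Longrightarrow> A \<subseteq> B \<Longrightarrow> degenerate A"
  by (auto simp: degenerate_def)

lemma not_degenerateE:
  assumes "\<not> degenerate A"
  obtains H where "H \<subseteq> A" "H \<noteq> {}" "\<And>h. h \<in> H \<Longrightarrow> k - 1 \<le> card (nb h \<inter> H)"
proof -
  obtain H where H: "H \<subseteq> A" "H \<noteq> {}" "\<not> (\<exists>h\<in>H. card (nb h \<inter> H) < k - 1)"
    using assms unfolding degenerate_def by blast
  show ?thesis by (rule that[of H]) (use H in \<open>auto simp: not_less\<close>)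
qed

lemma degenerate_small:
  assumes "finite A" "card A < k"
  shows "degenerate A"
proof (unfold degenerate_def, intro allI impI)
  fix H assume H: "H \<subseteq> A" "H \<noteq> {}"
  then obtain h where h: "h \<in> H" by auto
  have fin: "finite H" using H assms finite_subset by auto
  have "card (nb h \<inter> H) \<le> card (H - {h})"
    using fin by (intro card_mono) auto
  also have "\<dots> = card H - 1" using h fin by simp
  also have "card H - 1 < k - 1"
    using h fin card_mono[OF assms(1) H(1)] assms(2) card_gt_0_iff[of H] by fastforce
  finally show "\<exists>h\<in>H. card (nb h \<inter> H) < k - 1" using h by auto
qed

text \<open>Without edges between the pieces, a vertex of H has all its H-neighbours in its own
  piece, so a low-degree vertex of one piece is one of H.\<close>

lemma degenerate_UN:
  assumes "\<And>C. C \<in> P \<Longrightarrow> degenerate (f C)"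
    and "\<And>C D a. C \<in> P \<Longrightarrow> D \<in> P \<Longrightarrow> C \<noteq> D \<Longrightarrow> a \<in> f C \<Longrightarrow> nb a \<inter> f D = {}"
  shows "degenerate (\<Union>C\<in>P. f C)"
proof (unfold degenerate_def, intro allI impI)
  fix H assume H: "H \<subseteq> (\<Union>C\<in>P. f C)" "H \<noteq> {}"
  then obtain C where C: "C \<in> P" "H \<inter> f C \<noteq> {}" by blast
  then obtain h where h: "h \<in> H \<inter> f C" "card (nb h \<inter> (H \<inter> f C)) < k - 1"
    using assms(1)[OF C(1)] unfolding degenerate_def by (metis Int_lower2)
  have "nb h \<inter> H = nb h \<inter> (H \<inter> f C)"
    using H assms(2)[OF C(1)] h by fastforce
  then show "\<exists>h\<in>H. card (nb h \<inter> H) < k - 1" using h by (intro bexI[of _ h]) auto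
qed

section \<open>Connected sets and components\<close>

lemma connD:
  assumes "conn A" "B \<subseteq> A" "B \<noteq> {}" "B \<noteq> A"
  obtains a b where "a \<in> B" "b \<in> A" "b \<notin> B" "b \<in> nb a"
  using assms unfolding conn_def by blast

lemma conn_closed_eq:
  assumes "conn A" "B \<subseteq> A" "B \<noteq> {}" "\<And>a. a \<in> B \<Longrightarrow> nb a \<inter> A \<subseteq> B"
  shows "B = A"
  using connD[OF assms(1-3)] assms(4) by blast

lemma comps_disjoint:
  assumes "C \<in> comps A" "D \<in> comps A" "C \<noteq> D"
  shows "C \<inter> D = {}"
proof (rule ccontr)
  assume ne: "C \<inter> D \<noteq> {}"
  have C: "C \<subseteq> A" "conn C" "\<And>a. a \<in> C \<Longrightarrow> nb a \<inter> A \<subseteq> C"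
    and D: "D \<subseteq> A" "conn D" "\<And>a. a \<in> D \<Longrightarrow> nb a \<inter> A \<subseteq> D"
    using assms by (auto simp: comps_def)
  have "C \<inter> D = C"
    by (rule conn_closed_eq[OF C(2)]) (use ne C(1) D(3) in blast)+
  moreover have "C \<inter> D = D"
    by (rule conn_closed_eq[OF D(2)]) (use ne D(1) C(3) in blast)+
  ultimately show False using assms(3) by auto
qed

lemma comps_nonadjacent:
  assumes "C \<in> comps A" "D \<in> comps A" "C \<noteq> D" "a \<in> C"
  shows "nb a \<inter> D = {}"
  using comps_disjoint[OF assms(1-3)] assms(1,2,4) unfolding comps_def by blast

text \<open>The component of x is a smallest set containing x that is closed under neighbours in A.
  If B cut it without an edge, then B or the complement of B in it would be a smaller set of this
  kind.\<close>

lemma comps_cover: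
  assumes "finite A" "x \<in> A"
  obtains C where "C \<in> comps A" "x \<in> C"
proof -
  define S where "S = {B. B \<subseteq> A \<and> x \<in> B \<and> (\<forall>a\<in>B. nb a \<inter> A \<subseteq> B)}"
  have "A \<in> S" using assms by (auto simp: S_def)
  then obtain C where C: "C \<in> S" and min: "\<And>B. B \<in> S \<Longrightarrow> card C \<le> card B"
    using exists_least_iff[of "\<lambda>n. \<exists>B\<in>S. card B = n"] by (metis not_le)
  have finC: "finite C" using C assms by (auto simp: S_def intro: finite_subset)
  have "conn C"
  proof (unfold conn_def, intro conjI allI impI)
    show "C \<noteq> {}" using C by (auto simp: S_def)
    fix B assume B: "B \<subseteq> C" "B \<noteq> {}" "B \<noteq> C"
    show "\<exists>a\<in>B. \<exists>b\<in>C - B. b \<in> nb a"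
    proof (rule ccontr)
      assume no: "\<not> ?thesis"
      then have no': "b \<notin> nb a" "a \<notin> nb b" if "a \<in> B" "b \<in> C - B" for a b
        using that by (auto simp: nb_sym[of a b])
      have "B \<in> S \<or> C - B \<in> S" using C B no' unfolding S_def by blast
      moreover have "card B < card C" using B finC by (intro psubset_card_mono) auto
      moreover have "card (C - B) < card C" using B finC by (intro psubset_card_mono) auto
      ultimately show False using min by (meson not_le)
    qed
  qed
  then have "C \<in> comps A" "x \<in> C" using C by (auto simp: S_def comps_def)
  then show ?thesis using that by blast
qed

lemma Union_comps:
  assumes "finite A"
  shows "\<Union> (comps A) = A"
proof
  show "A \<subseteq> \<Union> (comps A)" using comps_cover[OF assms] by blast
qed (auto simp: comps_def)

lemma comps_subset: "C \<in> comps A \<Longrightarrow> C \<subseteq> A"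
  by (simp add: comps_def)

lemma comps_conn: "C \<in> comps A \<Longrightarrow> conn C"
  by (simp add: comps_def)

lemma finite_comps: "finite A \<Longrightarrow> finite (comps A)"
  by (rule finite_subset[of _ "Pow A"]) (auto simp: comps_def)

lemma finite_comp: "finite A \<Longrightarrow> C \<in> comps A \<Longrightarrow> finite C"
  using comps_subset finite_subset by blast

lemma links_UN_left:
  assumes "finite A"
  shows "links A B = (\<Sum>C\<in>comps A. links C B)"
proof -
  have "links (\<Union> (comps A)) B = (\<Sum>C\<in>comps A. links C B)"
    unfolding links_def
    by (subst sum.Union_disjoint) (use assms finite_comp comps_disjoint in \<open>auto simp: \<close>)
  then show ?thesis using assms by (simp add: Union_comps)
qed

text \<open>Doubling both sides turns edge counts into degree sums, which split over disjoint
  sets.\<close>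

lemma ecount_comps:
  assumes "finite A"
  shows "ecount A = (\<Sum>C\<in>comps A. ecount C)"
proof -
  have "2 * ecount A = (\<Sum>C\<in>comps A. links C A)"
    using handshake[OF assms] links_UN_left[OF assms, of A] by simp
  also have "\<dots> = (\<Sum>C\<in>comps A. links C C)"
  proof (rule sum.cong)
    fix C assume C: "C \<in> comps A"
    have "nb a \<inter> A = nb a \<inter> C" if "a \<in> C" for a
      using C that by (auto simp: comps_def)
    then show "links C A = links C C" by (simp add: links_def)
  qed simp
  also have "\<dots> = (\<Sum>C\<in>comps A. 2 * ecount C)"
    using assms finite_comp handshake by (intro sum.cong) auto
  finally show ?thesis by (simp add: sum_distrib_left[symmetric])
qed

section \<open>The isolation number and its behaviour under deletion of a set\<close>

lemma iso_num_le:
  assumes "D \<subseteq> W" "degenerate (W - Z - cnb D)"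
  shows "iso_num Z W \<le> card D"
  unfolding iso_num_def using assms by (intro Least_le) auto

lemma degenerate_empty [simp]: "degenerate {}"
  by (simp add: degenerate_def)

lemma iso_numE:
  obtains D where "D \<subseteq> W" "degenerate (W - Z - cnb D)" "card D = iso_num Z W"
proof -
  have "W - Z - cnb W = {}" by (auto simp: cnb_def)
  then have "\<exists>n. \<exists>D\<subseteq>W. degenerate (W - Z - cnb D) \<and> card D = n"
    by (metis degenerate_empty order_refl)
  then have "\<exists>D\<subseteq>W. degenerate (W - Z - cnb D) \<and> card D = iso_num Z W"
    unfolding iso_num_def by (rule LeastI_ex)
  then show ?thesis using that by blast
qed

lemma iso_num_mono:
  assumes "Z \<subseteq> Z'"
  shows "iso_num Z' W \<le> iso_num Z W"
proof -
  obtain D where D: "D \<subseteq> W" "degenerate (W - Z - cnb D)" "card D = iso_num Z W"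
    by (rule iso_numE)
  have "degenerate (W - Z' - cnb D)" by (rule degenerate_mono[OF D(2)]) (use assms in auto)
  then show ?thesis using iso_num_le D by metis
qed

lemma iso_num_eq_0: "degenerate (W - Z) \<Longrightarrow> iso_num Z W = 0"
  using iso_num_le[of "{}" W Z] by (simp add: cnb_def)

text \<open>The isolating set consists of v and an optimal set for each component. The latter may
  disregard what v dominates, and since components are pairwise nonadjacent, degeneracy is checked
  in each of them alone.\<close>

lemma iso_num_comps:
  assumes "finite W" "v \<in> Y" "Y \<subseteq> cnb {v}" "Y \<subseteq> W"
  shows "io W \<le> 1 + (\<Sum>C\<in>comps (W - Y). iso_num (cnb {v}) C)"
proof -
  let ?P = "comps (W - Y)"
  have "\<forall>C. \<exists>D. D \<subseteq> C \<and> degenerate (C - cnb {v} - cnb D) \<and> card D = iso_num (cnb {v}) C"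
  proof
    fix C
    show "\<exists>D. D \<subseteq> C \<and> degenerate (C - cnb {v} - cnb D) \<and> card D = iso_num (cnb {v}) C"
      by (rule iso_numE[of C "cnb {v}"]) blast
  qed
  from choice[OF this] obtain D where D: "\<And>C. D C \<subseteq> C"
      "\<And>C. degenerate (C - cnb {v} - cnb (D C))" "\<And>C. card (D C) = iso_num (cnb {v}) C"
    by blast
  define X where "X = insert v (\<Union>C\<in>?P. D C)"
  have fin: "finite ?P" using assms(1) by (simp add: finite_comps)
  have un: "\<Union> ?P = W - Y" using assms by (simp add: Union_comps)
  have "D C \<subseteq> W" if "C \<in> ?P" for C
    using D(1)[of C] comps_subset[OF that] by blast
  then have "X \<subseteq> W" using assms(2,4) unfolding X_def by blast
  moreover have "degenerate (W - {} - cnb X)"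
  proof (rule degenerate_mono)
    show "degenerate (\<Union>C\<in>?P. C - cnb {v} - cnb (D C))"
    proof (rule degenerate_UN)
      fix C B a assume "C \<in> ?P" "B \<in> ?P" "C \<noteq> B" "a \<in> C - cnb {v} - cnb (D C)"
      then show "nb a \<inter> (B - cnb {v} - cnb (D B)) = {}"
        using comps_nonadjacent[of C "W - Y" B a] by auto
    qed (use D in auto)
    show "W - {} - cnb X \<subseteq> (\<Union>C\<in>?P. C - cnb {v} - cnb (D C))"
    proof
      fix w assume w: "w \<in> W - {} - cnb X"
      then have "w \<in> W - Y" using assms by (auto simp: X_def cnb_def)
      then obtain C where C: "C \<in> ?P" "w \<in> C" using un by blast
      then show "w \<in> (\<Union>C\<in>?P. C - cnb {v} - cnb (D C))"
        using w by (auto simp: X_def cnb_def)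
    qed
  qed
  ultimately have "io W \<le> card X" by (rule iso_num_le)
  also have "card X \<le> 1 + card (\<Union>C\<in>?P. D C)" by (simp add: X_def card_insert_le_m1)
  also have "card (\<Union>C\<in>?P. D C) \<le> (\<Sum>C\<in>?P. card (D C))" using fin by (intro card_UN_le) auto
  finally show ?thesis using D by simp
qed

text \<open>What a component adds to the excess: its own edges and its edges to \<open>Y\<close>,
  less \<open>t\<close> for every vertex that it still needs after v has been chosen.\<close>

definition surplus :: "'a \<Rightarrow> 'a set \<Rightarrow> 'a set \<Rightarrow> int" where
  "surplus v Y C = int (ecount C) + int (links C Y) - int t * int (iso_num (cnb {v}) C)"

lemma ecount_comps_Diff:
  assumes "finite W" "Y \<subseteq> W"
  shows "ecount W = ecount Y + (\<Sum>C\<in>comps (W - Y). ecount C + links C Y)"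
proof -
  have "ecount (Y \<union> (W - Y)) = ecount Y + ecount (W - Y) + links Y (W - Y)"
    using assms by (intro ecount_Un) (auto intro: finite_subset)
  moreover have "links Y (W - Y) = links (W - Y) Y"
    using assms by (intro links_sym) (auto intro: finite_subset)
  ultimately show ?thesis
    using assms ecount_comps[of "W - Y"] links_UN_left[of "W - Y" Y]
    by (simp add: sum.distrib Un_absorb1)
qed

text \<open>Each edge of W lies in Y, in a component, or between the two, so the edge count is
  exact; the only estimate is that of \<open>io W\<close>.\<close>

lemma excess_ge:
  assumes "finite W" "v \<in> Y" "Y \<subseteq> cnb {v}" "Y \<subseteq> W"
  shows "int (ecount Y) + 1 - int t + (\<Sum>C\<in>comps (W - Y). surplus v Y C)
       \<le> int (ecount W) + 1 - int t * int (io W)"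
proof -
  have "int t * int (io W) \<le> int t * int (1 + (\<Sum>C\<in>comps (W - Y). iso_num (cnb {v}) C))"
    using iso_num_comps[OF assms] by (intro mult_left_mono) (simp_all only: of_nat_le_iff of_nat_0_le_iff)
  also have "\<dots> = int t + (\<Sum>C\<in>comps (W - Y). int t * int (iso_num (cnb {v}) C))"
    by (simp add: distrib_left sum_distrib_left)
  finally show ?thesis
    using ecount_comps_Diff[OF assms(1,4)]
    by (simp add: surplus_def sum_subtractf sum.distrib)
qed

lemma links_pos:
  assumes "conn W" "finite W" "Y \<subseteq> W" "Y \<noteq> {}" "C \<in> comps (W - Y)"
  shows "1 \<le> links C Y"
proof -
  have C: "C \<subseteq> W - Y" "C \<noteq> {}"
    using comps_subset[OF assms(5)] comps_conn[OF assms(5)] unfolding conn_def by blast+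
  obtain a b where ab: "a \<in> C" "b \<in> W" "b \<notin> C" "b \<in> nb a"
    by (rule connD[OF assms(1), of C]) (use C assms(3,4) in auto)
  have "b \<in> Y" using ab assms(5) unfolding comps_def by blast
  then have "links C Y \<noteq> 0" using ab C assms(2,3)
    by (subst links_eq_0_iff) (auto intro: finite_subset)
  then show ?thesis by simp
qed

section \<open>Cliques and pendant cliques\<close>

lemma clq_nb: "clq Q \<Longrightarrow> a \<in> Q \<Longrightarrow> nb a \<inter> Q = Q - {a}"
  unfolding clq_def by (auto dest: bspec)

lemma clq_finite: "clq Q \<Longrightarrow> finite Q"
  by (simp add: clq_def)

lemma clq_card: "clq Q \<Longrightarrow> card Q = k"
  by (simp add: clq_def)

lemma clq_nonempty: "clq Q \<Longrightarrow> Q \<noteq> {}"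
  using clq_card k_pos by fastforce

lemma clq_degree: "clq Q \<Longrightarrow> a \<in> Q \<Longrightarrow> card (nb a \<inter> Q) = k - 1"
  by (simp add: clq_nb clq_finite clq_card)

lemma two_choose_two: "2 * (n choose 2) = n * (n - 1)"
proof -
  have "even (n * (n - 1))" by (cases n) auto
  then show ?thesis by (simp add: choose_two)
qed

lemma clq_ecount:
  assumes "clq Q"
  shows "ecount Q = k choose 2"
proof -
  have "2 * ecount Q = links Q Q" using handshake assms by (simp add: clq_finite)
  also have "\<dots> = k * (k - 1)"
    using assms by (simp add: links_def clq_degree clq_card)
  finally show ?thesis using two_choose_two[of k] by simp
qed

lemma clq_conn:
  assumes "clq Q"
  shows "conn Q"
proof (unfold conn_def, intro conjI allI impI)
  fix B assume B: "B \<subseteq> Q" "B \<noteq> {}" "B \<noteq> Q"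
  then obtain a b where "a \<in> B" "b \<in> Q - B" by blast
  moreover from this have "a \<noteq> b" by blast
  ultimately show "\<exists>a\<in>B. \<exists>b\<in>Q - B. b \<in> nb a" using assms B(1) unfolding clq_def by blast
qed (use assms clq_nonempty in simp)

lemma clq_not_degenerate:
  assumes "clq Q"
  shows "\<not> degenerate Q"
proof
  assume "degenerate Q"
  then obtain h where "h \<in> Q" "card (nb h \<inter> Q) < k - 1"
    using clq_nonempty[OF assms] unfolding degenerate_def by blast
  then show False using clq_degree[OF assms] by simp
qed

lemma clq_io:
  assumes "clq Q"
  shows "io Q \<le> 1"
proof -
  obtain a where a: "a \<in> Q" using clq_nonempty[OF assms] by blast
  have "Q - {} - cnb {a} = {}" using clq_nb[OF assms a] by (auto simp: cnb_def)
  then have "degenerate (Q - {} - cnb {a})" by (simp only: degenerate_empty)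
  then have "io Q \<le> card {a}" using a by (intro iso_num_le) simp_all
  then show ?thesis by simp
qed

lemma clq_subset_eq:
  assumes "clq Q" "clq C" "Q \<subseteq> C"
  shows "Q = C"
  by (rule card_subset_eq) (use assms in \<open>simp_all add: clq_card clq_finite\<close>)

lemma clq_degenerate_Diff:
  assumes "clq Q" "nb x \<inter> Q \<noteq> {}"
  shows "degenerate (Q - cnb {x})"
proof (rule degenerate_small)
  have "Q - cnb {x} \<subset> Q" using assms(2) by (auto simp: cnb_def)
  then show "card (Q - cnb {x}) < k"
    using psubset_card_mono[OF clq_finite[OF assms(1)]] clq_card[OF assms(1)] by metis
qed (use assms clq_finite in auto)

text \<open>The minimum degree forces at least k vertices, and with exactly k of them every vertex
  would be adjacent to all others.\<close>

lemma core_card: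
  assumes "finite H" "H \<noteq> {}" "\<And>h. h \<in> H \<Longrightarrow> k - 1 \<le> card (nb h \<inter> H)" "\<And>Q. Q \<subseteq> H \<Longrightarrow> \<not> clq Q"
  shows "k + 1 \<le> card H"
proof -
  have sub: "nb h \<inter> H \<subseteq> H - {h}" for h by auto
  obtain h where h: "h \<in> H" using assms(2) by blast
  have "k - 1 \<le> card (H - {h})"
    using assms(3)[OF h] card_mono[OF _ sub[of h]] assms(1) by (meson finite_Diff le_trans)
  moreover have "1 \<le> card H" using assms(1,2) by (simp add: Suc_le_eq card_gt_0_iff)
  ultimately have ge: "k \<le> card H" using h assms(1) by simp
  have "card H \<noteq> k"
  proof
    assume eq: "card H = k"
    have "nb h \<inter> H = H - {h}" if "h \<in> H" for h
      by (rule card_seteq) (use that assms(1) eq assms(3)[OF that] in auto)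
    then have "clq H" using assms(1) eq unfolding clq_def by auto
    then show False using assms(4) by blast
  qed
  then show ?thesis using ge by simp
qed

lemma core_ecount:
  assumes "finite H" "\<And>h. h \<in> H \<Longrightarrow> k - 1 \<le> card (nb h \<inter> H)"
  shows "card H * (k - 1) \<le> 2 * ecount H"
proof -
  have "(\<Sum>h\<in>H. k - 1) \<le> links H H" unfolding links_def using assms(2) by (rule sum_mono)
  then show ?thesis using handshake[OF assms(1)] by simp
qed

text \<open>The bound exceeds the edge count by one, so one edge to Y makes up for it.\<close>

lemma surplus_ge:
  assumes "t * io C \<le> ecount C + 1"
  shows "int (links C Y) - 1 \<le> surplus v Y C"
proof -
  have "t * iso_num (cnb {v}) C \<le> t * io C"
    using iso_num_mono[of "{}" "cnb {v}" C] by simp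
  then have "t * iso_num (cnb {v}) C \<le> ecount C + 1" using assms by (rule le_trans)
  then have "int t * int (iso_num (cnb {v}) C) \<le> int (ecount C) + 1"
    by (metis of_nat_1 of_nat_add of_nat_le_iff of_nat_mult)
  then show ?thesis by (simp add: surplus_def)
qed

lemma surplus_degenerate:
  assumes "degenerate (C - cnb {v})"
  shows "surplus v Y C = int (ecount C) + int (links C Y)"
  using iso_num_eq_0[OF assms] by (simp add: surplus_def)

text \<open>A clique has \<open>t - 2\<close> edges and may need one vertex, which is why two edges
  to Y have to make up for it.\<close>

lemma surplus_clq:
  assumes "clq C"
  shows "int (links C Y) - 2 \<le> surplus v Y C"
proof -
  have "iso_num (cnb {v}) C \<le> 1"
    using iso_num_mono[of "{}" "cnb {v}" C] clq_io[OF assms] by simp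
  then have "int t * int (iso_num (cnb {v}) C) \<le> int t * 1"
    by (intro mult_left_mono) simp_all
  moreover have "int t = int (ecount C) + 2" using clq_ecount[OF assms] by (simp add: t_def)
  ultimately show ?thesis unfolding surplus_def by linarith
qed

text \<open>If the edges from C to Y all end in x, then x alone already cuts C off. This reduces a
  component with a weak link to Y to the deletion of a single vertex.\<close>

lemma comps_delete:
  assumes "C \<in> comps (W - Y)" "x \<in> Y" "\<And>a. a \<in> C \<Longrightarrow> nb a \<inter> Y \<subseteq> {x}"
  shows "C \<in> comps (W - {x})"
proof -
  have C: "C \<subseteq> W - Y" "conn C" "\<And>a. a \<in> C \<Longrightarrow> nb a \<inter> (W - Y) \<subseteq> C"
    using assms(1) unfolding comps_def by blast+
  have "nb a \<inter> (W - {x}) \<subseteq> C" if "a \<in> C" for a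
    using C(3)[OF that] assms(3)[OF that] by blast
  moreover have "C \<subseteq> W - {x}" using C(1) assms(2) by blast
  ultimately show ?thesis using C(2) unfolding comps_def by blast
qed

lemma single_link:
  assumes "finite C" "finite Y" "links C Y = 1"
  obtains x y where "x \<in> Y" "y \<in> C" "nb x \<inter> C = {y}" "nb y \<inter> Y = {x}"
    "\<And>a. a \<in> C \<Longrightarrow> nb a \<inter> Y \<subseteq> {x}" "\<And>a. a \<in> C \<Longrightarrow> a \<noteq> y \<Longrightarrow> nb a \<inter> Y = {}"
proof -
  obtain y where y: "y \<in> C" "card (nb y \<inter> Y) = 1" "\<And>b. b \<in> C \<Longrightarrow> y \<noteq> b \<Longrightarrow> card (nb b \<inter> Y) = 0"
    using assms(1,3) unfolding links_def by (subst (asm) sum_eq_1_iff) auto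
  obtain x where x: "nb y \<inter> Y = {x}" using y(2) by (rule card_1_singletonE)
  have z: "nb b \<inter> Y = {}" if "b \<in> C" "b \<noteq> y" for b
    using y(3)[OF that(1)] that(2) assms(2) by auto
  have "nb x \<inter> C = {y}"
    using x y(1) z nb_sym by blast
  then show ?thesis using that[of x y] x y(1) z by blast
qed

text \<open>Since no vertex of Y meets all edges from C, two different vertices of Y are reached.
  Each accounts for at least one edge, so a total of two leaves none for the rest of Y.\<close>

lemma links_ge_2:
  assumes "finite C" "finite Y" "\<And>x. x \<in> Y \<Longrightarrow> \<exists>a\<in>C. \<not> nb a \<inter> Y \<subseteq> {x}" "Y \<noteq> {}"
  obtains w1 w2 u1 u2 where "w1 \<in> Y" "w2 \<in> Y" "w1 \<noteq> w2" "u1 \<in> nb w1 \<inter> C" "u2 \<in> nb w2 \<inter> C"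
    "2 \<le> links C Y"
    "links C Y = 2 \<longrightarrow> nb w1 \<inter> C = {u1} \<and> nb w2 \<inter> C = {u2} \<and> (\<forall>w\<in>Y - {w1, w2}. nb w \<inter> C = {})"
proof -
  obtain y0 where "y0 \<in> Y" using assms(4) by blast
  then obtain u1 w1 where 1: "u1 \<in> C" "w1 \<in> Y" "w1 \<in> nb u1" using assms(3) by blast
  then obtain u2 w2 where 2: "u2 \<in> C" "w2 \<in> Y" "w2 \<in> nb u2" "w2 \<noteq> w1" using assms(3)[of w1] by blast
  have u: "u1 \<in> nb w1 \<inter> C" "u2 \<in> nb w2 \<inter> C" using 1 2 nb_sym by blast+
  have c: "1 \<le> card (nb w1 \<inter> C)" "1 \<le> card (nb w2 \<inter> C)"
    using u assms(1) card_gt_0_iff by (metis One_nat_def Suc_le_eq empty_iff finite_Int)+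
  have "links C Y = links Y C" using assms by (simp add: links_sym)
  also have "\<dots> = links ({w1} \<union> ({w2} \<union> (Y - {w1, w2}))) C"
    using 1 2 by (intro arg_cong2[where f = links]) auto
  also have "\<dots> = card (nb w1 \<inter> C) + (card (nb w2 \<inter> C) + links (Y - {w1, w2}) C)"
    using 2(4) assms(2) by (subst links_Un_left | simp)+
  finally have eq: "links C Y = card (nb w1 \<inter> C) + (card (nb w2 \<inter> C) + links (Y - {w1, w2}) C)" .
  show ?thesis
  proof (rule that[of w1 w2 u1 u2])
    show "2 \<le> links C Y" using eq c by simp
    show "links C Y = 2 \<longrightarrow> nb w1 \<inter> C = {u1} \<and> nb w2 \<inter> C = {u2} \<and> (\<forall>w\<in>Y - {w1, w2}. nb w \<inter> C = {})"
    proof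
      assume "links C Y = 2"
      then have *: "card (nb w1 \<inter> C) = 1" "card (nb w2 \<inter> C) = 1" "links (Y - {w1, w2}) C = 0"
        using eq c by linarith+
      have "nb w1 \<inter> C = {u1}" using *(1) u(1) by (metis card_1_singletonE singletonD)
      moreover have "nb w2 \<inter> C = {u2}" using *(2) u(2) by (metis card_1_singletonE singletonD)
      moreover have "\<forall>w\<in>Y - {w1, w2}. nb w \<inter> C = {}"
        using *(3) assms by (subst (asm) links_eq_0_iff) auto
      ultimately show "nb w1 \<inter> C = {u1} \<and> nb w2 \<inter> C = {u2} \<and> (\<forall>w\<in>Y - {w1, w2}. nb w \<inter> C = {})"
        by blast
    qed
  qed (use 1 2 u in auto)
qed

text \<open>\<open>S\<close> is the set of feet. Vertices besides the feet and the cliques are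
  allowed, so that the lower bound also covers special graphs with a nontrivial tree
  \<open>T'\<close>.\<close>

definition pendant :: "'a set \<Rightarrow> 'a set \<Rightarrow> ('a \<Rightarrow> 'a set) \<Rightarrow> ('a \<Rightarrow> 'a) \<Rightarrow> bool" where
  "pendant W S U u \<longleftrightarrow> S \<subseteq> W \<and>
     (\<forall>v\<in>S. U v \<subseteq> W \<and> U v \<inter> S = {} \<and> card (U v) = k \<and> u v \<in> U v \<and>
        (\<forall>a\<in>U v. nb a \<inter> W = (U v - {a}) \<union> (if a = u v then {v} else {}))) \<and>
     (\<forall>v\<in>S. \<forall>v'\<in>S. v \<noteq> v' \<longrightarrow> U v \<inter> U v' = {})"

text \<open>That \<open>S\<close> induces a tree is not demanded: it follows from the number of edges once the bound
  is attained.\<close>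
definition pure :: "'a set \<Rightarrow> 'a set \<Rightarrow> ('a \<Rightarrow> 'a set) \<Rightarrow> ('a \<Rightarrow> 'a) \<Rightarrow> bool" where
  "pure W S U u \<longleftrightarrow> pendant W S U u \<and> conn S \<and> W = S \<union> (\<Union>v\<in>S. U v)"

lemma pure_pendant: "pure W S U u \<Longrightarrow> pendant W S U u"
  and pure_conn: "pure W S U u \<Longrightarrow> conn S"
  and pure_eq: "pure W S U u \<Longrightarrow> W = S \<union> (\<Union>v\<in>S. U v)"
  unfolding pure_def by blast+

lemma pendantD:
  assumes "pendant W S U u" "v \<in> S"
  shows "v \<in> W" "U v \<subseteq> W" "U v \<inter> S = {}" "card (U v) = k" "u v \<in> U v" "v \<notin> U v"
    and "a \<in> U v \<Longrightarrow> nb a \<inter> W = (U v - {a}) \<union> (if a = u v then {v} else {})"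
    and "v' \<in> S \<Longrightarrow> v \<noteq> v' \<Longrightarrow> U v \<inter> U v' = {}"
proof -
  have S: "S \<subseteq> W" and v: "U v \<subseteq> W \<and> U v \<inter> S = {} \<and> card (U v) = k \<and> u v \<in> U v \<and>
      (\<forall>a\<in>U v. nb a \<inter> W = (U v - {a}) \<union> (if a = u v then {v} else {}))"
    and d: "\<forall>v'\<in>S. v \<noteq> v' \<longrightarrow> U v \<inter> U v' = {}"
    using assms unfolding pendant_def by simp_all
  show "v \<in> W" "U v \<subseteq> W" "U v \<inter> S = {}" "card (U v) = k" "u v \<in> U v" "v \<notin> U v"
    using S v assms(2) by blast+
  show "a \<in> U v \<Longrightarrow> nb a \<inter> W = (U v - {a}) \<union> (if a = u v then {v} else {})"
    using v by simp
  show "v' \<in> S \<Longrightarrow> v \<noteq> v' \<Longrightarrow> U v \<inter> U v' = {}" using d by simp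
qed

lemma pendant_clq:
  assumes "pendant W S U u" "v \<in> S"
  shows "clq (U v)"
proof -
  have "finite (U v)" using pendantD(4)[OF assms] k_pos card_ge_0_finite by force
  moreover have "b \<in> nb a" if "a \<in> U v" "b \<in> U v" "a \<noteq> b" for a b
    using pendantD(2,7)[OF assms] that by blast
  ultimately show ?thesis using pendantD(4)[OF assms] by (simp add: clq_def)
qed

lemma pendant_nb:
  assumes "pendant W S U u" "v \<in> S"
  shows "nb v \<inter> U v = {u v}"
proof -
  have "a = u v" if "a \<in> nb v \<inter> U v" for a
  proof (rule ccontr)
    assume "a \<noteq> u v"
    then have "v \<notin> nb a" using pendantD(7)[OF assms, of a] pendantD(1,6)[OF assms] that by auto
    then show False using that nb_sym by blast
  qed
  moreover have "u v \<in> nb v"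
    using pendantD(7)[OF assms, of "u v"] pendantD(5)[OF assms] nb_sym by auto
  ultimately show ?thesis using pendantD(5)[OF assms] by blast
qed

lemma pendant_nonadjacent:
  assumes "pendant W S U u" "v \<in> S" "v' \<in> S" "v \<noteq> v'" "a \<in> U v"
  shows "nb a \<inter> U v' = {}"
proof -
  have "nb a \<inter> U v' \<subseteq> nb a \<inter> W \<inter> U v'" using pendantD(2)[OF assms(1,3)] by blast
  also have "\<dots> = {}"
    using pendantD(7)[OF assms(1,2,5)] pendantD(8)[OF assms(1,2,3,4)] pendantD(3)[OF assms(1,3)] assms(2)
    by auto
  finally show ?thesis by blast
qed

text \<open>The closed neighbourhoods of the pendant cliques, \<open>insert v (U v)\<close>, are disjoint.\<close>
lemma pendant_card_le:
  assumes "pendant W S U u" "finite D" "D \<subseteq> W" "\<And>v. v \<in> S \<Longrightarrow> \<not> U v \<subseteq> W - cnb D"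
  shows "card S \<le> card D"
proof -
  have "\<exists>d\<in>D. d \<in> insert v (U v)" if v: "v \<in> S" for v
  proof -
    obtain a where a: "a \<in> U v" "a \<in> cnb D"
      using assms(4)[OF v] pendantD(2)[OF assms(1) v] by blast
    then obtain d where d: "d \<in> D" "a = d \<or> a \<in> nb d" by (auto simp: cnb_def)
    then have "d = a \<or> d \<in> nb a \<inter> W" using nb_sym assms(3) by blast
    then have "d \<in> insert v (U v)"
      using a(1) pendantD(7)[OF assms(1) v a(1)] by (auto split: if_splits)
    then show ?thesis using d(1) by blast
  qed
  then obtain f where f: "\<And>v. v \<in> S \<Longrightarrow> f v \<in> D" "\<And>v. v \<in> S \<Longrightarrow> f v \<in> insert v (U v)"
    by metis
  have "inj_on f S"
  proof (rule inj_onI, rule ccontr)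
    fix v v' assume *: "v \<in> S" "v' \<in> S" "f v = f v'" "v \<noteq> v'"
    then show False
      using f(2)[of v] f(2)[of v'] pendantD(3)[OF assms(1), of v] pendantD(3)[OF assms(1), of v']
        pendantD(8)[OF assms(1) *(1,2,4)] by auto
  qed
  then show ?thesis using f(1) assms(2) by (intro card_inj_on_le[of f]) auto
qed

lemma pure_finite: "pure W S U u \<Longrightarrow> finite W \<Longrightarrow> finite S"
  unfolding pure_def pendant_def using finite_subset by blast

lemma pure_card_le_io:
  assumes "pure W S U u" "finite W"
  shows "card S \<le> io W"
proof -
  note p = pure_pendant[OF assms(1)]
  obtain D where D: "D \<subseteq> W" "degenerate (W - {} - cnb D)" "card D = io W" by (rule iso_numE)
  have "\<not> U v \<subseteq> W - cnb D" if "v \<in> S" for v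
    using degenerate_mono[OF D(2), of "U v"] clq_not_degenerate[OF pendant_clq[OF p that]] by auto
  then have "card S \<le> card D"
    by (intro pendant_card_le[OF p]) (use D(1) assms(2) finite_subset in auto)
  then show ?thesis using D(3) by simp
qed

text \<open>Each punctured clique has only \<open>k - 1\<close> vertices, and different pendant
  cliques are nonadjacent.\<close>

lemma pendant_punctured_degenerate:
  assumes "pendant W S U u" "\<And>v. v \<in> S \<Longrightarrow> g v \<in> U v"
  shows "degenerate (\<Union>v\<in>S. U v - {g v})"
proof (rule degenerate_UN)
  fix v assume v: "v \<in> S"
  have "clq (U v)" using pendant_clq[OF assms(1) v] .
  then show "degenerate (U v - {g v})"
    using assms(2)[OF v] k_pos by (intro degenerate_small) (auto simp: clq_finite clq_card)
next
  fix v v' a assume "v \<in> S" "v' \<in> S" "v \<noteq> v'" "a \<in> U v - {g v}"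
  then show "nb a \<inter> (U v' - {g v'}) = {}"
    using pendant_nonadjacent[OF assms(1)] by blast
qed

text \<open>For the upper bound the feet themselves are chosen: they dominate all feet and one
  vertex of every clique.\<close>

lemma pure_io:
  assumes "pure W S U u" "finite W"
  shows "io W = card S"
proof (rule antisym)
  note p = pure_pendant[OF assms(1)] and W = pure_eq[OF assms(1)]
  have "degenerate (W - {} - cnb S)"
  proof (rule degenerate_mono)
    show "degenerate (\<Union>v\<in>S. U v - {u v})"
      by (rule pendant_punctured_degenerate[OF p]) (use pendantD(5)[OF p] in auto)
    show "W - {} - cnb S \<subseteq> (\<Union>v\<in>S. U v - {u v})"
      using W pendant_nb[OF p] by (fastforce simp: cnb_def)
  qed
  then show "io W \<le> card S" using W by (intro iso_num_le) auto
qed (use pure_card_le_io assms in blast)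

text \<open>If there is another foot, then v can be left out of S: it is dominated by an adjacent
  foot, and its clique loses y to x.\<close>

lemma pure_iso_num_less:
  assumes "pure W S U u" "finite W" "v \<in> S" "S \<noteq> {v}" "y \<in> U v" "y \<in> nb x"
  shows "iso_num (cnb {x}) W < card S"
proof -
  note p = pure_pendant[OF assms(1)] and W = pure_eq[OF assms(1)] and c = pure_conn[OF assms(1)]
  have finS: "finite S" using pure_finite assms(1,2) by blast
  \<comment> \<open>The vertex missing from each clique: y, dominated by x, for the clique at v, and
    the neighbour of the foot for the others.\<close>
  let ?g = "\<lambda>s. if s = v then y else u s"
  obtain b where b: "b \<in> S" "b \<noteq> v" "b \<in> nb v"
    by (rule connD[OF c, of "{v}"]) (use assms(3,4) in auto)
  have "degenerate (W - cnb {x} - cnb (S - {v}))"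
  proof (rule degenerate_mono)
    show "degenerate (\<Union>s\<in>S. U s - {?g s})"
      by (rule pendant_punctured_degenerate[OF p]) (use pendantD(5)[OF p] assms(5) in auto)
    show "W - cnb {x} - cnb (S - {v}) \<subseteq> (\<Union>s\<in>S. U s - {?g s})"
    proof
      fix w assume w: "w \<in> W - cnb {x} - cnb (S - {v})"
      have "w \<notin> S"
      proof
        assume "w \<in> S"
        then have "w = v" using w by (auto simp: cnb_def)
        moreover have "v \<in> nb b" using b nb_sym by blast
        ultimately show False using w b by (auto simp: cnb_def)
      qed
      then obtain s where s: "s \<in> S" "w \<in> U s" using w W by blast
      have "w \<noteq> ?g s"
      proof (cases "s = v")
        case True
        then show ?thesis using w assms(6) by (auto simp: cnb_def)
      next
        case False
        then show ?thesis using w s pendant_nb[OF p s(1)] by (auto simp: cnb_def)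
      qed
      then show "w \<in> (\<Union>s\<in>S. U s - {?g s})" using s by blast
    qed
  qed
  then have "iso_num (cnb {x}) W \<le> card (S - {v})" using W by (intro iso_num_le) auto
  also have "\<dots> < card S" using assms(3) finS by (intro psubset_card_mono) auto
  finally show ?thesis .
qed

text \<open>Without y the clique has too few vertices to violate degeneracy, so v would have to take
  part. But v has at most the one neighbour \<open>u v\<close>: too few for \<open>k >= 3\<close>,
  and gone for k = 2 if it equals y.\<close>

lemma pure_single_degenerate:
  assumes "pure W {v} U u" "y \<in> U v" "y \<in> nb x" "3 \<le> k \<or> k = 2 \<and> y = u v"
  shows "degenerate (W - cnb {x})"
proof (unfold degenerate_def, intro allI impI)
  note p = pure_pendant[OF assms(1)]
  have W: "W = insert v (U v)" using pure_eq[OF assms(1)] by simp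
  note clq = pendant_clq[OF p, of v, simplified]
  fix H assume H: "H \<subseteq> W - cnb {x}" "H \<noteq> {}"
  have y: "y \<notin> H" using H assms(3) by (auto simp: cnb_def)
  have nbv: "nb v \<inter> U v = {u v}" using pendant_nb[OF p] by simp
  show "\<exists>h\<in>H. card (nb h \<inter> H) < k - 1"
  proof (cases "v \<in> H")
    case True
    have sub: "nb v \<inter> H \<subseteq> {u v} - {y}" using nbv H W y by auto
    have "card (nb v \<inter> H) < k - 1"
    proof (cases "y = u v")
      case True
      then show ?thesis using sub assms(4) by auto
    next
      case False
      have "card (nb v \<inter> H) \<le> card ({u v} - {y})" using sub by (intro card_mono) auto
      then show ?thesis using assms(4) False by auto
    qed
    then show ?thesis using True by blast
  next
    case False
    then have "H \<subseteq> U v - {y}" using H W y by auto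
    moreover have "degenerate (U v - {y})"
      using clq assms(2) k_pos by (intro degenerate_small) (auto simp: clq_finite clq_card)
    ultimately show ?thesis using H(2) unfolding degenerate_def by blast
  qed
qed

lemma pure_singleI:
  assumes "W = insert v A" "v \<notin> A" "card A = k" "u \<in> A"
    "\<And>a. a \<in> A \<Longrightarrow> nb a \<inter> W = (A - {a}) \<union> (if a = u then {v} else {})"
  shows "pure W {v} (\<lambda>_. A) (\<lambda>_. u)"
proof -
  have "conn {v}" by (auto simp: conn_def)
  moreover have "A \<subseteq> W" using assms(1) by blast
  ultimately show ?thesis using assms unfolding pure_def pendant_def by simp
qed

text \<open>The cases left open by \<open>pure_single_degenerate\<close>: for k = 1 the set W is an
  edge between v and y, for k = 2 a path of three vertices with ends v and y. Reversing it makes y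
  the foot.\<close>

lemma pure_single_relabel:
  assumes "pure W {v} U u" "y \<in> U v" "k = 1 \<or> k = 2 \<and> y \<noteq> u v"
  shows "\<exists>U' u'. pure W {y} U' u'"
proof -
  note p = pure_pendant[OF assms(1)]
  have W: "W = insert v (U v)" using pure_eq[OF assms(1)] by simp
  have card: "card (U v) = k" and u: "u v \<in> U v" and vU: "v \<notin> U v"
    and nbU: "\<And>a. a \<in> U v \<Longrightarrow> nb a \<inter> W = (U v - {a}) \<union> (if a = u v then {v} else {})"
    using pendantD[OF p, of v] by auto
  have nbv: "nb v \<inter> W = {u v}" using pendant_nb[OF p, of v] W by auto
  from assms(3) show ?thesis
  proof
    assume "k = 1"
    then have U: "U v = {y}" "u v = y" using card assms(2) u by (auto simp: card_1_singleton_iff)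
    have "pure W {y} (\<lambda>_. {v}) (\<lambda>_. v)"
      by (rule pure_singleI) (use W U vU nbv \<open>k = 1\<close> in auto)
    then show ?thesis by blast
  next
    assume k2: "k = 2 \<and> y \<noteq> u v"
    have "card (U v) = 2" using card k2 by simp
    then have U: "U v = {y, u v}" using assms(2) u k2 by (auto simp: card_2_iff)
    have n: "nb (u v) \<inter> W = {y, v}" using nbU[of "u v"] u U k2 by auto
    have W': "W = {y, u v, v}" using W U by blast
    have "pure W {y} (\<lambda>_. {u v, v}) (\<lambda>_. u v)"
    proof (rule pure_singleI)
      show "card {u v, v} = k" using k2 vU u by (metis card_2_iff)
      fix a assume "a \<in> {u v, v}"
      then show "nb a \<inter> W = {u v, v} - {a} \<union> (if a = u v then {y} else {})"
        using n nbv vU u by (elim insertE) auto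
    qed (use W' k2 vU assms(2) in auto)
    then show ?thesis by blast
  qed
qed

text \<open>If y lies in a pendant clique, x saves a vertex by dominating it, except in the small
  symmetric cases, where y can be made the foot.\<close>

lemma pure_relabel:
  assumes "pure W S U u" "finite W" "y \<in> W" "y \<in> nb x" "card S \<le> iso_num (cnb {x}) W"
  shows "\<exists>S' U' u'. pure W S' U' u' \<and> y \<in> S'"
proof (cases "y \<in> S")
  case True
  then show ?thesis using assms(1) by auto
next
  case False
  then obtain v where v: "v \<in> S" "y \<in> U v" using assms(1,3) unfolding pure_def by blast
  then have S: "S = {v}" using pure_iso_num_less[OF assms(1,2)] assms(4,5) by (meson not_le)
  have "\<not> degenerate (W - cnb {x})" using iso_num_eq_0[of W "cnb {x}"] assms(5) S by auto
  then have "\<not> (3 \<le> k \<or> k = 2 \<and> y = u v)"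
    using pure_single_degenerate[of W v U u y x] assms(1,4) v(2) S by blast
  then have "k = 1 \<or> k = 2 \<and> y \<noteq> u v" using k_pos by linarith
  then show ?thesis using pure_single_relabel[of W v U u y] assms(1) v(2) S by blast
qed

section \<open>Cycles with four and five vertices\<close>

definition cyc4 :: "'a set \<Rightarrow> bool" where
  "cyc4 W \<longleftrightarrow> (\<exists>a b c d. W = {a, b, c, d} \<and> distinct [a, b, c, d] \<and>
     b \<in> nb a \<and> c \<in> nb b \<and> d \<in> nb c \<and> a \<in> nb d \<and> c \<notin> nb a \<and> d \<notin> nb b)"

definition cyc5 :: "'a set \<Rightarrow> bool" where
  "cyc5 W \<longleftrightarrow> (\<exists>a b c d e. W = {a, b, c, d, e} \<and> distinct [a, b, c, d, e] \<and>
     b \<in> nb a \<and> c \<in> nb b \<and> d \<in> nb c \<and> e \<in> nb d \<and> a \<in> nb e \<and>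
     c \<notin> nb a \<and> d \<notin> nb a \<and> d \<notin> nb b \<and> e \<notin> nb b \<and> e \<notin> nb c)"

text \<open>The defining conditions are invariant under rotation of the list, so it may start at any
  given vertex.\<close>

lemma cyc4E:
  assumes "cyc4 W" "y \<in> W"
  obtains b c d where "W = {y, b, c, d}" "distinct [y, b, c, d]"
    "nb y \<inter> W = {b, d}" "nb b \<inter> W = {y, c}" "nb c \<inter> W = {b, d}" "nb d \<inter> W = {c, y}"
proof -
  note ob = that
  have *: thesis if h: "W = {y, b, c, d}" "distinct [y, b, c, d]"
    "b \<in> nb y" "c \<in> nb b" "d \<in> nb c" "y \<in> nb d" "c \<notin> nb y" "d \<notin> nb b" for b c d
  proof -
    have "y \<in> nb b" "b \<in> nb c" "c \<in> nb d" "d \<in> nb y" "y \<notin> nb c" "b \<notin> nb d"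
      using h nb_sym by blast+
    with h show thesis by (intro ob[of b c d]) auto
  qed
  obtain a b c d where h: "W = {a, b, c, d}" "distinct [a, b, c, d]"
     "b \<in> nb a" "c \<in> nb b" "d \<in> nb c" "a \<in> nb d" "c \<notin> nb a" "d \<notin> nb b"
    using assms(1) unfolding cyc4_def by blast
  have n: "a \<notin> nb c" "b \<notin> nb d" using h nb_sym by blast+
  from assms(2) h(1) consider "y = a" | "y = b" | "y = c" | "y = d" by blast
  then show thesis
  proof cases
    case 1 show thesis by (rule *[of b c d]) (use h n 1 in auto)
  next
    case 2 show thesis by (rule *[of c d a]) (use h n 2 in auto)
  next
    case 3 show thesis by (rule *[of d a b]) (use h n 3 in auto)
  next
    case 4 show thesis by (rule *[of a b c]) (use h n 4 in auto)
  qed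
qed

lemma cyc5E:
  assumes "cyc5 W" "y \<in> W"
  obtains b c d e where "W = {y, b, c, d, e}" "distinct [y, b, c, d, e]"
    "nb y \<inter> W = {b, e}" "nb b \<inter> W = {y, c}" "nb c \<inter> W = {b, d}" "nb d \<inter> W = {c, e}" "nb e \<inter> W = {d, y}"
proof -
  note ob = that
  have *: thesis if h: "W = {y, b, c, d, e}" "distinct [y, b, c, d, e]"
    "b \<in> nb y" "c \<in> nb b" "d \<in> nb c" "e \<in> nb d" "y \<in> nb e"
     "c \<notin> nb y" "d \<notin> nb y" "d \<notin> nb b" "e \<notin> nb b" "e \<notin> nb c" for b c d e
  proof -
    have "y \<in> nb b" "b \<in> nb c" "c \<in> nb d" "d \<in> nb e" "e \<in> nb y"
      "y \<notin> nb c" "y \<notin> nb d" "b \<notin> nb d" "b \<notin> nb e" "c \<notin> nb e"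
      using h nb_sym by blast+
    with h show thesis by (intro ob[of b c d e]) auto
  qed
  obtain a b c d e where h: "W = {a, b, c, d, e}" "distinct [a, b, c, d, e]"
     "b \<in> nb a" "c \<in> nb b" "d \<in> nb c" "e \<in> nb d" "a \<in> nb e"
     "c \<notin> nb a" "d \<notin> nb a" "d \<notin> nb b" "e \<notin> nb b" "e \<notin> nb c"
    using assms(1) unfolding cyc5_def by blast
  have n: "a \<notin> nb c" "a \<notin> nb d" "b \<notin> nb d" "b \<notin> nb e" "c \<notin> nb e"
    using h nb_sym by blast+
  from assms(2) h(1) consider "y = a" | "y = b" | "y = c" | "y = d" | "y = e" by blast
  then show thesis
  proof cases
    case 1 show thesis by (rule *[of b c d e]) (use h n 1 in auto)
  next
    case 2 show thesis by (rule *[of c d e a]) (use h n 2 in auto)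
  next
    case 3 show thesis by (rule *[of d e a b]) (use h n 3 in auto)
  next
    case 4 show thesis by (rule *[of e a b c]) (use h n 4 in auto)
  next
    case 5 show thesis by (rule *[of a b c d]) (use h n 5 in auto)
  qed
qed

lemma cyc4_ecount:
  assumes "cyc4 W"
  shows "ecount W = 4"
proof -
  obtain y where y: "y \<in> W" using assms unfolding cyc4_def by blast
  obtain b c d where h: "W = {y, b, c, d}" "distinct [y, b, c, d]"
    "nb y \<inter> W = {b, d}" "nb b \<inter> W = {y, c}" "nb c \<inter> W = {b, d}" "nb d \<inter> W = {c, y}"
    by (rule cyc4E[OF assms y])
  have "2 * ecount W = links W W" using handshake h(1) by simp
  also have "\<forall>a\<in>{y, b, c, d}. card (nb a \<inter> W) = 2" using h(2-) by auto
  then have "links W W = (\<Sum>a\<in>W. 2)"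
    unfolding links_def h(1)[symmetric] by (intro sum.cong) simp_all
  finally show ?thesis using h(1,2) by simp
qed

lemma cyc5_ecount:
  assumes "cyc5 W"
  shows "ecount W = 5"
proof -
  obtain y where y: "y \<in> W" using assms unfolding cyc5_def by blast
  obtain b c d e where h: "W = {y, b, c, d, e}" "distinct [y, b, c, d, e]"
    "nb y \<inter> W = {b, e}" "nb b \<inter> W = {y, c}" "nb c \<inter> W = {b, d}" "nb d \<inter> W = {c, e}" "nb e \<inter> W = {d, y}"
    by (rule cyc5E[OF assms y])
  have "2 * ecount W = links W W" using handshake h(1) by simp
  also have "\<forall>a\<in>{y, b, c, d, e}. card (nb a \<inter> W) = 2" using h(2-) by auto
  then have "links W W = (\<Sum>a\<in>W. 2)"
    unfolding links_def h(1)[symmetric] by (intro sum.cong) simp_all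
  finally show ?thesis using h(1,2) by simp
qed

text \<open>Removing y leaves a path with middle vertex c. A subset of it has a vertex with at most
  one neighbour in it, which is less than \<open>k - 1 = 2\<close>.\<close>

lemma cyc4_degenerate:
  assumes "cyc4 W" "k = 3" "y \<in> W" "y \<in> nb x"
  shows "degenerate (W - cnb {x})"
proof -
  obtain b c d where h: "W = {y, b, c, d}" "distinct [y, b, c, d]"
    "nb y \<inter> W = {b, d}" "nb b \<inter> W = {y, c}" "nb c \<inter> W = {b, d}" "nb d \<inter> W = {c, y}"
    by (rule cyc4E[OF assms(1,3)])
  have sub: "W - cnb {x} \<subseteq> {b, c, d}" using h(1) assms(4) by (auto simp: cnb_def)
  have "degenerate {b, c, d}"
  proof (unfold degenerate_def, intro allI impI)
    fix H assume H: "H \<subseteq> {b, c, d}" "H \<noteq> {}"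
    show "\<exists>h\<in>H. card (nb h \<inter> H) < k - 1"
    proof (cases "b \<in> H \<or> d \<in> H")
      case True
      have "H \<subseteq> W" "y \<notin> H" using H(1) h(1,2) by auto
      then have "nb b \<inter> H \<subseteq> {c}" "nb d \<inter> H \<subseteq> {c}" using h(4,6) by blast+
      then have "card (nb b \<inter> H) \<le> card {c}" "card (nb d \<inter> H) \<le> card {c}"
        by (auto intro!: card_mono simp del: card.insert)
      then have "card (nb b \<inter> H) < k - 1" "card (nb d \<inter> H) < k - 1" using assms(2) by simp_all
      then show ?thesis using True by blast
    next
      case False
      then have "H = {c}" using H by auto
      then show ?thesis using assms(2) by simp
    qed
  qed
  then show ?thesis using sub by (rule degenerate_mono)
qed

text \<open>With y dominated from outside, c takes care of itself, b and d, and e is left without a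
  partner.\<close>

lemma cyc5_iso_num:
  assumes "cyc5 W" "k = 2" "y \<in> W" "y \<in> nb x"
  shows "iso_num (cnb {x}) W \<le> 1"
proof -
  obtain b c d e where h: "W = {y, b, c, d, e}" "distinct [y, b, c, d, e]"
    "nb y \<inter> W = {b, e}" "nb b \<inter> W = {y, c}" "nb c \<inter> W = {b, d}" "nb d \<inter> W = {c, e}" "nb e \<inter> W = {d, y}"
    by (rule cyc5E[OF assms(1,3)])
  have "b \<in> nb c" "d \<in> nb c" using h by auto
  then have sub: "W - cnb {x} - cnb {c} \<subseteq> {e}" using h(1) assms(4) by (auto simp: cnb_def)
  have "degenerate (W - cnb {x} - cnb {c})"
    by (rule degenerate_mono[OF _ sub]) (use assms(2) in \<open>intro degenerate_small; simp\<close>)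
  then have "iso_num (cnb {x}) W \<le> card {c}" using h(1) by (intro iso_num_le) auto
  then show ?thesis by simp
qed

text \<open>The equality cases for \<open>io\<close>, that is, for degeneracy; hence the 4-cycle
  appears here independently of the family.\<close>

definition extremal :: "'a set \<Rightarrow> bool" where
  "extremal W \<longleftrightarrow> (\<exists>S U u. pure W S U u) \<or> k = 2 \<and> cyc5 W \<or> k = 3 \<and> cyc4 W"

lemma t_pos: "0 < t"
  by (simp add: t_def)

lemma t_2: "k = 2 \<Longrightarrow> t = 3" and t_3: "k = 3 \<Longrightarrow> t = 5"
  unfolding t_def by (simp_all add: choose_two)

text \<open>Both exceptional cycles become cheaper as soon as x dominates one of their vertices. So
  if x saves nothing in C, then C is pure and \<open>pure_relabel\<close> makes y a foot.\<close>

lemma extremal_attached: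
  assumes "extremal C" "finite C" "y \<in> C" "y \<in> nb x"
    and "t * iso_num (cnb {x}) C = ecount C + 1" "t * io C \<le> ecount C + 1"
  shows "\<exists>S U u. pure C S U u \<and> y \<in> S"
proof -
  have "\<not> (k = 2 \<and> cyc5 C)"
  proof
    assume *: "k = 2 \<and> cyc5 C"
    then have "3 * iso_num (cnb {x}) C = 6" using assms(5) unfolding t_2[OF conjunct1[OF *]] cyc5_ecount[OF conjunct2[OF *]] by simp
    then show False using cyc5_iso_num[of C y x] * assms(3,4) by linarith
  qed
  moreover have "\<not> (k = 3 \<and> cyc4 C)"
  proof
    assume *: "k = 3 \<and> cyc4 C"
    then have "iso_num (cnb {x}) C = 0" using assms(3,4) by (intro iso_num_eq_0 cyc4_degenerate) auto
    then show False using assms(5) by simp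
  qed
  ultimately obtain S U u where p: "pure C S U u" using assms(1) unfolding extremal_def by blast
  have "t * io C \<le> t * iso_num (cnb {x}) C" using assms(5,6) by simp
  then have "io C \<le> iso_num (cnb {x}) C" using t_pos by (simp only: mult_le_cancel1)
  then have "card S \<le> iso_num (cnb {x}) C" using pure_card_le_io[OF p assms(2)] by simp
  then show ?thesis using pure_relabel[OF p assms(2,3,4)] by blast
qed

section \<open>Deleting a vertex with a clique component\<close>

definition good :: "'a set \<Rightarrow> bool" where
  "good W \<longleftrightarrow> t * io W \<le> ecount W + 1 \<and> (t * io W = ecount W + 1 \<longrightarrow> extremal W)"

lemma strict_good: "t * io W < ecount W + 1 \<Longrightarrow> good W"
  by (simp add: good_def)

lemma good_bound: "good W \<Longrightarrow> t * io W \<le> ecount W + 1"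
  by (simp add: good_def)

lemma bound_iff_excess:
  "t * io W < ecount W + 1 \<longleftrightarrow> 0 < int (ecount W) + 1 - int t * int (io W)"
  "t * io W \<le> ecount W + 1 \<longleftrightarrow> 0 \<le> int (ecount W) + 1 - int t * int (io W)"
proof -
  have e: "int t * int (io W) = int (t * io W)" by simp
  show "t * io W < ecount W + 1 \<longleftrightarrow> 0 < int (ecount W) + 1 - int t * int (io W)"
    "t * io W \<le> ecount W + 1 \<longleftrightarrow> 0 \<le> int (ecount W) + 1 - int t * int (io W)"
    unfolding e by linarith+
qed

text \<open>Connectedness makes x adjacent to each component. A clique is thereby destroyed by x at
  no cost, and any other component has its bound and an edge to x.\<close>

lemma surplus_delete_vertex:
  assumes "finite W" "conn W" "x \<in> W" "C \<in> comps (W - {x})" "\<not> clq C \<Longrightarrow> good C"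
  shows "0 \<le> surplus x {x} C"
proof -
  have l: "1 \<le> links C {x}" by (rule links_pos[OF assms(2,1)]) (use assms(3,4) in auto)
  show ?thesis
  proof (cases "clq C")
    case True
    have "nb x \<inter> C \<noteq> {}"
      using l finite_comp[OF _ assms(4)] assms(1) by (auto simp: links_singleton_right)
    then show ?thesis using surplus_degenerate[OF clq_degenerate_Diff[OF True]] by simp
  next
    case False
    then show ?thesis using surplus_ge[OF good_bound[OF assms(5)], of "{x}" x] l by simp
  qed
qed

text \<open>The set Y = {x} contains no edge, so the choice of x leaves a debt of
  \<open>t - 1\<close>. Here K alone contributes at least \<open>t\<close>, and no component
  contributes a negative amount.\<close>

lemma delete_vertex_strict:
  assumes "finite W" "conn W" "x \<in> W" "K \<in> comps (W - {x})" "degenerate (K - cnb {x})"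
    and "t \<le> ecount K + links K {x}"
    and "\<And>C. C \<in> comps (W - {x}) \<Longrightarrow> \<not> clq C \<Longrightarrow> good C"
  shows "t * io W < ecount W + 1"
proof -
  have "surplus x {x} K \<le> (\<Sum>C\<in>comps (W - {x}). surplus x {x} C)"
    by (rule member_le_sum) (use assms surplus_delete_vertex finite_comps in auto)
  moreover have "int t \<le> surplus x {x} K" using surplus_degenerate[OF assms(5)] assms(6) by simp
  ultimately show ?thesis
    unfolding bound_iff_excess using excess_ge[of W x "{x}"] assms(1,3) by (simp add: cnb_def)
qed

lemma nb_comp_delete:
  assumes "C \<in> comps (W - {x})" "x \<in> W" "a \<in> C"
  shows "nb a \<inter> W = nb a \<inter> C \<union> (if a \<in> nb x then {x} else {})"
proof -
  have "nb a \<inter> (W - {x}) = nb a \<inter> C" using assms unfolding comps_def by blast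
  moreover have "nb a \<inter> W = nb a \<inter> (W - {x}) \<union> (nb a \<inter> {x})" using assms(2) by blast
  moreover have "nb a \<inter> {x} = (if a \<in> nb x then {x} else {})" using nb_sym by auto
  ultimately show ?thesis by simp
qed

text \<open>K becomes the pendant clique of the new foot x. Each other component keeps its
  structure, and its only edge to x ends in one of its feet, so no pendant clique acquires a new
  neighbour.\<close>

lemma pure_assemble:
  assumes "finite W" "x \<in> W" "K \<in> comps (W - {x})" "clq K" "nb x \<inter> K = {k0}"
    and "\<And>C. C \<in> comps (W - {x}) \<Longrightarrow> C \<noteq> K \<Longrightarrow> \<exists>S U u y. pure C S U u \<and> y \<in> S \<and> nb x \<inter> C = {y}"
  shows "\<exists>S U u. pure W S U u"
proof -
  define P where "P = comps (W - {x}) - {K}"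
  have "\<forall>C\<in>P. \<exists>q. case q of (S, U, u, y) \<Rightarrow> pure C S U u \<and> y \<in> S \<and> nb x \<inter> C = {y}"
    using assms(6) unfolding P_def by (simp add: split_paired_Ex)
  from bchoice[OF this] obtain q
    where q: "\<forall>C\<in>P. case q C of (S, U, u, y) \<Rightarrow> pure C S U u \<and> y \<in> S \<and> nb x \<inter> C = {y}" ..
  define S where "S C = fst (q C)" for C
  define U where "U C = fst (snd (q C))" for C
  define u where "u C = fst (snd (snd (q C)))" for C
  define y where "y C = snd (snd (snd (q C)))" for C
  have pu: "pure C (S C) (U C) (u C)" and yS: "y C \<in> S C" and ny: "nb x \<inter> C = {y C}" if "C \<in> P" for C
    using bspec[OF q that] by (auto simp: S_def U_def u_def y_def split: prod.splits)
  note pe = pure_pendant[OF pu] and eq = pure_eq[OF pu] and cS = pure_conn[OF pu]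
  have PC: "C \<in> comps (W - {x})" "C \<noteq> K" if "C \<in> P" for C using that by (auto simp: P_def)
  have CW: "C \<subseteq> W" "x \<notin> C" if "C \<in> P" for C using comps_subset[OF PC(1)[OF that]] by auto
  have KW: "K \<subseteq> W" "x \<notin> K" using comps_subset[OF assms(3)] by auto
  have SC: "S C \<subseteq> C" if "C \<in> P" for C using eq[OF that] by blast
  have dis: "C \<inter> C' = {}" if "C \<in> P" "C' \<in> P" "C \<noteq> C'" for C C'
    using comps_disjoint[OF PC(1)[OF that(1)] PC(1)[OF that(2)] that(3)] .
  have disK: "C \<inter> K = {}" if "C \<in> P" for C
    using comps_disjoint[OF PC(1)[OF that] assms(3) PC(2)[OF that]] .
  \<comment> \<open>The structures of the components are merged into single functions on feet by
    looking up the component to which a foot belongs.\<close>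
  define c where "c v = (THE C. C \<in> P \<and> v \<in> C)" for v
  have c: "c v = C" if "C \<in> P" "v \<in> C" for v C
    unfolding c_def by (rule the_equality) (use that dis in blast)+
  define S' where "S' = insert x (\<Union>C\<in>P. S C)"
  define U' where "U' v = (if v = x then K else U (c v) v)" for v
  define u' where "u' v = (if v = x then k0 else u (c v) v)" for v
  have U'x: "U' x = K" "u' x = k0" by (simp_all add: U'_def u'_def)
  have U'C: "U' v = U C v" "u' v = u C v" if "C \<in> P" "v \<in> S C" for C v
  proof -
    have "v \<in> C" using SC that by blast
    then show "U' v = U C v" "u' v = u C v"
      using c[OF that(1)] CW(2)[OF that(1)] by (auto simp: U'_def u'_def)
  qed
  have UC: "U C v \<subseteq> C" if "C \<in> P" "v \<in> S C" for C v
    using pendantD(2)[OF pe[OF that(1)] that(2)] .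
  have pendant: "pendant W S' U' u'"
    unfolding pendant_def
  proof (intro conjI ballI impI)
    show "S' \<subseteq> W" using assms(2) SC CW unfolding S'_def by blast
  next
    fix v v' assume "v \<in> S'" "v' \<in> S'" "v \<noteq> v'"
    moreover have "U' v \<inter> K = {}" if "v \<in> S C" "C \<in> P" for v C
      using U'C[OF that(2,1)] UC[OF that(2,1)] disK[OF that(2)] by blast
    moreover have "U' v \<inter> U' v' = {}" if "v \<in> S C" "C \<in> P" "v' \<in> S C'" "C' \<in> P" "v \<noteq> v'" for v C v' C'
    proof (cases "C = C'")
      case True
      then show ?thesis
        using U'C[OF that(2,1)] U'C[OF that(4,3)] pendantD(8)[OF pe[OF that(2)] that(1), of v'] that by auto
    next
      case False
      then show ?thesis
        using U'C[OF that(2,1)] U'C[OF that(4,3)] UC[OF that(2,1)] UC[OF that(4,3)] dis[OF that(2,4)] by blast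
    qed
    ultimately show "U' v \<inter> U' v' = {}"
      unfolding S'_def using U'x by blast
  next
    fix v assume "v \<in> S'"
    then consider "v = x" | C where "C \<in> P" "v \<in> S C" unfolding S'_def by blast
    then have "U' v \<subseteq> W \<and> U' v \<inter> S' = {} \<and> card (U' v) = k \<and> u' v \<in> U' v \<and>
        (\<forall>a\<in>U' v. nb a \<inter> W = U' v - {a} \<union> (if a = u' v then {v} else {}))"
    proof cases
      case 1
      have "K \<inter> S' = {}" using KW(2) SC disK unfolding S'_def by blast
      moreover have "nb a \<inter> W = K - {a} \<union> (if a = k0 then {x} else {})" if a: "a \<in> K" for a
      proof -
        have "a \<in> nb x \<longleftrightarrow> a = k0" using assms(5) a by blast
        then show ?thesis
          using nb_comp_delete[OF assms(3,2) a] clq_nb[OF assms(4) a] by simp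
      qed
      ultimately show ?thesis
        using 1 U'x KW(1) clq_card[OF assms(4)] assms(5) by blast
    next
      case 2
      note D = pendantD[OF pe[OF 2(1)] 2(2)]
      have "U C v \<inter> S' = {}"
        using UC[OF 2] CW(2)[OF 2(1)] D(3) SC dis[OF 2(1)] unfolding S'_def by blast
      moreover have "nb a \<inter> W = U C v - {a} \<union> (if a = u C v then {v} else {})" if a: "a \<in> U C v" for a
      proof -
        have aC: "a \<in> C" using UC[OF 2] a by blast
        have "a \<noteq> y C" using yS[OF 2(1)] D(3) a by blast
        then have "a \<notin> nb x" using ny[OF 2(1)] aC by blast
        then show ?thesis
          using nb_comp_delete[OF PC(1)[OF 2(1)] assms(2) aC] D(7)[OF a] by simp
      qed
      ultimately show ?thesis
        unfolding U'C[OF 2] using subset_trans[OF UC[OF 2] CW(1)[OF 2(1)]] D(4,5) by simp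
    qed
    then show "U' v \<subseteq> W" "U' v \<inter> S' = {}" "card (U' v) = k" "u' v \<in> U' v"
      "\<And>a. a \<in> U' v \<Longrightarrow> nb a \<inter> W = U' v - {a} \<union> (if a = u' v then {v} else {})" by blast+
  qed
  have conn: "conn S'"
  proof (unfold conn_def, intro conjI allI impI)
    show "S' \<noteq> {}" unfolding S'_def by blast
    fix B assume B: "B \<subseteq> S'" "B \<noteq> {}" "B \<noteq> S'"
    have inner: "\<exists>a\<in>B. \<exists>b\<in>S' - B. b \<in> nb a" if BC: "C \<in> P" "B \<inter> S C \<noteq> {}" "B \<inter> S C \<noteq> S C" for C
    proof -
      obtain a b where "a \<in> B \<inter> S C" "b \<in> S C" "b \<notin> B \<inter> S C" "b \<in> nb a"
        by (rule connD[OF cS[OF BC(1)], of "B \<inter> S C"]) (use BC in auto)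
      then show ?thesis using BC(1) unfolding S'_def by blast
    qed
    \<comment> \<open>A cut that splits the feet of no component separates x from all feet of some
      component, among them the foot adjacent to x.\<close>
    show "\<exists>a\<in>B. \<exists>b\<in>S' - B. b \<in> nb a"
    proof (cases "x \<in> B")
      case True
      then obtain C b where b: "C \<in> P" "b \<in> S C" "b \<notin> B" using B unfolding S'_def by blast
      have "y C \<in> nb x" using ny[OF b(1)] by blast
      moreover have "y C \<in> S'" using yS[OF b(1)] b(1) unfolding S'_def by blast
      ultimately show ?thesis using inner[OF b(1)] True b yS[OF b(1)] by blast
    next
      case False
      then obtain C b where b: "C \<in> P" "b \<in> S C" "b \<in> B" using B unfolding S'_def by blast
      have "x \<in> nb (y C)" using ny[OF b(1)] nb_sym by blast
      moreover have "x \<in> S' - B" using False unfolding S'_def by blast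
      ultimately show ?thesis using inner[OF b(1)] False b yS[OF b(1)] by blast
    qed
  qed
  have "W = insert x (K \<union> \<Union>P)"
    using Union_comps[of "W - {x}"] assms(1,2,3) unfolding P_def by blast
  also have "\<dots> = S' \<union> (\<Union>v\<in>S'. U' v)"
  proof -
    have "C = S C \<union> (\<Union>v\<in>S C. U' v)" if "C \<in> P" for C
      using eq[OF that] U'C(1)[OF that] by simp
    then have "\<Union>P = (\<Union>C\<in>P. S C \<union> (\<Union>v\<in>S C. U' v))" by blast
    then show ?thesis using U'x(1) unfolding S'_def by auto
  qed
  finally show ?thesis using pendant conn unfolding pure_def by blast
qed

text \<open>K contributes \<open>t - 2\<close> edges and at least one edge to x, which cancels the
  debt of \<open>t - 1\<close> exactly. In the case of equality K has one edge to x and the other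
  components have surplus 0. Such a component is no clique, has one edge to x, attains its own
  bound, and x saves nothing in it: the situation of \<open>extremal_attached\<close>.\<close>

lemma delete_vertex_clq:
  assumes "finite W" "conn W" "x \<in> W" "K \<in> comps (W - {x})" "clq K"
    and IH: "\<And>C. C \<in> comps (W - {x}) \<Longrightarrow> \<not> clq C \<Longrightarrow> good C"
  shows "good W"
proof -
  let ?P = "comps (W - {x})"
  have fin: "finite ?P" using assms(1) finite_comps by simp
  have finC: "finite C" if "C \<in> ?P" for C using finite_comp[OF _ that] assms(1) by simp
  have lC: "1 \<le> links C {x}" if "C \<in> ?P" for C
    by (rule links_pos[OF assms(2,1)]) (use assms(3) that in auto)
  have lC': "links C {x} = card (nb x \<inter> C)" if "C \<in> ?P" for C
    using links_singleton_right finC[OF that] by simp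
  have sclq: "surplus x {x} C = int t - 2 + int (links C {x})" if "C \<in> ?P" "clq C" for C
  proof -
    have "nb x \<inter> C \<noteq> {}" using lC[OF that(1)] lC'[OF that(1)] by auto
    then show ?thesis
      using surplus_degenerate[OF clq_degenerate_Diff[OF that(2)]] clq_ecount[OF that(2)] by (simp add: t_def)
  qed
  have s0: "0 \<le> surplus x {x} C" if "C \<in> ?P" for C
    by (rule surplus_delete_vertex[OF assms(1,2,3) that IH[OF that]])
  have split: "(\<Sum>C\<in>?P. surplus x {x} C) = surplus x {x} K + (\<Sum>C\<in>?P - {K}. surplus x {x} C)"
    using fin assms(4) by (rule sum.remove)
  have rest: "0 \<le> (\<Sum>C\<in>?P - {K}. surplus x {x} C)" using s0 by (intro sum_nonneg) auto
  have ex: "1 - int t + (\<Sum>C\<in>?P. surplus x {x} C) \<le> int (ecount W) + 1 - int t * int (io W)"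
    using excess_ge[of W x "{x}"] assms(1,3) by (simp add: cnb_def)
  have sK: "surplus x {x} K = int t - 2 + int (links K {x})" using sclq assms(4,5) by blast
  have "0 \<le> int (ecount W) + 1 - int t * int (io W)"
    using ex split rest sK lC[OF assms(4)] by linarith
  then have bound: "t * io W \<le> ecount W + 1" unfolding bound_iff_excess .
  moreover have "extremal W" if tight: "t * io W = ecount W + 1"
  proof -
    have "int t * int (io W) = int (ecount W) + 1"
      using tight by (metis of_nat_1 of_nat_add of_nat_mult)
    then have z: "links K {x} = 1" "(\<Sum>C\<in>?P - {K}. surplus x {x} C) = 0"
      using ex split rest sK lC[OF assms(4)] by linarith+
    then have s: "surplus x {x} C = 0" if "C \<in> ?P" "C \<noteq> K" for C
      using sum_nonneg_eq_0_iff[of "?P - {K}" "surplus x {x}"] fin s0 that by auto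
    have "\<exists>S U u y. pure C S U u \<and> y \<in> S \<and> nb x \<inter> C = {y}" if C: "C \<in> ?P" "C \<noteq> K" for C
    proof -
      have nclq: "\<not> clq C" using s[OF C] sclq[OF C(1)] lC[OF C(1)] by (auto simp: t_def)
      note g = good_bound[OF IH[OF C(1) nclq]]
      have l1: "links C {x} = 1"
        using surplus_ge[OF g, of "{x}" x] s[OF C] lC[OF C(1)] by simp
      then have y: "\<exists>y. nb x \<inter> C = {y}" using lC'[OF C(1)] by (simp add: card_1_singleton_iff)
      then obtain y where y: "nb x \<inter> C = {y}" by blast
      have "int (t * iso_num (cnb {x}) C) = int (ecount C + 1)"
        using s[OF C] l1 unfolding surplus_def by simp
      then have eq: "t * iso_num (cnb {x}) C = ecount C + 1" by (rule of_nat_eq_iff[THEN iffD1])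
      have "t * iso_num (cnb {x}) C \<le> t * io C"
        using iso_num_mono[of "{}" "cnb {x}" C] by simp
      then have "t * io C = ecount C + 1" using g eq by linarith
      then have "extremal C" using IH[OF C(1) nclq] by (simp add: good_def)
      from extremal_attached[OF this finC[OF C(1)] _ _ eq g] y show ?thesis by blast
    qed
    moreover obtain k0 where "nb x \<inter> K = {k0}"
      using z(1) lC'[OF assms(4)] by (auto simp: card_1_singleton_iff)
    ultimately have "\<exists>S U u. pure W S U u"
      using pure_assemble[OF assms(1,3,4,5)] by blast
    then show ?thesis by (simp add: extremal_def)
  qed
  ultimately show ?thesis by (simp add: good_def)
qed

section \<open>Graphs without cliques\<close>

lemma core_ecount_no_clq:
  assumes "finite H" "H \<noteq> {}" "\<And>h. h \<in> H \<Longrightarrow> k - 1 \<le> card (nb h \<inter> H)" "\<And>Q. Q \<subseteq> H \<Longrightarrow> \<not> clq Q"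
  shows "(k + 1) * (k - 1) \<le> 2 * ecount H"
proof -
  have "(k + 1) * (k - 1) \<le> card H * (k - 1)"
    using core_card[OF assms] by (intro mult_right_mono) auto
  then show ?thesis using core_ecount[OF assms(1,3)] by linarith
qed

text \<open>For \<open>k <= 2\<close> a clique is a vertex or an edge, and every set violating
  degeneracy contains one.\<close>

lemma no_clq_k_ge_3:
  assumes "\<not> degenerate W" "\<And>Q. Q \<subseteq> W \<Longrightarrow> \<not> clq Q"
  shows "3 \<le> k"
proof (rule ccontr)
  assume "\<not> 3 \<le> k"
  then have k: "k = 1 \<or> k = 2" using k_pos by linarith
  obtain H where H: "H \<subseteq> W" "H \<noteq> {}" "\<And>h. h \<in> H \<Longrightarrow> k - 1 \<le> card (nb h \<inter> H)"
    using not_degenerateE[OF assms(1)] by metis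
  then obtain h where h: "h \<in> H" by blast
  show False
  proof (cases "k = 1")
    case True
    then have "clq {h}" unfolding clq_def by simp
    then show False using assms(2)[of "{h}"] h H(1) by blast
  next
    case False
    then have k2: "k = 2" using k by simp
    then have "nb h \<inter> H \<noteq> {}" using H(3)[OF h] by force
    then obtain b where b: "b \<in> nb h" "b \<in> H" by blast
    then have "h \<noteq> b" "h \<in> nb b" using nb_sym by auto
    then have "clq {h, b}" unfolding clq_def using k2 b by auto
    then show False using assms(2)[of "{h, b}"] h b H(1) by blast
  qed
qed

text \<open>The vertices of H have no degree left for neighbours outside H, so H is closed and
  connectedness makes it everything.\<close>

lemma core_eq:
  assumes "finite W" "conn W" "H \<subseteq> W" "H \<noteq> {}" "\<And>h. h \<in> H \<Longrightarrow> k - 1 \<le> card (nb h \<inter> H)"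
    and "\<And>h. h \<in> H \<Longrightarrow> card (nb h \<inter> W) \<le> k - 1"
  shows "H = W"
proof (rule conn_closed_eq[OF assms(2-4)])
  fix h assume h: "h \<in> H"
  have "nb h \<inter> H = nb h \<inter> W"
    by (rule card_seteq) (use assms(1,3) assms(5)[OF h] assms(6)[OF h] in auto)
  then show "nb h \<inter> W \<subseteq> H" by blast
qed

lemma two_t: "2 * t = k * (k - 1) + 4"
  using two_choose_two[of k] by (simp add: t_def)

text \<open>By \<open>core_eq\<close> the only subset of minimum degree at least
  \<open>k - 1\<close> is W itself. So any single vertex isolates, and W is regular with enough
  edges to pay for that vertex.\<close>

lemma regular_good:
  assumes "finite W" "conn W" "\<not> degenerate W" "\<And>Q. Q \<subseteq> W \<Longrightarrow> \<not> clq Q"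
    and "\<And>v. v \<in> W \<Longrightarrow> card (nb v \<inter> W) \<le> k - 1"
  shows "good W"
proof -
  have eqW: "H = W" if "H \<subseteq> W" "H \<noteq> {}" "\<And>h. h \<in> H \<Longrightarrow> k - 1 \<le> card (nb h \<inter> H)" for H
    by (rule core_eq[OF assms(1,2) that(1,2)]) (use that assms(5) in auto)
  obtain H where "H \<subseteq> W" "H \<noteq> {}" "\<And>h. h \<in> H \<Longrightarrow> k - 1 \<le> card (nb h \<inter> H)"
    using not_degenerateE[OF assms(3)] by metis
  then have W: "W \<noteq> {}" and deg: "\<And>h. h \<in> W \<Longrightarrow> k - 1 \<le> card (nb h \<inter> W)" using eqW by metis+
  obtain v where v: "v \<in> W" using W by blast
  have "degenerate (W - {} - cnb {v})"
  proof (rule ccontr)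
    assume "\<not> degenerate (W - {} - cnb {v})"
    then obtain H where H: "H \<subseteq> W - {} - cnb {v}" "H \<noteq> {}" "\<And>h. h \<in> H \<Longrightarrow> k - 1 \<le> card (nb h \<inter> H)"
      using not_degenerateE by metis
    then have "H = W" by (intro eqW) auto
    then show False using H(1) v by (auto simp: cnb_def)
  qed
  then have io: "io W \<le> 1" using iso_num_le[of "{v}" W "{}"] v by simp
  obtain j where k: "k = j + 3" using no_clq_k_ge_3[OF assms(3,4)] by (metis le_add_diff_inverse2)
  have e: "(k + 1) * (k - 1) \<le> 2 * ecount W" by (rule core_ecount_no_clq[OF assms(1) W deg assms(4)])
  \<comment> \<open>With \<open>k = j + 3\<close> the next two facts compare \<open>2 * t\<close>
    with \<open>2 * (ecount W + 1)\<close>, which is at least \<open>j * j + 6 * j + 10\<close>.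
    Equality therefore needs j = 0: four edges, all degrees two, hence four vertices.\<close>
  have tj: "2 * t = j * j + 5 * j + 10" unfolding two_t unfolding k by (simp add: algebra_simps)
  have ej: "j * j + 6 * j + 8 \<le> 2 * ecount W" using e unfolding k by (simp add: algebra_simps)
  have tm: "t \<le> ecount W + 1" using tj ej by linarith
  have tio: "t * io W = 0 \<or> t * io W = t" using io by (cases "io W") auto
  have "extremal W" if "t * io W = ecount W + 1"
  proof -
    have "t = ecount W + 1" using that tio by linarith
    then have j0: "j = 0" and e4: "ecount W = 4" using tj ej by auto
    have k3: "k = 3" using k j0 by simp
    have d2: "card (nb h \<inter> W) = 2" if "h \<in> W" for h
      using deg[OF that] assms(5)[OF that] k3 by simp
    have "links W W = card W * 2" using d2 by (simp add: links_def)
    then have c4: "card W = 4" using handshake[OF assms(1)] e4 by simp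
    obtain b d where bd: "nb v \<inter> W = {b, d}" "b \<noteq> d" using d2[OF v] by (meson card_2_iff)
    have mem: "b \<in> W" "d \<in> W" "b \<in> nb v" "d \<in> nb v" using bd by auto
    have ne: "v \<noteq> b" "v \<noteq> d" using mem by auto
    have "card (W - {v, b, d}) = 1"
      using c4 v mem ne bd(2) assms(1) by (simp add: card_Diff_subset)
    then obtain c where c: "W - {v, b, d} = {c}" by (rule card_1_singletonE)
    then have W4: "W = {v, b, c, d}" and cne: "c \<noteq> v" "c \<noteq> b" "c \<noteq> d" using v mem by blast+
    have cv: "c \<notin> nb v" using bd(1) cne W4 by blast
    then have "v \<notin> nb c" using nb_sym by blast
    then have "nb c \<inter> W \<subseteq> {b, d}" using W4 nb_irrefl by blast
    then have "nb c \<inter> W = {b, d}"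
      by (intro card_seteq) (use d2[of c] W4 bd(2) in auto)
    then have cc: "b \<in> nb c" "d \<in> nb c" by blast+
    have sym: "v \<in> nb b" "c \<in> nb b" "v \<in> nb d" using mem cc nb_sym by blast+
    have "{v, c} = nb b \<inter> W"
      by (rule card_seteq) (use d2[of b] sym W4 cne assms(1) in auto)
    then have "nb b \<inter> W \<subseteq> {v, c}" by simp
    then have "d \<notin> nb b" using cne(3) ne(2) mem(2) by blast
    moreover have "distinct [v, b, c, d]" using ne cne bd(2) by auto
    ultimately have "cyc4 W" unfolding cyc4_def using W4 mem(3) sym(2,3) cc(2) cv by blast
    then show ?thesis using k3 unfolding extremal_def by blast
  qed
  then show ?thesis using tm tio by (auto simp: good_def)
qed

lemma links_closed_nbhd:
  assumes "finite W" "Y \<subseteq> W"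
  shows "links Y W = 2 * ecount Y + (\<Sum>C\<in>comps (W - Y). links C Y)"
proof -
  have fin: "finite Y" "finite (W - Y)" using assms finite_subset by auto
  have "links Y W = links Y (Y \<union> (W - Y))" using assms(2) by (simp add: Un_absorb1)
  also have "\<dots> = links Y Y + links Y (W - Y)" by (rule links_Un_right) (use fin in auto)
  also have "links Y (W - Y) = links (W - Y) Y" using fin by (intro links_sym)
  finally show ?thesis using handshake[OF fin(1)] links_UN_left[OF fin(2), of Y] by simp
qed

text \<open>The bound is attained when \<open>v\<close> has \<open>k - 1\<close> neighbours of degree \<open>k - 1\<close> and a pendant neighbour.\<close>
lemma links_core_ge:
  assumes "finite W" "H \<subseteq> W" "v \<in> H" "\<And>h. h \<in> H \<Longrightarrow> k - 1 \<le> card (nb h \<inter> H)"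
    and "k \<le> card (nb v \<inter> W)" "2 \<le> k"
  shows "2 * t \<le> links (insert v (nb v \<inter> W)) W + 2"
proof -
  define A where "A = nb v \<inter> H"
  define B where "B = nb v \<inter> W - A"
  have fin: "finite A" "finite B" "finite (nb v \<inter> W)"
    using assms(1,2) finite_subset[of H W] by (auto simp: A_def B_def)
  have AB: "nb v \<inter> W = A \<union> B" "A \<inter> B = {}" using assms(2) by (auto simp: A_def B_def)
  have "links (insert v (nb v \<inter> W)) W = card (nb v \<inter> W) + links (nb v \<inter> W) W"
    using fin by (simp add: links_insert_left)
  also have "links (nb v \<inter> W) W = links A W + links B W"
    unfolding AB(1) using fin AB(2) by (intro links_Un_left)
  finally have 1: "links (insert v (nb v \<inter> W)) W = card (nb v \<inter> W) + (links A W + links B W)" .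
  have "(\<Sum>a\<in>A. k - 1) \<le> links A W"
    unfolding links_def
  proof (rule sum_mono)
    fix a assume a: "a \<in> A"
    have "card (nb a \<inter> H) \<le> card (nb a \<inter> W)" using assms(1,2) by (intro card_mono) auto
    then show "k - 1 \<le> card (nb a \<inter> W)" using assms(4)[of a] a by (auto simp: A_def)
  qed
  then have 2: "card A * (k - 1) \<le> links A W" by simp
  have 3: "card B \<le> links B W"
  proof (rule card_le_links)
    fix b assume "b \<in> B"
    then have "v \<in> nb b" using nb_sym by (auto simp: B_def)
    then show "nb b \<inter> W \<noteq> {}" using assms(2,3) by blast
  qed (use fin assms in auto)
  have 4: "card (nb v \<inter> W) = card A + card B" unfolding AB(1) using fin AB(2) by (intro card_Un_disjoint)
  have 5: "k - 1 \<le> card A" using assms(4)[OF assms(3)] by (simp add: A_def)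
  obtain j where k: "k = j + 2" using assms(6) by (metis le_add_diff_inverse2)
  \<comment> \<open>Let a and b be the sizes of A and B. The degree sum is at least
    \<open>(a + b) + a * (k - 1) + b\<close>, which is \<open>a * (k - 2) + 2 * (a + b)\<close>.
    From \<open>a >= k - 1\<close> and \<open>a + b >= k\<close> this is at least
    \<open>k * (k - 1) + 2\<close>, that is, \<open>2 * t - 2\<close>.\<close>
  have "(j + 1) * j \<le> card A * j" using 5 k by (intro mult_right_mono) auto
  then show ?thesis using 1 2 3 4 assms(5) two_t unfolding k by (simp add: algebra_simps)
qed

text \<open>The degree sum over Y counts edges inside Y twice but edges leaving Y only once. So it
  suffices that each component has a surplus of at least half the number of its edges to Y. A
  component satisfying the strict bound gives the full number; a tight one is a 4-cycle with at
  least two such edges and gives all but one.\<close>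

lemma no_clq_good:
  assumes "finite W" "conn W" "\<not> degenerate W" and noclq: "\<And>Q. Q \<subseteq> W \<Longrightarrow> \<not> clq Q"
    and IH: "\<And>C. conn C \<Longrightarrow> C \<subset> W \<Longrightarrow> good C"
  shows "good W"
proof (rule ccontr)
  assume ngood: "\<not> good W"
  obtain H where H: "H \<subseteq> W" "H \<noteq> {}" "\<And>h. h \<in> H \<Longrightarrow> k - 1 \<le> card (nb h \<inter> H)"
    using not_degenerateE[OF assms(3)] by metis
  have k3: "3 \<le> k" using no_clq_k_ge_3[OF assms(3) noclq] .
  have finH: "finite H" using H(1) assms(1) finite_subset by blast
  have "\<exists>v\<in>H. k \<le> card (nb v \<inter> W)"
  proof (rule ccontr)
    assume "\<not> ?thesis"
    then have le: "card (nb h \<inter> W) \<le> k - 1" if "h \<in> H" for h using that by force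
    have "H = W" by (rule core_eq[OF assms(1,2) H le])
    then show False using regular_good[OF assms(1-3) noclq] le ngood by blast
  qed
  then obtain v where v: "v \<in> H" "k \<le> card (nb v \<inter> W)" by blast
  define N where "N = nb v \<inter> W"
  define Y where "Y = insert v N"
  have Y: "v \<in> Y" "Y \<subseteq> cnb {v}" "Y \<subseteq> W" using v(1) H(1) by (auto simp: Y_def N_def cnb_def)
  have finY: "finite Y" and finN: "finite N" using Y(3) assms(1) finite_subset Y_def by auto
  let ?P = "comps (W - Y)"
  have finP: "finite ?P" using assms(1) finite_comps by simp
  have PW: "C \<subset> W" "conn C" "finite C" if "C \<in> ?P" for C
    using comps_subset[OF that] comps_conn[OF that] finite_comp[OF _ that] assms(1) Y(1,3) by auto
  have lpos: "1 \<le> links C Y" if "C \<in> ?P" for C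
    by (rule links_pos[OF assms(2,1) Y(3) _ that]) (use Y in auto)
  have nopure: "\<not> pure C S U u" if "C \<subseteq> W" for C S U u
  proof
    assume p: "pure C S U u"
    obtain s where s: "s \<in> S" using pure_conn[OF p] unfolding conn_def by blast
    show False
      using noclq[of "U s"] pendant_clq[OF pure_pendant[OF p] s] pendantD(2)[OF pure_pendant[OF p] s] that by blast
  qed
  have sur: "int (links C Y) \<le> surplus v Y C \<or> k = 3 \<and> cyc4 C \<and> 2 \<le> links C Y \<and> int (links C Y) - 1 \<le> surplus v Y C"
    if C: "C \<in> ?P" for C
  proof (cases "t * io C = ecount C + 1")
    case True
    have g: "good C" using IH PW[OF C] by blast
    then have cyc: "k = 3 \<and> cyc4 C"
      using True nopure[of C] PW(1)[OF C] k3 unfolding good_def extremal_def by auto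
    \<comment> \<open>A 4-cycle hanging on a single edge is destroyed by the outer end x of that
      edge. Its four edges and the edge to x make up \<open>t = 5\<close>, so W would satisfy the
      strict bound.\<close>
    have "links C Y \<noteq> 1"
    proof
      assume "links C Y = 1"
      then obtain x y where xy: "x \<in> Y" "y \<in> C" "nb x \<inter> C = {y}" "\<And>a. a \<in> C \<Longrightarrow> nb a \<inter> Y \<subseteq> {x}"
        using single_link[OF PW(3)[OF C] finY] by metis
      have xW: "x \<in> W" using xy(1) Y(3) by blast
      have Cx: "C \<in> comps (W - {x})" by (rule comps_delete[OF C xy(1,4)])
      have deg: "degenerate (C - cnb {x})" by (rule cyc4_degenerate[of C y]) (use cyc xy in auto)
      have "1 \<le> links C {x}" by (rule links_pos[OF assms(2,1) _ _ Cx]) (use xW in auto)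
      then have "t \<le> ecount C + links C {x}" using t_3 cyc4_ecount[of C] cyc by simp
      then have "t * io W < ecount W + 1"
        by (rule delete_vertex_strict[OF assms(1,2) xW Cx deg])
          (use comps_subset comps_conn xW in \<open>intro IH; blast\<close>)
      then show False using ngood strict_good by blast
    qed
    then have "2 \<le> links C Y" using lpos[OF C] by linarith
    then show ?thesis using cyc surplus_ge[OF good_bound[OF g], of Y v] by blast
  next
    case False
    have "t * io C \<le> ecount C" using good_bound[OF IH[OF PW(2)[OF C] PW(1)[OF C]]] False by linarith
    moreover have "t * iso_num (cnb {v}) C \<le> t * io C"
      using iso_num_mono[of "{}" "cnb {v}" C] by simp
    ultimately have "int (t * iso_num (cnb {v}) C) \<le> int (ecount C)"
      by (simp only: of_nat_le_iff)
    then show ?thesis by (simp add: surplus_def)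
  qed
  have sur2: "int (links C Y) \<le> 2 * surplus v Y C" if "C \<in> ?P" for C
    using sur[OF that] lpos[OF that] by linarith
  have sumle: "(\<Sum>C\<in>?P. int (links C Y)) \<le> (\<Sum>C\<in>?P. 2 * surplus v Y C)"
    using sur2 by (rule sum_mono)
  have key: "2 * t \<le> 2 * ecount Y + (\<Sum>C\<in>?P. links C Y) + 2"
    using links_core_ge[OF assms(1) H(1) v(1) H(3) v(2)] k3 links_closed_nbhd[OF assms(1) Y(3)]
    unfolding Y_def N_def by simp
  have key': "2 * int t \<le> 2 * int (ecount Y) + (\<Sum>C\<in>?P. int (links C Y)) + 2"
    using key unfolding of_nat_sum[symmetric] by linarith
  have ex: "int (ecount Y) + 1 - int t + (\<Sum>C\<in>?P. surplus v Y C) \<le> int (ecount W) + 1 - int t * int (io W)"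
    by (rule excess_ge[OF assms(1) Y])
  have dbl: "(\<Sum>C\<in>?P. 2 * surplus v Y C) = 2 * (\<Sum>C\<in>?P. surplus v Y C)"
    by (simp add: sum_distrib_left)
  have "0 \<le> int (ecount W) + 1 - int t * int (io W)"
    using ex key' sumle dbl by linarith
  then have bound: "t * io W \<le> ecount W + 1" unfolding bound_iff_excess .
  then have tight: "t * io W = ecount W + 1" using ngood strict_good by force
  then have tight': "int t * int (io W) = int (ecount W) + 1"
    by (metis of_nat_1 of_nat_add of_nat_mult)
  have eq: "(\<Sum>C\<in>?P. 2 * surplus v Y C - int (links C Y)) = 0"
    and eqt: "2 * int t = 2 * int (ecount Y) + (\<Sum>C\<in>?P. int (links C Y)) + 2"
    using ex key' sumle dbl tight' unfolding sum_subtractf by linarith+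
  have each: "2 * surplus v Y C = int (links C Y)" if "C \<in> ?P" for C
    using eq sum_nonneg_eq_0_iff[of ?P "\<lambda>C. 2 * surplus v Y C - int (links C Y)"] finP sur2 that by auto
  \<comment> \<open>Equality forces a surplus of exactly half the links. As there is at least one
    link, a component giving the full number is impossible.\<close>
  have cyc: "k = 3 \<and> cyc4 C \<and> links C Y = 2" if "C \<in> ?P" for C
    using sur[OF that] each[OF that] lpos[OF that] by auto
  have eY: "ecount Y = ecount N + card N"
    unfolding Y_def by (subst ecount_insert) (use finN in \<open>auto simp: N_def\<close>)
  show False
  proof (cases "?P = {}")
    case True
    \<comment> \<open>Every vertex other than v is now adjacent to v. Comparing edge counts leaves
      only k = 3; then the absence of triangles makes the neighbours of v independent, and no vertex
      of H besides v has two neighbours in H.\<close>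
    then have WY: "W = Y" using Union_comps[of "W - Y"] assms(1) Y(3) by auto
    obtain j where k: "k = j + 3" using k3 by (metis le_add_diff_inverse2)
    have "2 * t = 2 * ecount Y + 2" using eqt True by simp
    moreover have "2 * t = j * j + 5 * j + 10" unfolding two_t unfolding k by (simp add: algebra_simps)
    moreover have "(k + 1) * (k - 1) \<le> 2 * ecount H"
      by (rule core_ecount_no_clq[OF finH H(2,3)]) (use noclq H(1) in auto)
    then have "j * j + 6 * j + 8 \<le> 2 * ecount H" unfolding k by (simp add: algebra_simps)
    moreover have "ecount H \<le> ecount Y" using ecount_mono[OF finY] H(1) WY by blast
    ultimately have "j = 0" by linarith
    then have k': "k = 3" using k by simp
    have "4 \<le> card H" using core_card[OF finH H(2,3)] noclq H(1) k' by force
    then have "\<not> H \<subseteq> {v}" using card_mono[of "{v}" H] by fastforce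
    then obtain h where h: "h \<in> H" "h \<noteq> v" by blast
    then have hv: "h \<in> nb v" "v \<in> nb h" using H(1) WY nb_sym unfolding Y_def N_def by blast+
    have "nb h \<inter> H \<subseteq> {v}"
    proof (rule subsetI, rule ccontr)
      fix g assume g: "g \<in> nb h \<inter> H" "g \<notin> {v}"
      then have "g \<in> nb v" using H(1) WY unfolding Y_def N_def by blast
      then have "v \<in> nb g" "h \<in> nb g" using g nb_sym by blast+
      moreover have "v \<noteq> h" "v \<noteq> g" "h \<noteq> g" using g h by auto
      ultimately have "clq {v, h, g}" unfolding clq_def using g hv k' \<open>g \<in> nb v\<close> by auto
      then show False using noclq[of "{v, h, g}"] v(1) h g H(1) by blast
    qed
    then have "card (nb h \<inter> H) \<le> card {v}" by (intro card_mono) auto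
    then show False using H(3)[OF h(1)] k' by simp
  next
    case False
    then obtain C where C: "C \<in> ?P" by blast
    have k': "k = 3" and t5: "t = 5" using cyc[OF C] t_3 by auto
    have "(\<Sum>C\<in>?P. int (links C Y)) = (\<Sum>C\<in>?P. 2)" using cyc by (intro sum.cong) auto
    \<comment> \<open>Since v has at least three neighbours, Y must be a star with three leaves, and
      a single 4-cycle is attached to it by two edges.\<close>
    then have "ecount Y + card ?P = 4" using eqt t5 by simp
    moreover have "3 \<le> card N" using v(2) k' by (simp add: N_def)
    moreover have "1 \<le> card ?P" using finP False by (simp add: Suc_le_eq card_gt_0_iff)
    ultimately have eY3: "ecount Y = 3" and P1: "card ?P = 1" using eY by linarith+
    then have P: "?P = {C}" using C by (auto simp: card_1_singleton_iff)
    have WYC: "W = Y \<union> C" using Union_comps[of "W - Y"] P assms(1) Y(3) by auto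
    have c4: "cyc4 C" and l2: "links C Y = 2" using cyc[OF C] by auto
    have YC: "Y \<inter> C = {}" using comps_subset[OF C] by blast
    have "\<not> (\<forall>a\<in>C. \<forall>b\<in>Y. b \<notin> nb a)" using links_eq_0_iff[OF PW(3)[OF C] finY] l2 by simp
    then obtain u1 w1 where u1: "u1 \<in> C" "w1 \<in> Y" "w1 \<in> nb u1" by blast
    obtain b c d where h: "C = {u1, b, c, d}" "distinct [u1, b, c, d]" "nb u1 \<inter> C = {b, d}"
      by (rule cyc4E[OF c4 u1(1)])
    have w1v: "w1 \<noteq> v"
    proof
      assume "w1 = v"
      then have "u1 \<in> N" using u1 nb_sym comps_subset[OF C] unfolding N_def by blast
      then show False using YC u1(1) by (auto simp: Y_def)
    qed
    have e1: "ecount (Y - {w1}) \<le> 2"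
    proof -
      have "v \<in> nb w1" using w1v u1(2) nb_sym unfolding Y_def N_def by blast
      then have "nb w1 \<inter> (Y - {w1}) \<noteq> {}" using w1v Y(1) by blast
      then have "1 \<le> card (nb w1 \<inter> (Y - {w1}))" using finY by (simp add: Suc_le_eq card_gt_0_iff)
      moreover have "ecount Y = ecount (Y - {w1}) + card (nb w1 \<inter> (Y - {w1}))"
        using ecount_insert[of "Y - {w1}" w1] finY u1(2) by (simp add: insert_absorb)
      ultimately show ?thesis using eY3 by linarith
    qed
    have c1: "card (nb c \<inter> Y) \<le> 1"
    proof -
      have "links {u1, c} Y \<le> links C Y" by (rule links_mono) (use PW(3)[OF C] finY h(1) in auto)
      moreover have "links {u1, c} Y = card (nb u1 \<inter> Y) + card (nb c \<inter> Y)" using h(2) by (simp add: links_def)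
      moreover have "nb u1 \<inter> Y \<noteq> {}" using u1 by blast
      then have "1 \<le> card (nb u1 \<inter> Y)" using finY by (simp add: Suc_le_eq card_gt_0_iff)
      ultimately show ?thesis using l2 by linarith
    qed
    have e3: "ecount (insert c (Y - {w1})) \<le> 3"
    proof -
      have "card (nb c \<inter> (Y - {w1})) \<le> card (nb c \<inter> Y)" using finY by (intro card_mono) auto
      moreover have "c \<notin> Y" using h(1) YC by blast
      ultimately show ?thesis using ecount_insert[of "Y - {w1}" c] finY e1 c1 by simp
    qed
    \<comment> \<open>Outside N[u1] there remain at most the vertex c opposite to u1 and Y without
      w1. They span at most three edges, whereas a triangle-free set of minimum degree 2 has at
      least four. So one vertex isolates W, but equality with nine edges would need two.\<close>
    have "degenerate (W - {} - cnb {u1})"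
    proof (rule ccontr)
      assume "\<not> degenerate (W - {} - cnb {u1})"
      then obtain H' where H': "H' \<subseteq> W - {} - cnb {u1}" "H' \<noteq> {}" "\<And>h. h \<in> H' \<Longrightarrow> k - 1 \<le> card (nb h \<inter> H')"
        using not_degenerateE by metis
      have sub: "H' \<subseteq> insert c (Y - {w1})"
        using H'(1) WYC h(1,3) u1(3) by (auto simp: cnb_def)
      have finH': "finite H'" using sub finY finite_subset by blast
      have "(k + 1) * (k - 1) \<le> 2 * ecount H'"
        by (rule core_ecount_no_clq[OF finH' H'(2,3)]) (use noclq H'(1) in auto)
      then have "4 \<le> ecount H'" using k' by simp
      moreover have "ecount H' \<le> ecount (insert c (Y - {w1}))" using sub finY by (intro ecount_mono) auto
      ultimately show False using e3 by linarith
    qed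
    then have "io W \<le> 1" using iso_num_le[of "{u1}" W "{}"] u1(1) WYC by simp
    moreover have "ecount W = 9"
      using ecount_comps_Diff[OF assms(1) Y(3)] P eY3 cyc4_ecount[OF c4] l2 by simp
    ultimately show False using tight t5 by simp
  qed
qed

section \<open>Graphs with cliques\<close>

lemma clqD: "clq Q \<Longrightarrow> a \<in> Q \<Longrightarrow> b \<in> Q \<Longrightarrow> a \<noteq> b \<Longrightarrow> b \<in> nb a"
  by (simp add: clq_def)

lemma pure_single_ecount:
  assumes "pure C {s} U u"
  shows "ecount C + 1 = t"
proof -
  note p = pure_pendant[OF assms]
  have C: "C = insert s (U s)" using pure_eq[OF assms] by simp
  have clq: "clq (U s)" using pendant_clq[OF p] by simp
  have "ecount C = ecount (U s) + card (nb s \<inter> U s)"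
    unfolding C using clq_finite[OF clq] pendantD(6)[OF p] by (intro ecount_insert) auto
  then show ?thesis using pendant_nb[OF p] clq_ecount[OF clq] by (simp add: t_def)
qed

context
  fixes W :: "'a set"
  assumes fin: "finite W" and conn: "conn W"
    and no_clq_comp: "\<And>x C. x \<in> W \<Longrightarrow> C \<in> comps (W - {x}) \<Longrightarrow> \<not> clq C"
    and IH: "\<And>C. conn C \<Longrightarrow> C \<subset> W \<Longrightarrow> \<not> clq C \<Longrightarrow> good C"
begin

text \<open>If all edges from C to Y ended in one vertex, \<open>comps_delete\<close> would make C a
  clique component left by the deletion of that vertex, which this context excludes.\<close>

lemma clq_comp_links:
  assumes "Y \<subseteq> W" "Y \<noteq> {}" "C \<in> comps (W - Y)" "clq C"
  obtains w1 w2 u1 u2 where "w1 \<in> Y" "w2 \<in> Y" "w1 \<noteq> w2" "u1 \<in> nb w1 \<inter> C" "u2 \<in> nb w2 \<inter> C"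
    "2 \<le> links C Y"
    "links C Y = 2 \<longrightarrow> nb w1 \<inter> C = {u1} \<and> nb w2 \<inter> C = {u2} \<and> (\<forall>w\<in>Y - {w1, w2}. nb w \<inter> C = {})"
proof -
  have ne: "\<exists>a\<in>C. \<not> nb a \<inter> Y \<subseteq> {x}" if x: "x \<in> Y" for x
  proof (rule ccontr)
    assume "\<not> ?thesis"
    then have "C \<in> comps (W - {x})" by (intro comps_delete[OF assms(3) x]) blast
    then show False using no_clq_comp[of x C] x assms(1,4) by blast
  qed
  show ?thesis
    by (rule links_ge_2[OF clq_finite[OF assms(4)] finite_subset[OF assms(1) fin] ne assms(2)])
      (assumption, rule that)
qed

text \<open>Q and an edge from v out of Q already give \<open>t - 1\<close> edges inside N[v], which
  pays for v, and no component has negative surplus. If W misses the strict bound, all these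
  estimates are exact, and only one vertex z and one edge can be added to Q. The lemma is a local
  test at any vertex of any clique with a neighbour outside it.\<close>

lemma clq_vertex_tight:
  assumes "\<not> t * io W < ecount W + 1" "Q \<subseteq> W" "clq Q" "v \<in> Q" "k \<le> card (nb v \<inter> W)"
  obtains z where "z \<notin> Q" "z \<in> W" "nb v \<inter> W = insert z (Q - {v})" "nb z \<inter> Q = {v}"
    "t \<le> ecount (insert z Q) + 1" "t * io W \<le> ecount W + 1"
    "\<And>C. C \<in> comps (W - insert z Q) \<Longrightarrow> surplus v (insert z Q) C = 0"
proof -
  define Y where "Y = insert v (nb v \<inter> W)"
  define R where "R = (nb v \<inter> W) - Q"
  have v: "v \<in> W" using assms(2,4) by blast
  have Y: "v \<in> Y" "Y \<subseteq> cnb {v}" "Y \<subseteq> W" using v by (auto simp: Y_def cnb_def)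
  have finY: "finite Y" using Y(3) fin finite_subset by blast
  let ?P = "comps (W - Y)"
  have finR: "finite R" using fin by (simp add: R_def)
  have nbv: "nb v \<inter> Q = Q - {v}" by (rule clq_nb[OF assms(3,4)])
  have nW: "nb v \<inter> W = (Q - {v}) \<union> R" using nbv assms(2) by (auto simp: R_def)
  have YQR: "Y = Q \<union> R" using nW assms(4) by (auto simp: Y_def)
  have QR: "Q \<inter> R = {}" by (auto simp: R_def)
  have finQ: "finite Q" using assms(3) by (rule clq_finite)
  have "card (nb v \<inter> W) = card (Q - {v}) + card R"
    unfolding nW using finQ finR QR by (intro card_Un_disjoint) auto
  then have R1: "1 \<le> card R" using assms(4,5) finQ clq_card[OF assms(3)] k_pos by simp
  have vr: "v \<in> nb r" if "r \<in> R" for r using that nb_sym by (auto simp: R_def)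
  have lR: "card R \<le> links R Q" using finR finQ vr assms(4) by (intro card_le_links) auto
  have eY: "ecount Y = (k choose 2) + ecount R + links R Q"
    unfolding YQR using ecount_Un[OF finQ finR QR] links_sym[OF finQ finR] clq_ecount[OF assms(3)] by simp
  have tY: "t \<le> ecount Y + 1" using eY lR R1 by (simp add: t_def)
  have s0: "0 \<le> surplus v Y C" if C: "C \<in> ?P" for C
  proof (cases "clq C")
    case True
    have "2 \<le> links C Y" by (rule clq_comp_links[OF Y(3) _ C True]) (use Y(1) in auto)
    then show ?thesis using surplus_clq[OF True, of Y v] by linarith
  next
    case False
    have "good C" using IH[OF comps_conn[OF C] _ False] comps_subset[OF C] v Y(1) by blast
    moreover have "1 \<le> links C Y" by (rule links_pos[OF conn fin Y(3) _ C]) (use Y(1) in auto)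
    ultimately show ?thesis using surplus_ge[OF good_bound, of C Y v] by linarith
  qed
  have finP: "finite ?P" using fin finite_comps by simp
  have sum0: "0 \<le> (\<Sum>C\<in>?P. surplus v Y C)" using s0 by (rule sum_nonneg)
  have "int (ecount Y) + 1 - int t + (\<Sum>C\<in>?P. surplus v Y C) \<le> 0"
    using excess_ge[OF fin Y] assms(1) unfolding bound_iff_excess by linarith
  then have eq: "int (ecount Y) + 1 = int t" "(\<Sum>C\<in>?P. surplus v Y C) = 0"
    using tY sum0 by linarith+
  have bound: "t * io W \<le> ecount W + 1"
    unfolding bound_iff_excess using excess_ge[OF fin Y] tY sum0 by linarith
  have sz: "surplus v Y C = 0" if "C \<in> ?P" for C
    using eq(2) sum_nonneg_eq_0_iff[OF finP s0] that by simp
  have "(k choose 2) + ecount R + links R Q + 1 = t" using eq(1) eY by linarith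
  then have l1: "links R Q = 1" "card R = 1" using lR R1 by (simp_all add: t_def)
  then obtain z where z: "R = {z}" by (auto simp: card_1_singleton_iff)
  have "card (nb z \<inter> Q) = 1" using l1(1) z by simp
  moreover have "v \<in> nb z \<inter> Q" using vr z assms(4) by blast
  ultimately have nz: "nb z \<inter> Q = {v}" by (metis card_1_singletonE singletonD)
  have Yz: "Y = insert z Q" using YQR z by auto
  show ?thesis
  proof (rule that[of z])
    show "z \<notin> Q" "z \<in> W" using z unfolding R_def by auto
    show "nb v \<inter> W = insert z (Q - {v})" using nW z by auto
    show "nb z \<inter> Q = {v}" by (rule nz)
    show "t \<le> ecount (insert z Q) + 1" using tY Yz by simp
    show "t * io W \<le> ecount W + 1" by (rule bound)
    show "surplus v (insert z Q) C = 0" if "C \<in> comps (W - insert z Q)" for C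
      using sz that Yz by simp
  qed
qed

lemma clq_vertex_tight_ex:
  assumes "\<not> t * io W < ecount W + 1" "Q \<subseteq> W" "clq Q" "v \<in> Q" "k \<le> card (nb v \<inter> W)"
  shows "\<exists>z. nb v \<inter> W = insert z (Q - {v}) \<and>
    (\<forall>C\<in>comps (W - insert z Q). surplus v (insert z Q) C = 0)"
  by (rule clq_vertex_tight[OF assms]) blast

text \<open>A pendant clique of C that avoids y is not adjacent to x, so its foot s alone would cut
  it off from W.\<close>

lemma pure_comp_attached:
  assumes "x \<in> W" "C \<in> comps (W - {x})" "nb x \<inter> C = {y}" "pure C S U u" "s \<in> S"
  shows "y \<in> U s"
proof (rule ccontr)
  assume y: "y \<notin> U s"
  note p = pure_pendant[OF assms(4)]
  note D = pendantD[OF p assms(5)]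
  have clq: "clq (U s)" by (rule pendant_clq[OF p assms(5)])
  have CW: "C \<subseteq> W" using comps_subset[OF assms(2)] by blast
  have "nb a \<inter> (W - {s}) \<subseteq> U s" if a: "a \<in> U s" for a
  proof -
    have aC: "a \<in> C" using D(2) a by blast
    have "a \<notin> nb x"
    proof
      assume "a \<in> nb x"
      then have "a = y" using assms(3) aC by auto
      then show False using y a by blast
    qed
    then have "nb a \<inter> W = nb a \<inter> C" using nb_comp_delete[OF assms(2,1) aC] by simp
    then show ?thesis using D(7)[OF a] by (auto split: if_splits)
  qed
  moreover have "U s \<subseteq> W - {s}" using D(2,6) CW by blast
  ultimately have "U s \<in> comps (W - {s})" using clq_conn[OF clq] unfolding comps_def by blast
  then show False using no_clq_comp[of s "U s"] clq D(1) CW by blast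
qed

text \<open>Let xy be the only edge from C to Y. If C is pure, all its pendant cliques contain y, so
  there is just one and C has \<open>t - 1\<close> edges; unless k is 1 or 2, x destroys C and the
  edge xy completes the payment. The small exceptions can be relabelled with foot y, which again
  contradicts \<open>pure_comp_attached\<close>. In a 5-cycle, y has two neighbours outside an edge
  of the cycle, against \<open>clq_vertex_tight\<close>. A 4-cycle is destroyed by x and has
  \<open>t - 1\<close> edges.\<close>

lemma single_link_not_tight:
  assumes ns: "\<not> t * io W < ecount W + 1"
    and "Y \<subseteq> W" "C \<in> comps (W - Y)" "links C Y = 1" "extremal C"
  shows False
proof -
  have finC: "finite C" and finY: "finite Y"
    using finite_comp[OF _ assms(3)] fin assms(2) finite_subset by auto
  obtain x y where xy: "x \<in> Y" "y \<in> C" "nb x \<inter> C = {y}" "nb y \<inter> Y = {x}"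
    "\<And>a. a \<in> C \<Longrightarrow> nb a \<inter> Y \<subseteq> {x}"
    using single_link[OF finC finY assms(4)] by metis
  have xW: "x \<in> W" using xy(1) assms(2) by blast
  have Cx: "C \<in> comps (W - {x})" by (rule comps_delete[OF assms(3) xy(1,5)])
  have CW: "C \<subseteq> W" "x \<notin> C" using comps_subset[OF Cx] by auto
  have l1: "1 \<le> links C {x}" by (rule links_pos[OF conn fin _ _ Cx]) (use xW in auto)
  have ndeg: "\<not> (degenerate (C - cnb {x}) \<and> t \<le> ecount C + 1)"
  proof
    assume *: "degenerate (C - cnb {x}) \<and> t \<le> ecount C + 1"
    have "t * io W < ecount W + 1"
    proof (rule delete_vertex_strict[OF fin conn xW Cx conjunct1[OF *]])
      show "t \<le> ecount C + links C {x}" using * l1 by linarith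
      show "good D" if "D \<in> comps (W - {x})" "\<not> clq D" for D
        using IH[OF comps_conn[OF that(1)] _ that(2)] comps_subset[OF that(1)] xW by blast
    qed
    then show False using ns by blast
  qed
  from assms(5) consider S U u where "pure C S U u" | "k = 2" "cyc5 C" | "k = 3" "cyc4 C"
    unfolding extremal_def by blast
  then show False
  proof cases
    case 1
    obtain s where s: "s \<in> S" using pure_conn[OF 1] unfolding conn_def by blast
    have yU: "y \<in> U s'" if "s' \<in> S" for s' by (rule pure_comp_attached[OF xW Cx xy(3) 1 that])
    have "s' = s" if "s' \<in> S" for s'
      using pendantD(8)[OF pure_pendant[OF 1] that s] yU[OF that] yU[OF s] by blast
    then have "S = {s}" using s by blast
    then have p: "pure C {s} U u" using 1 by simp
    have "y \<in> nb x" using xy(3) by blast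
    then have "\<not> (3 \<le> k \<or> k = 2 \<and> y = u s)"
      using ndeg pure_single_ecount[OF p] pure_single_degenerate[OF p yU[OF s]] by auto
    then have "k = 1 \<or> k = 2 \<and> y \<noteq> u s" using k_pos by linarith
    then obtain U' u' where p': "pure C {y} U' u'" using pure_single_relabel[OF p yU[OF s]] by blast
    have "y \<in> U' y" by (rule pure_comp_attached[OF xW Cx xy(3) p']) simp
    then show False using pendantD(6)[OF pure_pendant[OF p']] by blast
  next
    case 2
    obtain b c d e where h: "C = {y, b, c, d, e}" "distinct [y, b, c, d, e]" "nb y \<inter> C = {b, e}"
      by (rule cyc5E[OF 2(2) xy(2)])
    have yb: "b \<in> nb y" "e \<in> nb y" "y \<in> nb b" "x \<in> nb y" using h(3) xy(4) nb_sym by blast+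
    have clq: "clq {y, b}" unfolding clq_def using 2(1) yb h(2) by auto
    have "{b, e} \<subseteq> nb y \<inter> W" using yb h(1) CW(1) by blast
    then have "card {b, e} \<le> card (nb y \<inter> W)" using fin by (intro card_mono) auto
    then have "k \<le> card (nb y \<inter> W)" using 2(1) h(2) by simp
    moreover have "{y, b} \<subseteq> W" using h(1) CW(1) by blast
    ultimately obtain z where z: "nb y \<inter> W = insert z ({y, b} - {y})"
      using clq_vertex_tight_ex[OF ns _ clq, of y] by blast
    have "x = z" using z yb(4) xW CW(2) h(1) by blast
    moreover have "e = z" using z yb(2) h(1,2) CW(1) by auto
    ultimately show False using CW(2) h(1) by blast
  next
    case 3
    have "degenerate (C - cnb {x})" by (rule cyc4_degenerate[of C y]) (use 3 xy in auto)
    then show False using ndeg cyc4_ecount[OF 3(2)] t_3[OF 3(1)] by simp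
  qed
qed

text \<open>A component that is no clique and has surplus 0 would attain its bound and hang on one
  edge, which \<open>single_link_not_tight\<close> excludes.\<close>

lemma tight_comp_clq:
  assumes ns: "\<not> t * io W < ecount W + 1"
    and "v \<in> Y" "Y \<subseteq> W" "C \<in> comps (W - Y)" "surplus v Y C = 0"
  shows "clq C \<and> links C Y = 2"
proof (cases "clq C")
  case True
  have "2 \<le> links C Y" by (rule clq_comp_links[OF assms(3) _ assms(4) True]) (use assms(2) in auto)
  then show ?thesis using surplus_clq[OF True, of Y v] True assms(5) by linarith
next
  case False
  have g: "good C" using IH[OF comps_conn[OF assms(4)] _ False] comps_subset[OF assms(4)] assms(2,3) by blast
  have "1 \<le> links C Y" by (rule links_pos[OF conn fin assms(3) _ assms(4)]) (use assms(2) in auto)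
  then have l1: "links C Y = 1" using surplus_ge[OF good_bound[OF g], of Y v] assms(5) by linarith
  have "int (t * iso_num (cnb {v}) C) = int (ecount C + 1)"
    using assms(5) l1 unfolding surplus_def by simp
  then have "t * iso_num (cnb {v}) C = ecount C + 1" by (rule of_nat_eq_iff[THEN iffD1])
  moreover have "t * iso_num (cnb {v}) C \<le> t * io C"
    using iso_num_mono[of "{}" "cnb {v}" C] by simp
  ultimately have "t * io C = ecount C + 1" using good_bound[OF g] by linarith
  then have "extremal C" using g by (simp add: good_def)
  then show ?thesis using single_link_not_tight[OF ns assms(3,4) l1] by blast
qed

text \<open>Choosing z removes a vertex from both cliques. The rest of each has \<open>k - 1\<close>
  vertices, so only the ends of the single edge between Q and C could have degree
  \<open>k - 1\<close>, and two vertices are too few for \<open>k >= 3\<close>.\<close>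

lemma two_clq_io:
  assumes "3 \<le> k" "W = insert z (Q \<union> C)" "clq Q" "clq C" "Q \<inter> C = {}" "v \<in> Q" "v \<in> nb z" "u1 \<in> C" "u1 \<in> nb z"
    and "\<And>q c. q \<in> Q \<Longrightarrow> c \<in> C \<Longrightarrow> c \<in> nb q \<Longrightarrow> q = w2 \<and> c = u2"
  shows "io W \<le> 1"
proof -
  have "degenerate (W - {} - cnb {z})"
  proof (rule ccontr)
    assume "\<not> degenerate (W - {} - cnb {z})"
    then obtain H where H: "H \<subseteq> W - {} - cnb {z}" "H \<noteq> {}" "\<And>h. h \<in> H \<Longrightarrow> k - 1 \<le> card (nb h \<inter> H)"
      using not_degenerateE by metis
    have HQC: "H \<subseteq> (Q - {v}) \<union> (C - {u1})" using H(1) assms(2,7,9) by (auto simp: cnb_def)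
    have finH: "finite H" using HQC clq_finite[OF assms(3)] clq_finite[OF assms(4)] finite_subset by blast
    have small: "card (nb h \<inter> H) < k - 1" if "nb h \<inter> H \<subseteq> K - {a} - {h}" "clq K" "h \<in> K" "a \<in> K" "a \<noteq> h" for h K a
    proof -
      have "card (nb h \<inter> H) \<le> card (K - {a} - {h})"
        using that(1) clq_finite[OF that(2)] by (intro card_mono) auto
      also have "\<dots> = k - 2" using that(3-5) clq_finite[OF that(2)] clq_card[OF that(2)] by simp
      finally show ?thesis using assms(1) by linarith
    qed
    have "h \<in> {w2, u2}" if h: "h \<in> H" for h
    proof (rule ccontr)
      assume nh: "h \<notin> {w2, u2}"
      from h HQC consider "h \<in> Q" "h \<noteq> v" | "h \<in> C" "h \<noteq> u1" by blast
      then have "card (nb h \<inter> H) < k - 1"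
      proof cases
        case 1
        have "nb h \<inter> C = {}" using assms(10)[OF 1(1)] nh by blast
        then have "nb h \<inter> H \<subseteq> Q - {v} - {h}" using HQC nb_irrefl by blast
        then show ?thesis using small 1 assms(3,6) by blast
      next
        case 2
        have "nb h \<inter> Q = {}" using assms(10)[OF _ 2(1)] nh nb_sym by blast
        then have "nb h \<inter> H \<subseteq> C - {u1} - {h}" using HQC nb_irrefl by blast
        then show ?thesis using small 2 assms(4,8) by blast
      qed
      then show False using H(3)[OF h] by linarith
    qed
    then have H2: "H \<subseteq> {w2, u2}" by blast
    obtain h where h: "h \<in> H" using H(2) by blast
    have "nb h \<inter> H \<subseteq> {w2, u2} - {h}" using H2 by auto
    then have "card (nb h \<inter> H) \<le> card ({w2, u2} - {h})" by (intro card_mono) auto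
    also have "\<dots> < 2" using h H2 by (auto simp: card_insert_if card_Diff_singleton_if)
    finally show False using H(3)[OF h] assms(1) by linarith
  qed
  then show ?thesis using iso_num_le[of "{z}" W "{}"] assms(2) by simp
qed

text \<open>Since z does not cut off Q, there is a second clique C, joined to N[v] by two edges.
  Tightness applied again at the ends of these edges says that each has one neighbour outside C and
  that removing its closed neighbourhood leaves only cliques. This determines W: it is a 5-cycle for
  k = 2 and contradictory otherwise.\<close>

lemma clq_good:
  assumes "\<not> clq W" "Q \<subseteq> W" "clq Q"
  shows "good W"
proof (rule ccontr)
  assume ngood: "\<not> good W"
  then have ns: "\<not> t * io W < ecount W + 1" using strict_good by blast
  have QW: "Q \<noteq> W" using assms(1,3) by blast
  obtain v b where vb: "v \<in> Q" "b \<in> W" "b \<notin> Q" "b \<in> nb v"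
    by (rule connD[OF conn assms(2) clq_nonempty[OF assms(3)] QW])
  have deg: "k \<le> card (nb a \<inter> W)" if "clq K" "K \<subseteq> W" "a \<in> K" "b \<in> W" "b \<notin> K" "b \<in> nb a" for K a b
  proof -
    have "insert b (K - {a}) \<subseteq> nb a \<inter> W" using clq_nb[OF that(1,3)] that by blast
    then have "card (insert b (K - {a})) \<le> card (nb a \<inter> W)" using fin by (intro card_mono) auto
    then show ?thesis using that(3,5) clq_finite[OF that(1)] clq_card[OF that(1)] k_pos by simp
  qed
  obtain z where z: "z \<notin> Q" "z \<in> W" "nb v \<inter> W = insert z (Q - {v})" "nb z \<inter> Q = {v}"
    "t \<le> ecount (insert z Q) + 1" "t * io W \<le> ecount W + 1"
    "\<And>C. C \<in> comps (W - insert z Q) \<Longrightarrow> surplus v (insert z Q) C = 0"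
    by (rule clq_vertex_tight[OF ns assms(2,3) vb(1) deg[OF assms(3,2) vb]]) blast
  define Y where "Y = insert z Q"
  have Y: "v \<in> Y" "Y \<subseteq> W" using vb(1) z(2) assms(2) by (auto simp: Y_def)
  have YW: "W \<noteq> Y"
  proof
    assume "W = Y"
    then have "W - {z} = Q" using z(1) by (auto simp: Y_def)
    then have "Q \<in> comps (W - {z})" using clq_conn[OF assms(3)] by (auto simp: comps_def)
    then show False using no_clq_comp[OF z(2)] assms(3) by blast
  qed
  then obtain q where "q \<in> W - Y" using Y(2) by blast
  then obtain C where C: "C \<in> comps (W - Y)" using comps_cover[of "W - Y" q] fin by blast
  have CY: "C \<subseteq> W" "C \<inter> Y = {}" using comps_subset[OF C] by auto
  have allclq: "clq D \<and> links D Y = 2" if "D \<in> comps (W - Y)" for D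
    using tight_comp_clq[OF ns Y that] z(7) that unfolding Y_def by blast
  have clqC: "clq C" and l2: "links C Y = 2" using allclq[OF C] by auto
  obtain w1 w2 u1 u2 where w: "w1 \<in> Y" "w2 \<in> Y" "w1 \<noteq> w2" "u1 \<in> nb w1 \<inter> C" "u2 \<in> nb w2 \<inter> C"
    and n: "nb w1 \<inter> C = {u1} \<and> nb w2 \<inter> C = {u2} \<and> (\<forall>w\<in>Y - {w1, w2}. nb w \<inter> C = {})"
    using clq_comp_links[OF Y(2) _ C clqC] l2 Y(1) by (metis empty_iff)
  have nbvC: "nb v \<inter> C = {}" using z(3) CY by (auto simp: Y_def)
  have wv: "w1 \<noteq> v" "w2 \<noteq> v" using nbvC w(4,5) by blast+
  have wW: "w1 \<in> W" "w2 \<in> W" "w1 \<notin> C" "w2 \<notin> C" using w(1,2) Y(2) CY(2) by blast+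
  have nbu: "nb u \<inter> W = insert a (C - {u})" if uc: "u \<in> C" "a \<in> Y" "u \<in> nb a" for u a
  proof -
    have a: "a \<in> W" "a \<notin> C" "a \<in> nb u" using uc Y(2) CY(2) nb_sym by blast+
    obtain z' where "nb u \<inter> W = insert z' (C - {u})"
      using clq_vertex_tight_ex[OF ns CY(1) clqC uc(1) deg[OF clqC CY(1) uc(1) a]] by blast
    moreover from this have "a = z'" using a by blast
    ultimately show ?thesis by simp
  qed
  \<comment> \<open>A common end in C would have two neighbours outside C.\<close>
  have u12: "u1 \<noteq> u2"
  proof
    assume "u1 = u2"
    then have "insert w1 (C - {u1}) = insert w2 (C - {u1})"
      using nbu[of u1 w1] nbu[of u1 w2] w by auto
    then show False using w(3) wW(3,4) by blast
  qed
  have clqC': "D \<in> comps (W - insert a C) \<Longrightarrow> clq D" if uc: "u \<in> C" "a \<in> Y" "u \<in> nb a" for D u a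
  proof -
    assume D: "D \<in> comps (W - insert a C)"
    have a: "a \<in> W" "a \<notin> C" "a \<in> nb u" using uc Y(2) CY(2) nb_sym by blast+
    obtain z' where z': "nb u \<inter> W = insert z' (C - {u})"
       "\<And>C'. C' \<in> comps (W - insert z' C) \<Longrightarrow> surplus u (insert z' C) C' = 0"
      using clq_vertex_tight_ex[OF ns CY(1) clqC uc(1) deg[OF clqC CY(1) uc(1) a]] by blast
    have "a = z'" using z'(1) a by blast
    then show "clq D"
      using tight_comp_clq[OF ns _ _ D, of u] z'(2)[of D] D uc(1) a(1) CY(1) by blast
  qed
  \<comment> \<open>One of the two edges ends in z. Then \<open>insert z C\<close> is the closed
    neighbourhood of \<open>u1'\<close> in W, and its removal leaves Q as a component. A further
    clique would need a neighbour in Q, so W consists of z, Q and C only. It has at least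
    \<open>t + 1\<close> edges while z alone isolates it.\<close>
  have two: False if k3: "3 \<le> k" and wz: "w1' = z" and w': "w2' \<in> Y" "w2' \<noteq> w1'"
    and n': "nb w1' \<inter> C = {u1'}" "nb w2' \<inter> C = {u2'}" "\<forall>w\<in>Y - {w1', w2'}. nb w \<inter> C = {}" for w1' w2' u1' u2'
  proof -
    have u1': "u1' \<in> C" "u1' \<in> nb z" using n'(1) wz by blast+
    have zY: "z \<in> Y" by (simp add: Y_def)
    have vW: "v \<in> W - insert z C" using vb(1) assms(2) z(1) CY(2) Y(1) by blast
    then obtain K where K: "K \<in> comps (W - insert z C)" "v \<in> K" using comps_cover[of "W - insert z C" v] fin by blast
    have clqK: "clq K" by (rule clqC'[OF u1'(1) zY u1'(2) K(1)])
    have "Q \<subseteq> W - insert z C" using assms(2) z(1) CY(2) by (auto simp: Y_def)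
    then have "Q \<subseteq> K" using K clq_nb[OF assms(3) vb(1)] unfolding comps_def by blast
    then have KQ: "Q = K" using clq_subset_eq[OF assms(3) clqK] by blast
    have one: "D = C" if D: "D \<in> comps (W - Y)" for D
    proof (rule ccontr)
      assume DC: "D \<noteq> C"
      have dis: "D \<inter> C = {}" by (rule comps_disjoint[OF D C DC])
      have DY: "D \<subseteq> W - Y" using comps_subset[OF D] .
      obtain a1 a2 d1 d2 where a: "a1 \<in> Y" "a2 \<in> Y" "a1 \<noteq> a2" "d1 \<in> nb a1 \<inter> D" "d2 \<in> nb a2 \<inter> D"
        using clq_comp_links[OF Y(2) _ D] allclq[OF D] Y(1) by (metis empty_iff)
      then obtain a d where "a \<in> Y" "a \<noteq> z" "d \<in> nb a \<inter> D" by metis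
      then have "a \<in> K" "d \<in> nb a" "d \<in> W - insert z C" "d \<notin> Q"
        using KQ DY dis zY by (auto simp: Y_def)
      then show False using K(1) KQ unfolding comps_def by blast
    qed
    have P: "comps (W - Y) = {C}" using one C by blast
    have WYC: "W = Y \<union> C" using Union_comps[of "W - Y"] P fin Y(2) by auto
    have io1: "io W \<le> 1"
    proof (rule two_clq_io[OF k3 _ assms(3) clqC _ vb(1) _ u1'])
      show "W = insert z (Q \<union> C)" using WYC by (simp add: Y_def)
      show "Q \<inter> C = {}" using CY(2) by (auto simp: Y_def)
      show "v \<in> nb z" using z(4) by blast
      show "q = w2' \<and> c = u2'" if "q \<in> Q" "c \<in> C" "c \<in> nb q" for q c
      proof -
        have "q \<noteq> w1'" using that(1) wz z(1) by blast
        then have "q = w2'" using n'(3) that by (auto simp: Y_def)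
        then show ?thesis using n'(2) that by blast
      qed
    qed
    have "ecount W = ecount Y + (ecount C + 2)" using ecount_comps_Diff[OF fin Y(2)] P l2 by simp
    then have "t + 1 \<le> ecount W" using z(5) unfolding Y_def by linarith
    moreover have "t * io W \<le> t * 1" using io1 by (intro mult_left_mono) auto
    ultimately show False using ns by simp
  qed
  \<comment> \<open>If both edges end in Q, the clique left around v after removing N[u1] contains
    w2 and z. They would be adjacent, but v is the only neighbour of z in Q.\<close>
  have notz: False if wz: "w1 \<noteq> z" "w2 \<noteq> z"
  proof -
    have wQ: "w1 \<in> Q" "w2 \<in> Q" using w(1,2) wz by (auto simp: Y_def)
    have u1: "u1 \<in> C" "u1 \<in> nb w1" using w(4) by auto
    have vW: "v \<in> W - insert w1 C" using vb(1) assms(2) wv CY(2) Y(1) by blast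
    then obtain K where K: "K \<in> comps (W - insert w1 C)" "v \<in> K" using comps_cover[of "W - insert w1 C" v] fin by blast
    have clqK: "clq K" by (rule clqC'[OF u1(1) w(1) u1(2) K(1)])
    have "w2 \<in> nb v" "z \<in> nb v" using z(3) wQ wv by blast+
    moreover have "w2 \<in> W - insert w1 C" "z \<in> W - insert w1 C"
      using wW w(3) wz z(2) CY(2) by (auto simp: Y_def)
    ultimately have "w2 \<in> K" "z \<in> K" using K unfolding comps_def by blast+
    then have "w2 \<in> nb z" using clqD[OF clqK] wz(2) by metis
    then show False using z(4) wQ(2) wv by blast
  qed
  consider "k = 1" | "k = 2" | "3 \<le> k" using k_pos by linarith
  then show False
  proof cases
    case 1
    have "Q = {v}" using clq_card[OF assms(3)] 1 vb(1) by (auto simp: card_1_singleton_iff)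
    then have "nb v \<inter> (W - {z}) \<subseteq> Q" using z(3) by blast
    then have "Q \<in> comps (W - {z})"
      using \<open>Q = {v}\<close> clq_conn[OF assms(3)] assms(2) z(1) unfolding comps_def by blast
    then show False using no_clq_comp[OF z(2)] assms(3) by blast
  next
    case 3
    then show False using two[OF 3, of w1 w2 u1 u2] two[OF 3, of w2 w1 u2 u1] notz w(1-3) n by (metis insert_commute)
  next
    case 2
    have k2: "k = 2" by fact
    \<comment> \<open>For k = 2 tightness at v, at the ends in C and at w1 and w2 gives each of the
      five vertices exactly two neighbours, all among the five. Connectedness then leaves no room
      for others.\<close>
    have nbv: "nb v \<inter> W = {w1, w2}"
    proof -
      have "card (nb v \<inter> W) = 2"
        unfolding z(3) using z(1) clq_finite[OF assms(3)] clq_card[OF assms(3)] vb(1) 2 by simp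
      moreover have "{w1, w2} \<subseteq> nb v \<inter> W" using z(3) w(1,2) wv by (auto simp: Y_def)
      ultimately show ?thesis using w(3) fin by (intro card_seteq[symmetric]) auto
    qed
    have "C = {u1, u2}"
      using u12 w(4,5) clq_card[OF clqC] clq_finite[OF clqC] 2 by (intro card_seteq[symmetric]) auto
    then have Cu: "C = {u1, u2}" "C - {u1} = {u2}" "C - {u2} = {u1}" using u12 by auto
    have nbu1: "nb u1 \<inter> W = {w1, u2}" and nbu2: "nb u2 \<inter> W = {w2, u1}"
      using nbu[of u1 w1] nbu[of u2 w2] w Cu(2,3) by auto
    have nbw: "nb a \<inter> W = {c, v}" if "a \<in> {w1, w2}" "c \<in> nb a \<inter> C" for a c
    proof -
      have av: "a \<in> nb v" "v \<in> nb a" "a \<noteq> v" "a \<in> W" using nbv that(1) wv nb_sym by blast+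
      have clq: "clq {a, v}" unfolding clq_def using 2 av by auto
      have sub: "{a, v} \<subseteq> W" using av assms(2) vb(1) by blast
      have c: "c \<in> W" "c \<notin> {a, v}" "c \<in> nb a" using that(2) CY Y wW(3,4) that(1) by blast+
      obtain z' where z': "nb a \<inter> W = insert z' ({a, v} - {a})"
        using clq_vertex_tight_ex[OF ns sub clq _ deg[OF clq sub _ c]] by blast
      then have "c = z'" using c by blast
      then show ?thesis using z' av(3) by auto
    qed
    have nbw1: "nb w1 \<inter> W = {u1, v}" and nbw2: "nb w2 \<inter> W = {u2, v}" using nbw w(4,5) by blast+
    let ?F = "{v, w1, u1, u2, w2}"
    have uW: "u1 \<in> W" "u2 \<in> W" "v \<in> W" using Cu(1) CY(1) Y by blast+
    have "?F = W"
    proof (rule conn_closed_eq[OF conn])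
      show "?F \<subseteq> W" using uW wW by blast
      fix a assume "a \<in> ?F"
      then show "nb a \<inter> W \<subseteq> ?F" using nbv nbw1 nbw2 nbu1 nbu2 by auto
    qed simp
    then have WF: "W = {v, w1, u1, u2, w2}" by (rule sym)
    have dist: "distinct [v, w1, u1, u2, w2]"
      using wv w(3) u12 wW(3,4) Cu(1) CY(2) Y(1) by auto
    have adj: "w1 \<in> nb v" "u1 \<in> nb w1" "u2 \<in> nb u1" "w2 \<in> nb u2" "v \<in> nb w2"
      using equalityD2[OF nbv] equalityD2[OF nbw1] equalityD2[OF nbu1] equalityD2[OF nbu2] equalityD2[OF nbw2]
      by simp_all
    have ne: "u1 \<noteq> w1" "u1 \<noteq> w2" "u2 \<noteq> w1" "u2 \<noteq> w2" "u2 \<noteq> u1" "u2 \<noteq> v"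
      "w2 \<noteq> u1" "w2 \<noteq> v" "w2 \<noteq> w1" "w2 \<noteq> u2"
      using dist by auto
    have notin: "q \<notin> nb a" if "nb a \<inter> W = S" "q \<in> W" "q \<notin> S" for a q S
      using that by blast
    have nadj: "u1 \<notin> nb v" "u2 \<notin> nb v" "u2 \<notin> nb w1" "w2 \<notin> nb w1" "w2 \<notin> nb u1"
      using notin[OF nbv uW(1)] notin[OF nbv uW(2)] notin[OF nbw1 uW(2)] notin[OF nbw1 wW(2)]
        notin[OF nbu1 wW(2)] ne by simp_all
    have "cyc5 W" unfolding cyc5_def
      by (rule exI[of _ v], rule exI[of _ w1], rule exI[of _ u1], rule exI[of _ u2], rule exI[of _ w2])
        (intro conjI WF dist adj nadj)
    then have "extremal W" using 2 unfolding extremal_def by blast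
    then show False using ngood z(6) unfolding good_def by blast
  qed
qed

end

theorem good_conn:
  assumes "finite W" "conn W" "\<not> clq W"
  shows "good W"
  using assms
proof (induction W rule: finite_psubset_induct)
  case (psubset W)
  note fin = psubset.hyps and conn = psubset.prems(1) and nclq = psubset.prems(2)
  have IH: "good C" if "conn C" "C \<subset> W" "\<not> clq C" for C
    using psubset.IH[OF that(2,1,3)] .
  show ?case
  proof (cases "degenerate W")
    case True
    then have "io W = 0" by (intro iso_num_eq_0) simp
    then show ?thesis by (simp add: good_def)
  next
    case nondeg: False
    show ?thesis
    proof (cases "\<exists>x\<in>W. \<exists>K\<in>comps (W - {x}). clq K")
      case True
      then obtain x K where xK: "x \<in> W" "K \<in> comps (W - {x})" "clq K" by blast
      show ?thesis
      proof (rule delete_vertex_clq[OF fin conn xK])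
        fix C assume C: "C \<in> comps (W - {x})" "\<not> clq C"
        have "C \<subset> W" using comps_subset[OF C(1)] xK(1) by blast
        then show "good C" using IH[OF comps_conn[OF C(1)] _ C(2)] by blast
      qed
    next
      case no: False
      then have ncc: "\<And>x C. x \<in> W \<Longrightarrow> C \<in> comps (W - {x}) \<Longrightarrow> \<not> clq C" by blast
      show ?thesis
      proof (cases "\<exists>Q\<subseteq>W. clq Q")
        case True
        then obtain Q where "Q \<subseteq> W" "clq Q" by blast
        then show ?thesis by (intro clq_good[OF fin conn _ _ nclq]) (use ncc IH in blast)+
      next
        case False
        then have nq: "\<And>Q. Q \<subseteq> W \<Longrightarrow> \<not> clq Q" by blast
        show ?thesis
        proof (rule no_clq_good[OF fin conn nondeg nq])
          fix C assume "conn C" "C \<subset> W"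
          then show "good C" using IH nq by blast
        qed
      qed
    qed
  qed
qed

section \<open>Colourings, trees and subgraphs\<close>

text \<open>Connectedness lets H grow by one vertex at a time, each bringing at least one
  edge.\<close>

lemma conn_ecount_ge:
  assumes "finite W" "conn W" "H \<subseteq> W" "H \<noteq> {}"
  shows "ecount H + card (W - H) \<le> ecount W"
  using assms(3,4)
proof (induction "card (W - H)" arbitrary: H)
  case 0
  then have "H = W" using assms(1) by auto
  then show ?case by simp
next
  case (Suc n)
  then have "H \<noteq> W" by auto
  then obtain a b where ab: "a \<in> H" "b \<in> W" "b \<notin> H" "b \<in> nb a"
    by (rule connD[OF assms(2) Suc.prems])
  have finH: "finite H" using Suc.prems(1) assms(1) finite_subset by blast
  have "W - H = insert b (W - insert b H)" using ab by auto
  then have c: "card (W - H) = Suc (card (W - insert b H))"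
    using assms(1) by (metis Diff_iff card_insert_disjoint finite_Diff insertI1)
  have "ecount (insert b H) + card (W - insert b H) \<le> ecount W"
    using Suc.hyps(1)[of "insert b H"] Suc.hyps(2) Suc.prems(1) c ab(2) by simp
  moreover have "a \<in> nb b \<inter> H" using ab nb_sym by blast
  then have "1 \<le> card (nb b \<inter> H)" using finH by (metis One_nat_def Suc_leI card_gt_0_iff empty_iff finite_Int)
  ultimately show ?case using c ecount_insert[OF finH ab(3)] by simp
qed

lemma ecount_UN_ge:
  assumes "finite F" "\<And>s. s \<in> F \<Longrightarrow> finite (U s)" "\<And>s s'. s \<in> F \<Longrightarrow> s' \<in> F \<Longrightarrow> s \<noteq> s' \<Longrightarrow> U s \<inter> U s' = {}"
  shows "(\<Sum>s\<in>F. ecount (U s)) \<le> ecount (\<Union>s\<in>F. U s)"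
  using assms
proof (induction F rule: finite_induct)
  case (insert a F)
  have "U a \<inter> U s = {}" if "s \<in> F" for s using insert.prems(2)[of a s] insert.hyps(2) that by auto
  then have dis: "U a \<inter> (\<Union>s\<in>F. U s) = {}" by blast
  have "(\<Sum>s\<in>F. ecount (U s)) \<le> ecount (\<Union>s\<in>F. U s)" using insert by simp
  moreover have "ecount (U a \<union> (\<Union>s\<in>F. U s)) = ecount (U a) + ecount (\<Union>s\<in>F. U s) + links (U a) (\<Union>s\<in>F. U s)"
    using insert by (intro ecount_Un dis) auto
  ultimately show ?case using insert.hyps by simp
qed simp

text \<open>Every constituent accounts for \<open>t - 1\<close> edges: those of its clique and the
  one to its foot. When the bound is attained, at most \<open>card S - 1\<close> edges are left for
  the feet, which makes them a tree.\<close>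

lemma pure_ecount_ge:
  assumes "pure W S U u" "finite W"
  shows "ecount S + card S * (t - 1) \<le> ecount W"
proof -
  note p = pure_pendant[OF assms(1)]
  let ?X = "\<Union>s\<in>S. U s"
  have finS: "finite S" using pure_finite[OF assms] .
  have finU: "finite (U s)" if "s \<in> S" for s using clq_finite[OF pendant_clq[OF p that]] .
  have "ecount (S \<union> ?X) = ecount S + ecount ?X + links S ?X"
    using finS finU pendantD(3)[OF p] by (intro ecount_Un) auto
  moreover have "(\<Sum>s\<in>S. ecount (U s)) \<le> ecount ?X"
    using pendantD(8)[OF p] by (intro ecount_UN_ge finS finU) auto
  moreover have "(\<Sum>s\<in>S. ecount (U s)) = card S * (k choose 2)"
    using clq_ecount[OF pendant_clq[OF p]] by simp
  moreover have "card S \<le> links S ?X"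
  proof (rule card_le_links)
    fix s assume s: "s \<in> S"
    then show "nb s \<inter> ?X \<noteq> {}" using pendant_nb[OF p s] by blast
  qed (use finS finU in auto)
  moreover have "card S * (t - 1) = card S * (k choose 2) + card S" by (simp add: t_def)
  ultimately show ?thesis using pure_eq[OF assms(1)] by simp
qed

text \<open>Greedy colouring: the vertices other than a low-degree vertex h are coloured first, and
  the neighbours of h cannot occupy all \<open>k - 1\<close> colours.\<close>

lemma degenerate_colouring:
  assumes "finite A" "degenerate A"
  shows "\<exists>c. c ` A \<subseteq> {..<k - 1} \<and> (\<forall>a\<in>A. \<forall>b\<in>A. b \<in> nb a \<longrightarrow> c a \<noteq> c b)"
  using assms
proof (induction A rule: finite_psubset_induct)
  case (psubset A)
  show ?case
  proof (cases "A = {}")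
    case False
    then obtain h where h: "h \<in> A" "card (nb h \<inter> A) < k - 1"
      using psubset.prems unfolding degenerate_def by blast
    have "degenerate (A - {h})" by (rule degenerate_mono[OF psubset.prems]) auto
    then obtain c where c: "c ` (A - {h}) \<subseteq> {..<k - 1}"
        "\<forall>a\<in>A - {h}. \<forall>b\<in>A - {h}. b \<in> nb a \<longrightarrow> c a \<noteq> c b"
      using psubset.IH[of "A - {h}"] h(1) by blast
    have "card (c ` (nb h \<inter> A)) < card {..<k - 1}"
      using card_image_le[of "nb h \<inter> A" c] psubset.hyps h(2) by simp
    then have "\<not> {..<k - 1} \<subseteq> c ` (nb h \<inter> A)"
      using psubset.hyps card_mono[of "c ` (nb h \<inter> A)" "{..<k - 1}"] by auto
    then obtain i where i: "i < k - 1" "i \<notin> c ` (nb h \<inter> A)" by blast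
    let ?c = "c(h := i)"
    have "?c ` A \<subseteq> {..<k - 1}" using c(1) i(1) by auto
    moreover have "?c a \<noteq> ?c b" if ab: "a \<in> A" "b \<in> A" "b \<in> nb a" for a b
    proof -
      have "a \<noteq> b" "a \<in> nb b" using ab nb_sym by auto
      consider "a = h" | "b = h" "a \<noteq> h" | "a \<noteq> h" "b \<noteq> h" by blast
      then show ?thesis
      proof cases
        case 1
        then show ?thesis using i(2) ab \<open>a \<noteq> b\<close> by auto
      next
        case 2
        then show ?thesis using i(2) ab \<open>a \<in> nb b\<close> by auto
      next
        case 3
        then show ?thesis using c(2) ab by auto
      qed
    qed
    ultimately show ?thesis by blast
  qed simp
qed

end

section \<open>Passage from vertex sets to the graphs of the theorem\<close>

lemma isolation_edges: "simple_graph G \<Longrightarrow> 1 \<le> k \<Longrightarrow> isolation (edges G) k"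
  by unfold_locales (auto simp: simple_graph_def nsets_def)

lemma cycle_graph_edges_iff: "{i, j} \<in> edges (cycle_graph n) \<longleftrightarrow>
    i < n \<and> j = Suc i mod n \<or> j < n \<and> i = Suc j mod n"
  by (auto simp: cycle_graph_def doubleton_eq_iff)

text \<open>The witnesses are the successor and the predecessor of i, which differ because
  \<open>n >= 3\<close>.\<close>

lemma cycle_graph_degree:
  assumes "3 \<le> n" "i < n"
  obtains j j' where "j < n" "j' < n" "j \<noteq> j'" "{i, j} \<in> edges (cycle_graph n)" "{i, j'} \<in> edges (cycle_graph n)"
proof -
  let ?j = "Suc i mod n" and ?j' = "if i = 0 then n - 1 else i - 1"
  have "?j < n" "?j' < n" using assms by auto
  moreover have "Suc ?j' mod n = i" using assms by auto
  moreover have "?j \<noteq> ?j'"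
  proof (cases "Suc i = n")
    case False
    then have "?j = Suc i" using assms by simp
    then show ?thesis using assms by auto
  qed (use assms in auto)
  ultimately show ?thesis
    using that[of ?j ?j'] assms cycle_graph_edges_iff[of i ?j n] cycle_graph_edges_iff[of i ?j' n] by simp
qed

text \<open>The vertices of a cycle span at least as many edges as there are vertices, and by
  \<open>conn_ecount_ge\<close> each remaining vertex brings another edge. With a cycle there would
  thus be at least as many edges as vertices.\<close>

lemma tree_if_card_edges:
  assumes "simple_graph T" "connected_graph T" "isolation.conn (edges T) (verts T)"
    and "card (edges T) + 1 \<le> card (verts T)"
  shows "tree T"
proof -
  \<comment> \<open>The parameter 3 turns the requirement of degree \<open>k - 1\<close> into degree
    2, so that \<open>core_ecount\<close> applies to the vertex set of a cycle.\<close>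
  interpret isolation "edges T" 3 using assms(1) by (rule isolation_edges) simp
  have fin: "finite (verts T)" using assms(1) by (simp add: simple_graph_def)
  have "{e \<in> edges T. e \<subseteq> verts T} = edges T"
    using assms(1) by (auto simp: simple_graph_def nsets_def)
  then have eT: "ecount (verts T) = card (edges T)" by (simp add: ecount_def)
  have False if H: "3 \<le> n" "subgraph H T" "isomorphic H (cycle_graph n)" for H n
  proof -
    obtain f where f: "bij_betw f (verts H) {..<n}"
      "\<And>a b. a \<in> verts H \<Longrightarrow> b \<in> verts H \<Longrightarrow> {a, b} \<in> edges H \<longleftrightarrow> {f a, f b} \<in> edges (cycle_graph n)"
      using H(3) by (auto simp: isomorphic_def cycle_graph_def)
    have sub: "verts H \<subseteq> verts T" "edges H \<subseteq> edges T" using H(2) by (auto simp: subgraph_def)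
    have finH: "finite (verts H)" using sub(1) fin finite_subset by blast
    have "3 - 1 \<le> card (nb h \<inter> verts H)" if h: "h \<in> verts H" for h
    proof -
      have "f h < n" using f(1) h by (auto simp: bij_betw_def)
      then obtain j j' where j: "j < n" "j' < n" "j \<noteq> j'"
          "{f h, j} \<in> edges (cycle_graph n)" "{f h, j'} \<in> edges (cycle_graph n)"
        using cycle_graph_degree[OF H(1)] by blast
      have "j \<in> f ` verts H" "j' \<in> f ` verts H" using f(1) j(1,2) by (auto simp: bij_betw_def)
      then obtain a a' where a: "a \<in> verts H" "a' \<in> verts H" "j = f a" "j' = f a'" by blast
      have "{h, a} \<in> edges H" "{h, a'} \<in> edges H" using f(2)[OF h] a j(4,5) by auto
      then have "{a, a'} \<subseteq> nb h \<inter> verts H" using sub(2) a by (auto simp: nb_def)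
      then have "card {a, a'} \<le> card (nb h \<inter> verts H)" using finH by (intro card_mono) auto
      moreover have "a \<noteq> a'" using a j(3) by auto
      ultimately show ?thesis by simp
    qed
    then have "card (verts H) * (3 - 1) \<le> 2 * ecount (verts H)" by (rule core_ecount[OF finH])
    then have "card (verts H) \<le> ecount (verts H)" by simp
    moreover have "card (verts H) = n" using bij_betw_same_card[OF f(1)] by simp
    then have "verts H \<noteq> {}" using H(1) by force
    then have "ecount (verts H) + card (verts T - verts H) \<le> ecount (verts T)"
      by (rule conn_ecount_ge[OF fin assms(3) sub(1)])
    moreover have "card (verts T - verts H) = card (verts T) - card (verts H)"
      by (rule card_Diff_subset[OF finH sub(1)])
    moreover have "card (verts H) \<le> card (verts T)" using fin sub(1) by (rule card_mono)
    ultimately show False using assms(4) eT by linarith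
  qed
  then show ?thesis using assms(1,2) unfolding tree_def by blast
qed

locale graph_isolation =
  fixes G :: "'a graph" and k :: nat
  assumes simple: "simple_graph G" and k_ge_1: "1 \<le> k"
begin

sublocale isolation "edges G" k
  using simple k_ge_1 by (rule isolation_edges)

lemma finite_verts: "finite (verts G)"
  using simple by (simp add: simple_graph_def)

lemma neighbours_eq: "neighbours G = nb"
  by (simp add: fun_eq_iff neighbours_def nb_def)

lemma closed_nbhd_eq: "closed_nbhd G = cnb"
  by (simp add: fun_eq_iff closed_nbhd_def cnb_def neighbours_eq)

lemma nb_verts: "nb v \<subseteq> verts G"
  using simple by (auto simp: nb_def simple_graph_def nsets_def)

lemma nb_eq: "b \<in> nb a \<longleftrightarrow> {a, b} \<in> edges G"
  by (simp add: nb_def)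

lemma edges_subset: "e \<in> edges G \<Longrightarrow> e \<subseteq> verts G"
  using simple by (auto simp: simple_graph_def nsets_def)

lemma edgeE:
  assumes "e \<in> edges G"
  obtains a b where "e = {a, b}" "a \<noteq> b" "a \<in> verts G" "b \<in> verts G" "b \<in> nb a"
proof -
  obtain a b where "e = {a, b}" "a \<noteq> b" using card_edge[OF assms] by (meson card_2_iff)
  moreover from this have "a \<in> verts G" "b \<in> verts G" "b \<in> nb a"
    using edges_subset[OF assms] assms by (auto simp: nb_eq)
  ultimately show ?thesis by (rule that)
qed

lemma ecount_verts: "ecount (verts G) = card (edges G)"
  unfolding ecount_def by (rule arg_cong[of _ _ card]) (use edges_subset in auto)

lemma conn_if_connected:
  assumes "connected_graph G"
  shows "conn (verts G)"
proof (unfold conn_def, intro conjI allI impI)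
  show "verts G \<noteq> {}" using assms by (simp add: connected_graph_def)
  fix B assume B: "B \<subseteq> verts G" "B \<noteq> {}" "B \<noteq> verts G"
  then obtain u v where uv: "u \<in> B" "v \<in> verts G" "v \<notin> B" by blast
  show "\<exists>a\<in>B. \<exists>b\<in>verts G - B. b \<in> nb a"
  proof (rule ccontr)
    assume no: "\<not> ?thesis"
    have "(u, v) \<in> {(x, y). {x, y} \<in> edges G}\<^sup>*"
      using assms uv B(1) unfolding connected_graph_def by blast
    then have "v \<in> B"
    proof (induction rule: rtrancl_induct)
      case (step y z)
      then have "z \<in> nb y" by (simp add: nb_eq)
      then show ?case using no step.IH nb_verts by blast
    qed (use uv in simp)
    then show False using uv by blast
  qed
qed

lemma connected_induced:
  assumes "conn S"
  shows "connected_graph (Graph S {e \<in> edges G. e \<subseteq> S})"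
proof -
  let ?R = "{(x, y). {x, y} \<in> {e \<in> edges G. e \<subseteq> S}}\<^sup>*"
  have "(u, v) \<in> ?R" if u: "u \<in> S" "v \<in> S" for u v
  proof -
    have "{x \<in> S. (u, x) \<in> ?R} = S"
    proof (rule ccontr)
      assume ne: "{x \<in> S. (u, x) \<in> ?R} \<noteq> S"
      obtain a b where ab: "a \<in> {x \<in> S. (u, x) \<in> ?R}" "b \<in> S" "b \<notin> {x \<in> S. (u, x) \<in> ?R}" "b \<in> nb a"
        by (rule connD[OF assms _ _ ne]) (use u in auto)
      then have "(a, b) \<in> {(x, y). {x, y} \<in> {e \<in> edges G. e \<subseteq> S}}" by (auto simp: nb_eq)
      then show False using ab by (auto intro: rtrancl.rtrancl_into_rtrancl)
    qed
    then show ?thesis using u(2) by blast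
  qed
  then show ?thesis using assms by (auto simp: connected_graph_def conn_def)
qed

lemma isomorphic_complete_if_clq:
  assumes "clq (verts G)"
  shows "isomorphic G (complete_graph k)"
proof -
  obtain f where f: "bij_betw f (verts G) {..<k}"
    using ex_bij_betw_finite_nat[OF finite_verts] clq_card[OF assms] by (auto simp: atLeast0LessThan)
  have "{u, v} \<in> edges G \<longleftrightarrow> {f u, f v} \<in> nsets {..<k} 2" if "u \<in> verts G" "v \<in> verts G" for u v
  proof -
    have "f u < k" "f v < k" using f that by (auto simp: bij_betw_def)
    then have "{f u, f v} \<in> nsets {..<k} 2 \<longleftrightarrow> f u \<noteq> f v" by (auto simp: nsets_def card_insert_if)
    also have "\<dots> \<longleftrightarrow> u \<noteq> v" using f that by (auto simp: bij_betw_def inj_on_def)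
    also have "\<dots> \<longleftrightarrow> {u, v} \<in> edges G" using clqD[OF assms that] nb_irrefl unfolding nb_eq by auto
    finally show ?thesis by simp
  qed
  then show ?thesis using f unfolding isomorphic_def complete_graph_def by auto
qed

lemma subgraph_deleted:
  assumes "subgraph H (delete_verts G (closed_nbhd G D))"
  shows "verts H \<subseteq> verts G - cnb D" "edges H \<subseteq> edges G" "simple_graph H" "finite (verts H)"
  using assms by (auto simp: subgraph_def delete_verts_def closed_nbhd_eq simple_graph_def)

lemma chromatic_number_le:
  assumes "isomorphic H F" "edges H \<subseteq> edges G" "c ` verts H \<subseteq> {..<n}"
    and "\<forall>a\<in>verts H. \<forall>b\<in>verts H. b \<in> nb a \<longrightarrow> c a \<noteq> c b"
  shows "chromatic_number F \<le> n"
proof -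
  obtain f where f: "bij_betw f (verts H) (verts F)"
      "\<And>u v. u \<in> verts H \<Longrightarrow> v \<in> verts H \<Longrightarrow> {u, v} \<in> edges H \<longleftrightarrow> {f u, f v} \<in> edges F"
    using assms(1) unfolding isomorphic_def by blast
  define g where "g = inv_into (verts H) f"
  have g: "g x \<in> verts H" "f (g x) = x" if "x \<in> verts F" for x
    using f(1) that by (auto simp: g_def bij_betw_def inv_into_into f_inv_into_f)
  have "proper_colouring F n (c \<circ> g)"
    unfolding proper_colouring_def
  proof (intro conjI ballI impI)
    show "(c \<circ> g) ` verts F \<subseteq> {..<n}" using assms(3) g(1) by auto
    fix u v assume uv: "u \<in> verts F" "v \<in> verts F" "{u, v} \<in> edges F"
    then have "{g u, g v} \<in> edges H" using f(2)[OF g(1) g(1)] g(2) by simp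
    then have "g v \<in> nb (g u)" using assms(2) by (auto simp: nb_eq)
    then show "(c \<circ> g) u \<noteq> (c \<circ> g) v" using assms(4) g(1) uv by simp
  qed
  then show ?thesis unfolding chromatic_number_def by (intro Least_le) auto
qed

text \<open>A vertex of low degree in H contradicts regularity of degree at least
  \<open>k - 1\<close>, and a greedy colouring of H contradicts chromatic number at least k. This
  settles the three families together.\<close>

lemma isolating_if_degenerate:
  assumes "D \<subseteq> verts G" "degenerate (verts G - cnb D)"
  shows "isolating G (family l k :: 'b graph set) D"
proof -
  have False if H: "subgraph H (delete_verts G (closed_nbhd G D))"
    and F: "F \<in> (family l k :: 'b graph set)" "isomorphic H F" for H F
  proof -
    note S = subgraph_deleted[OF H]
    have deg: "degenerate (verts H)" using assms(2) S(1) by (rule degenerate_mono)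
    obtain f where f: "bij_betw f (verts H) (verts F)"
      "\<And>u v. u \<in> verts H \<Longrightarrow> v \<in> verts H \<Longrightarrow> {u, v} \<in> edges H \<longleftrightarrow> {f u, f v} \<in> edges F"
      using F(2) unfolding isomorphic_def by blast
    from F(1) consider "F \<in> regular_family k" | "F \<in> chromatic_family k"
      by (auto simp: family_def split: if_splits)
    then show False
    proof cases
      case 1
      then obtain d where d: "simple_graph F" "verts F \<noteq> {}" "k - 1 \<le> d" "\<And>v. v \<in> verts F \<Longrightarrow> degree F v = d"
        by (auto simp: regular_family_def)
      have "verts H \<noteq> {}" using f(1) d(2) by (auto simp: bij_betw_def)
      then obtain h where h: "h \<in> verts H" "card (nb h \<inter> verts H) < k - 1"
        using deg unfolding degenerate_def by blast
      have "neighbours F (f h) \<subseteq> f ` (nb h \<inter> verts H)"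
      proof
        fix w assume w: "w \<in> neighbours F (f h)"
        then have "{f h, w} \<in> edges F" by (simp add: neighbours_def)
        moreover from this have "w \<in> verts F" using d(1) by (auto simp: simple_graph_def nsets_def)
        then obtain w' where w': "w' \<in> verts H" "w = f w'" using f(1) by (auto simp: bij_betw_def)
        ultimately have "{h, w'} \<in> edges H" using f(2)[OF h(1) w'(1)] by simp
        then show "w \<in> f ` (nb h \<inter> verts H)" using w' S(2) by (auto simp: nb_eq)
      qed
      then have "card (neighbours F (f h)) \<le> card (f ` (nb h \<inter> verts H))"
        using S(4) by (intro card_mono) auto
      also have "\<dots> \<le> card (nb h \<inter> verts H)" using S(4) by (intro card_image_le) auto
      finally have "degree F (f h) < k - 1" using h(2) by (simp add: degree_def)
      moreover have "f h \<in> verts F" using f(1) h(1) by (auto simp: bij_betw_def)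
      ultimately show False using d(3,4) by fastforce
    next
      case 2
      obtain c where "c ` verts H \<subseteq> {..<k - 1}"
          "\<forall>a\<in>verts H. \<forall>b\<in>verts H. b \<in> nb a \<longrightarrow> c a \<noteq> c b"
        using degenerate_colouring[OF S(4) deg] by blast
      then have "chromatic_number F \<le> k - 1" by (rule chromatic_number_le[OF F(2) S(2)])
      moreover have "k \<le> chromatic_number F" using 2 by (simp add: chromatic_family_def)
      ultimately show False using k_ge_1 by linarith
    qed
  qed
  then show ?thesis using assms(1) unfolding isolating_def by blast
qed

lemma iota_le_io: "iota G (family l k :: 'b graph set) \<le> io (verts G)"
proof -
  obtain D where D: "D \<subseteq> verts G" "degenerate (verts G - {} - cnb D)" "card D = io (verts G)"
    by (rule iso_numE)
  then have "isolating G (family l k :: 'b graph set) D" by (intro isolating_if_degenerate) auto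
  then show ?thesis unfolding iota_def using D(3) by (intro Least_le) auto
qed

lemma iotaE:
  obtains D where "isolating G (family l k :: 'b graph set) D" "card D = iota G (family l k :: 'b graph set)"
    "D \<subseteq> verts G" "finite D"
proof -
  have "verts G - cnb (verts G) = {}" by (auto simp: cnb_def)
  then have "degenerate (verts G - cnb (verts G))" by (simp only: degenerate_empty)
  then have "isolating G (family l k :: 'b graph set) (verts G)"
    by (intro isolating_if_degenerate) auto
  then have "\<exists>n D. isolating G (family l k :: 'b graph set) D \<and> card D = n" by blast
  then have "\<exists>D. isolating G (family l k :: 'b graph set) D \<and> card D = iota G (family l k :: 'b graph set)"
    unfolding iota_def by (rule LeastI_ex)
  then obtain D where D: "isolating G (family l k :: 'b graph set) D" "card D = iota G (family l k :: 'b graph set)"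
    by blast
  moreover have "D \<subseteq> verts G" using D(1) by (simp add: isolating_def)
  ultimately show ?thesis using that finite_subset[OF _ finite_verts] by blast
qed

text \<open>The complete graph is regular of degree \<open>k - 1\<close> and needs distinct colours
  at all vertices. It is built on vertices of the type of G, so the lower bounds concern families of
  graphs over that type.\<close>

lemma complete_in_family:
  assumes "finite K" "card K = k"
  shows "Graph K (nsets K 2) \<in> family l k"
proof -
  let ?H = "Graph K (nsets K 2)"
  have s: "simple_graph ?H" using assms(1) by (simp add: simple_graph_def)
  have e: "{v, w} \<in> nsets K 2 \<longleftrightarrow> v \<in> K \<and> w \<in> K \<and> v \<noteq> w" for v w
    by (auto simp: nsets_def card_insert_if)
  have "neighbours ?H v = K - {v}" if "v \<in> K" for v using that by (auto simp: neighbours_def e)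
  then have "degree ?H v = k - 1" if "v \<in> K" for v using that assms by (simp add: degree_def)
  then have r: "?H \<in> regular_family k"
    using s assms k_ge_1 unfolding regular_family_def by (auto intro!: exI[of _ "k - 1"])
  have "\<exists>n c. proper_colouring ?H n c"
  proof -
    obtain c where "bij_betw c K {0..<card K}" using ex_bij_betw_finite_nat[OF assms(1)] by blast
    then have "proper_colouring ?H (card K) c"
      by (auto simp: proper_colouring_def e bij_betw_def inj_on_def)
    then show ?thesis by blast
  qed
  then have "\<exists>c. proper_colouring ?H (chromatic_number ?H) c"
    unfolding chromatic_number_def by (rule LeastI_ex)
  then obtain c where c: "c ` K \<subseteq> {..<chromatic_number ?H}" "\<forall>u\<in>K. \<forall>v\<in>K. {u, v} \<in> nsets K 2 \<longrightarrow> c u \<noteq> c v"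
    by (auto simp: proper_colouring_def)
  have "inj_on c K" using c(2) unfolding e by (meson inj_onI)
  then have "card K \<le> card {..<chromatic_number ?H}" using c(1) by (intro card_inj_on_le) auto
  then have "?H \<in> chromatic_family k" using s assms(2) by (simp add: chromatic_family_def)
  then show ?thesis using r by (simp add: family_def)
qed

lemma isolating_no_clq:
  assumes "isolating G (family l k :: 'a graph set) D" "K \<subseteq> verts G - cnb D"
  shows "\<not> clq K"
proof
  assume clq: "clq K"
  let ?H = "Graph K (nsets K 2)"
  have "subgraph ?H (delete_verts G (closed_nbhd G D))"
    unfolding subgraph_def
  proof (intro conjI)
    show "simple_graph ?H" using clq_finite[OF clq] by (simp add: simple_graph_def)
    show "verts ?H \<subseteq> verts (delete_verts G (closed_nbhd G D))"
      using assms(2) by (simp add: delete_verts_def closed_nbhd_eq)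
    show "edges ?H \<subseteq> edges (delete_verts G (closed_nbhd G D))"
    proof
      fix e assume "e \<in> edges ?H"
      then have e: "e \<subseteq> K" "card e = 2" by (auto simp: nsets_def)
      then obtain a b where ab: "e = {a, b}" "a \<noteq> b" by (meson card_2_iff)
      then have "e \<in> edges G" using clqD[OF clq, of a b] e(1) by (simp add: nb_eq)
      then show "e \<in> edges (delete_verts G (closed_nbhd G D))"
        using e(1) assms(2) by (auto simp: delete_verts_def closed_nbhd_eq)
    qed
  qed
  moreover have "?H \<in> family l k"
    by (rule complete_in_family[OF clq_finite[OF clq] clq_card[OF clq]])
  moreover have "isomorphic ?H ?H"
    unfolding isomorphic_def by (rule exI[of _ id]) auto
  ultimately show False using assms(1) unfolding isolating_def by blast
qed

section \<open>Cycles and special graphs\<close>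

lemma nb_Int_verts: "nb a \<inter> verts G = nb a"
  using nb_verts by blast

lemma isomorphic_if_cyc4:
  assumes "cyc4 (verts G)"
  shows "isomorphic G (cycle_graph 4)"
proof -
  obtain a where "a \<in> verts G" using assms unfolding cyc4_def by blast
  from cyc4E[OF assms this] obtain b c d where V: "verts G = {a, b, c, d}" and dist: "distinct [a, b, c, d]"
    and n: "nb a = {b, d}" "nb b = {a, c}" "nb c = {b, d}" "nb d = {c, a}"
    unfolding nb_Int_verts by metis
  define f where "f x = (if x = a then 0 else if x = b then 1 else if x = c then 2 else (3::nat))" for x
  have fx: "f a = 0" "f b = 1" "f c = 2" "f d = 3" using dist by (auto simp: f_def)
  have "f ` verts G = {..<4}" unfolding V using fx by (auto simp: numeral_eq_Suc less_Suc_eq)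
  moreover have "inj_on f (verts G)" unfolding V using fx by (auto simp: inj_on_def)
  ultimately have "bij_betw f (verts G) (verts (cycle_graph 4))"
    by (simp add: bij_betw_def cycle_graph_def)
  moreover have "{x, y} \<in> edges G \<longleftrightarrow> {f x, f y} \<in> edges (cycle_graph 4)"
    if "x \<in> verts G" "y \<in> verts G" for x y
    using that dist unfolding V nb_eq[symmetric] cycle_graph_edges_iff
    by (elim insertE emptyE; simp add: n fx; auto)
  ultimately show ?thesis unfolding isomorphic_def by blast
qed

lemma isomorphic_if_cyc5:
  assumes "cyc5 (verts G)"
  shows "isomorphic G (cycle_graph 5)"
proof -
  obtain a where "a \<in> verts G" using assms unfolding cyc5_def by blast
  from cyc5E[OF assms this] obtain b c d e where V: "verts G = {a, b, c, d, e}"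
    and dist: "distinct [a, b, c, d, e]"
    and n: "nb a = {b, e}" "nb b = {a, c}" "nb c = {b, d}" "nb d = {c, e}" "nb e = {d, a}"
    unfolding nb_Int_verts by metis
  define f where "f x = (if x = a then 0 else if x = b then 1 else if x = c then 2 else
    if x = d then 3 else (4::nat))" for x
  have fx: "f a = 0" "f b = 1" "f c = 2" "f d = 3" "f e = 4" using dist by (auto simp: f_def)
  have "f ` verts G = {..<5}" unfolding V using fx by (auto simp: numeral_eq_Suc less_Suc_eq)
  moreover have "inj_on f (verts G)" unfolding V using fx by (auto simp: inj_on_def)
  ultimately have "bij_betw f (verts G) (verts (cycle_graph 5))"
    by (simp add: bij_betw_def cycle_graph_def)
  moreover have "{x, y} \<in> edges G \<longleftrightarrow> {f x, f y} \<in> edges (cycle_graph 5)"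
    if "x \<in> verts G" "y \<in> verts G" for x y
    using that dist unfolding V nb_eq[symmetric] cycle_graph_edges_iff
    by (elim insertE emptyE; simp add: n fx; auto)
  ultimately show ?thesis unfolding isomorphic_def by blast
qed

lemma isomorphic_cycleE:
  assumes "isomorphic G (cycle_graph n)"
  obtains g where "inj_on g {..<n}" "verts G = g ` {..<n}"
    "\<And>i j. i < n \<Longrightarrow> j < n \<Longrightarrow> g j \<in> nb (g i) \<longleftrightarrow> j = Suc i mod n \<or> i = Suc j mod n"
proof -
  obtain f where f: "bij_betw f (verts G) {..<n}"
      "\<And>u v. u \<in> verts G \<Longrightarrow> v \<in> verts G \<Longrightarrow> {u, v} \<in> edges G \<longleftrightarrow> {f u, f v} \<in> edges (cycle_graph n)"
    using assms by (auto simp: isomorphic_def cycle_graph_def)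
  define g where "g = inv_into (verts G) f"
  have g: "bij_betw g {..<n} (verts G)" unfolding g_def using f(1) by (rule bij_betw_inv_into)
  have fg: "f (g i) = i" if "i < n" for i
    using f(1) that unfolding g_def by (intro f_inv_into_f) (auto simp: bij_betw_def)
  show ?thesis
  proof (rule that[of g])
    show "inj_on g {..<n}" "verts G = g ` {..<n}" using g by (auto simp: bij_betw_def)
    fix i j assume ij: "i < n" "j < n"
    then have "g i \<in> verts G" "g j \<in> verts G" using g by (auto simp: bij_betw_def)
    then show "g j \<in> nb (g i) \<longleftrightarrow> j = Suc i mod n \<or> i = Suc j mod n"
      using f(2)[of "g i" "g j"] fg ij by (simp add: nb_eq cycle_graph_edges_iff)
  qed
qed

lemma cyc4_if_isomorphic:
  assumes "isomorphic G (cycle_graph 4)"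
  shows "cyc4 (verts G)"
proof -
  obtain g where g: "inj_on g {..<4}" "verts G = g ` {..<4}"
    "\<And>i j. i < 4 \<Longrightarrow> j < 4 \<Longrightarrow> g j \<in> nb (g i) \<longleftrightarrow> j = Suc i mod 4 \<or> i = Suc j mod 4"
    by (rule isomorphic_cycleE[OF assms]) blast
  have e: "{..<4} = {0, 1, 2, 3::nat}" by auto
  have "verts G = {g 0, g 1, g 2, g 3}" unfolding g(2) e by simp
  moreover have "distinct [g 0, g 1, g 2, g 3]" using g(1) unfolding e by (simp add: inj_on_def)
  moreover have "g 1 \<in> nb (g 0)" "g 2 \<in> nb (g 1)" "g 3 \<in> nb (g 2)" "g 0 \<in> nb (g 3)"
    "g 2 \<notin> nb (g 0)" "g 3 \<notin> nb (g 1)"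
    by (simp_all add: g(3))
  ultimately show ?thesis unfolding cyc4_def by blast
qed

lemma cyc5_if_isomorphic:
  assumes "isomorphic G (cycle_graph 5)"
  shows "cyc5 (verts G)"
proof -
  obtain g where g: "inj_on g {..<5}" "verts G = g ` {..<5}"
    "\<And>i j. i < 5 \<Longrightarrow> j < 5 \<Longrightarrow> g j \<in> nb (g i) \<longleftrightarrow> j = Suc i mod 5 \<or> i = Suc j mod 5"
    by (rule isomorphic_cycleE[OF assms]) blast
  have e: "{..<5} = {0, 1, 2, 3, 4::nat}" by auto
  have "verts G = {g 0, g 1, g 2, g 3, g 4}" unfolding g(2) e by simp
  moreover have "distinct [g 0, g 1, g 2, g 3, g 4]" using g(1) unfolding e by (simp add: inj_on_def)
  moreover have "g 1 \<in> nb (g 0)" "g 2 \<in> nb (g 1)" "g 3 \<in> nb (g 2)" "g 4 \<in> nb (g 3)" "g 0 \<in> nb (g 4)"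
    "g 2 \<notin> nb (g 0)" "g 3 \<notin> nb (g 0)" "g 3 \<notin> nb (g 1)" "g 4 \<notin> nb (g 1)" "g 4 \<notin> nb (g 2)"
    by (simp_all add: g(3))
  ultimately show ?thesis unfolding cyc5_def by blast
qed

text \<open>The empty set does not isolate, because the 4-cycle is itself 2-regular.\<close>

lemma cyc4_regular_iota_pos:
  assumes "cyc4 (verts G)" "k = 3" "l \<noteq> 2"
  shows "1 \<le> iota G (family l k :: 'a graph set)"
proof (rule ccontr)
  assume "\<not> ?thesis"
  moreover obtain D where D: "isolating G (family l k :: 'a graph set) D"
      "card D = iota G (family l k :: 'a graph set)" "D \<subseteq> verts G" "finite D"
    by (rule iotaE)
  ultimately have "card D = 0" by linarith
  then have "D = {}" using D(4) by simp
  have "degree G v = 2" if v: "v \<in> verts G" for v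
  proof -
    obtain b c d where h: "distinct [v, b, c, d]" "nb v \<inter> verts G = {b, d}"
      by (rule cyc4E[OF assms(1) v])
    then have "degree G v = card {b, d}" by (simp add: degree_def neighbours_eq nb_Int_verts)
    then show ?thesis using h(1) by simp
  qed
  moreover have "verts G \<noteq> {}" using assms(1) unfolding cyc4_def by blast
  ultimately have "G \<in> regular_family k"
    unfolding regular_family_def using simple assms(2) by auto
  then have "G \<in> family l k" using assms(3) by (simp add: family_def)
  moreover have "subgraph G (delete_verts G (closed_nbhd G D))"
    using simple \<open>D = {}\<close> by (simp add: subgraph_def delete_verts_def closed_nbhd_def)
  moreover have "isomorphic G G" unfolding isomorphic_def by (rule exI[of _ id]) auto
  ultimately show False using D(1) unfolding isolating_def by blast
qed

text \<open>Two colours suffice for all subgraphs of a 4-cycle. So for l = 2 the extremal set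
  \<open>cyc4\<close> gives no equality case.\<close>

lemma cyc4_chromatic_iota:
  assumes "cyc4 (verts G)" "k = 3"
  shows "iota G (family 2 k :: 'a graph set) = 0"
proof -
  obtain a where "a \<in> verts G" using assms unfolding cyc4_def by blast
  from cyc4E[OF assms(1) this] obtain b c d where V: "verts G = {a, b, c, d}" and dist: "distinct [a, b, c, d]"
    and n: "nb a = {b, d}" "nb b = {a, c}" "nb c = {b, d}" "nb d = {c, a}"
    unfolding nb_Int_verts by metis
  define col where "col x = (if x = a \<or> x = c then 0 else (1::nat))" for x
  have col: "col x \<noteq> col y" if "x \<in> verts G" "y \<in> nb x" for x y
    using that dist unfolding V by (elim insertE emptyE; simp add: n col_def; auto)
  have "isolating G (family 2 k :: 'a graph set) {}"
  proof -
    have False if H: "subgraph H (delete_verts G (closed_nbhd G {}))"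
      and F: "F \<in> (family 2 k :: 'a graph set)" "isomorphic H F" for H F
    proof -
      note S = subgraph_deleted[OF H]
      have "chromatic_number F \<le> 2"
      proof (rule chromatic_number_le[OF F(2) S(2)])
        show "col ` verts H \<subseteq> {..<2}" by (auto simp: col_def)
        show "\<forall>x\<in>verts H. \<forall>y\<in>verts H. y \<in> nb x \<longrightarrow> col x \<noteq> col y" using col S(1) by blast
      qed
      then show False using F(1) assms(2) by (simp add: family_def chromatic_family_def)
    qed
    then show ?thesis unfolding isolating_def by blast
  qed
  then have "iota G (family 2 k :: 'a graph set) \<le> card ({} :: 'a set)"
    unfolding iota_def by (intro Least_le) blast
  then show ?thesis by simp
qed

text \<open>One vertex dominates three consecutive vertices of the cycle, and the other two form an
  edge, a clique for k = 2.\<close>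

lemma cyc5_iota_ge:
  assumes "cyc5 (verts G)" "k = 2"
  shows "2 \<le> iota G (family l k :: 'a graph set)"
proof (rule ccontr)
  assume "\<not> ?thesis"
  moreover obtain D where D: "isolating G (family l k :: 'a graph set) D"
      "card D = iota G (family l k :: 'a graph set)" "D \<subseteq> verts G" "finite D"
    by (rule iotaE)
  ultimately have "card D \<le> 1" by simp
  moreover obtain y0 where y0: "y0 \<in> verts G" using assms(1) unfolding cyc5_def by blast
  \<comment> \<open>If D is empty, y may be any vertex: only \<open>D \<subseteq> {y}\<close>
    matters below.\<close>
  ultimately obtain y where y: "y \<in> verts G" "D \<subseteq> {y}"
  proof (cases "D = {}")
    case False
    then have "card D = 1" using \<open>card D \<le> 1\<close> D(4) by (metis card_0_eq le_antisym less_one not_le)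
    then obtain y where "D = {y}" by (rule card_1_singletonE)
    then show thesis using that[of y] D(3) by auto
  qed (use that[of y0] y0 in auto)
  obtain b c d e where h: "verts G = {y, b, c, d, e}" "distinct [y, b, c, d, e]"
    "nb y \<inter> verts G = {b, e}" "nb c \<inter> verts G = {b, d}" "nb d \<inter> verts G = {c, e}"
    by (rule cyc5E[OF assms(1) y(1)])
  have "cnb D \<subseteq> {y, b, e}" using y(2) h(3) by (auto simp: cnb_def nb_Int_verts)
  then have "{c, d} \<subseteq> verts G - cnb D" using h(1,2) by auto
  moreover have "d \<in> nb c" "c \<in> nb d" using equalityD2[OF h(4)] equalityD2[OF h(5)] by simp_all
  then have "clq {c, d}" unfolding clq_def using h(2) assms(2) by auto
  ultimately show False using isolating_no_clq[OF D(1)] by blast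
qed

text \<open>The tree \<open>T\<close> lives on the feet, and \<open>T'\<close> meets the
  constituents only in the last foot. So no edge leaves \<open>U i\<close> except the one to
  \<open>v i\<close>, and \<open>pendant_card_le\<close> applies.\<close>

lemma special_iota_ge:
  assumes "special_structure k q r G"
  shows "q \<le> iota G (family l k :: 'a graph set)"
  using assms unfolding special_structure_def
proof (elim disjE conjE exE)
  fix v :: "nat \<Rightarrow> 'a" and U u T T'
  assume q1: "1 \<le> q" and inj: "inj_on v {1..q}"
    and dis: "disjoint_family_on U {1..q}"
    and U': "\<forall>i\<in>{1..q}. finite (U i) \<and> card (U i) = k \<and> U i \<inter> v ` {1..q} = {} \<and> u i \<in> U i"
    and T: "tree T" "verts T = v ` {1..q}" and T': "tree T'"
    and T'v: "verts T' \<inter> (\<Union>i\<in>{1..q}. verts (clique_constituent (U i) (u i) (v i))) = {v q}"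
    and V: "verts G = verts T' \<union> (\<Union>i\<in>{1..q}. verts (clique_constituent (U i) (u i) (v i)))"
    and E: "edges G = edges T \<union> edges T' \<union> (\<Union>i\<in>{1..q}. edges (clique_constituent (U i) (u i) (v i)))"
  note U = bspec[OF U']
  \<comment> \<open>\<open>pendant\<close> indexes the cliques by their feet, the special structure
    by numbers.\<close>
  define idx where "idx = the_inv_into {1..q} v"
  have idx: "idx (v i) = i" if "i \<in> {1..q}" for i
    unfolding idx_def by (rule the_inv_into_f_f[OF inj that])
  let ?S = "v ` {1..q}"
  have vq: "q \<in> {1..q}" using q1 by simp
  have mem: "U i \<subseteq> verts G" "v i \<in> verts G" if "i \<in> {1..q}" for i
    using that unfolding V clique_constituent_def by auto
  have nT: "e \<subseteq> ?S" if "e \<in> edges T" for e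
    using that T by (auto simp: tree_def simple_graph_def nsets_def)
  have nT': "e \<inter> U i = {}" if "e \<in> edges T'" "i \<in> {1..q}" for e i
  proof -
    have "e \<subseteq> verts T'" using that(1) T' by (auto simp: tree_def simple_graph_def nsets_def)
    moreover have "U i \<subseteq> (\<Union>i\<in>{1..q}. verts (clique_constituent (U i) (u i) (v i)))"
      using that(2) unfolding clique_constituent_def by auto
    ultimately have "e \<inter> U i \<subseteq> {v q}" using equalityD1[OF T'v] by blast
    then show ?thesis using U[OF that(2)] vq by blast
  qed
  have nb: "nb a \<inter> verts G = (U i - {a}) \<union> (if a = u i then {v i} else {})" if i: "i \<in> {1..q}" and a: "a \<in> U i" for i a
  proof (rule equalityI; rule subsetI)
    fix b assume "b \<in> nb a \<inter> verts G"
    then have e: "{a, b} \<in> edges G" by (simp add: nb_eq)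
    have "{a, b} \<notin> edges T" using nT a U[OF i] by blast
    moreover have "{a, b} \<notin> edges T'" using nT' a i by blast
    ultimately obtain j where j: "j \<in> {1..q}" "{a, b} \<in> nsets (U j) 2 \<or> {a, b} = {u j, v j}"
      using e unfolding E clique_constituent_def by auto
    have "a \<in> U j"
      using j U[OF i] a by (auto simp: nsets_def doubleton_eq_iff U)
    then have ij: "j = i" using dis i j(1) a unfolding disjoint_family_on_def by blast
    have "a \<noteq> v i" using U[OF i] a i by blast
    then show "b \<in> (U i - {a}) \<union> (if a = u i then {v i} else {})"
      using j(2) unfolding ij by (auto simp: nsets_def doubleton_eq_iff)
  next
    fix b assume b: "b \<in> (U i - {a}) \<union> (if a = u i then {v i} else {})"
    then have "{a, b} \<in> edges (clique_constituent (U i) (u i) (v i))"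
      using a by (auto simp: clique_constituent_def nsets_def split: if_splits)
    then have "{a, b} \<in> edges G" unfolding E using i by blast
    then have "b \<in> nb a" by (simp add: nb_eq)
    then show "b \<in> nb a \<inter> verts G" using nb_verts by blast
  qed
  have pendant: "pendant (verts G) ?S (\<lambda>s. U (idx s)) (\<lambda>s. u (idx s))"
    unfolding pendant_def
  proof (intro conjI ballI impI)
    show "?S \<subseteq> verts G" using mem by blast
  next
    fix s s' assume "s \<in> ?S" "s' \<in> ?S" "s \<noteq> s'"
    then obtain i j where "i \<in> {1..q}" "j \<in> {1..q}" "s = v i" "s' = v j" "i \<noteq> j" by blast
    then show "U (idx s) \<inter> U (idx s') = {}"
      using dis idx by (simp add: disjoint_family_on_def)
  next
    fix s assume "s \<in> ?S"
    then obtain i where i: "i \<in> {1..q}" "s = v i" by blast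
    then have s: "idx s = i" using idx by simp
    show "U (idx s) \<subseteq> verts G" "U (idx s) \<inter> ?S = {}" "card (U (idx s)) = k" "u (idx s) \<in> U (idx s)"
      "\<And>a. a \<in> U (idx s) \<Longrightarrow> nb a \<inter> verts G = U (idx s) - {a} \<union> (if a = u (idx s) then {s} else {})"
      unfolding s using mem(1)[OF i(1)] U[OF i(1)] nb[OF i(1)] i(2) by simp_all
  qed
  obtain D where D: "isolating G (family l k :: 'a graph set) D"
      "card D = iota G (family l k :: 'a graph set)" "D \<subseteq> verts G" "finite D"
    by (rule iotaE)
  have "card ?S \<le> card D"
  proof (rule pendant_card_le[OF pendant D(4,3)])
    fix s assume "s \<in> ?S"
    then show "\<not> U (idx s) \<subseteq> verts G - cnb D"
      using isolating_no_clq[OF D(1)] pendant_clq[OF pendant] by blast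
  qed
  then show ?thesis using D(2) card_image[OF inj] by simp
qed simp

text \<open>This is the tree \<open>T'\<close> of a pure special graph, where r = 0.\<close>

lemma tree_singleton: "tree (Graph {x} {})"
proof -
  have s: "simple_graph (Graph {x} {})" by (simp add: simple_graph_def)
  have c: "connected_graph (Graph {x} {})" by (simp add: connected_graph_def)
  interpret S: isolation "edges (Graph {x} {})" 1 using s by (rule isolation_edges) simp
  have "S.conn {x}" unfolding S.conn_def by auto
  then show ?thesis using s c by (intro tree_if_card_edges) simp_all
qed

text \<open>The edge count leaves at most \<open>card S - 1\<close> edges among the feet, so the
  connected subgraph they induce is the required tree \<open>T\<close>; the last foot alone serves
  as \<open>T'\<close>.\<close>

lemma pure_special_if_pure:
  assumes "pure (verts G) S U u" "card (edges G) + 1 = t * card S"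
  shows "pure_special_graph (card (edges G)) k G"
proof -
  note p = pure_pendant[OF assms(1)] and V = pure_eq[OF assms(1)]
  have finS: "finite S" using pure_finite[OF assms(1) finite_verts] .
  have SV: "S \<subseteq> verts G" using V by blast
  define q where "q = card S"
  have "S \<noteq> {}" using pure_conn[OF assms(1)] by (simp add: conn_def)
  then have q1: "1 \<le> q" using finS by (simp add: q_def Suc_le_eq card_gt_0_iff)
  obtain v where v: "bij_betw v {1..q} S" using ex_bij_betw_nat_finite_1[OF finS] by (auto simp: q_def)
  have vS: "v ` {1..q} = S" "inj_on v {1..q}" using v by (auto simp: bij_betw_def)
  define T where "T = Graph S {e \<in> edges G. e \<subseteq> S}"
  have sT: "simple_graph T" using finS simple by (auto simp: T_def simple_graph_def nsets_def)
  have cT: "connected_graph T" unfolding T_def by (rule connected_induced[OF pure_conn[OF assms(1)]])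
  have treeT: "tree T"
  proof (rule tree_if_card_edges[OF sT cT])
    interpret T: isolation "edges T" k using sT k_ge_1 by (rule isolation_edges)
    have nbT: "b \<in> T.nb a" if "a \<in> S" "b \<in> S" "b \<in> nb a" for a b
      unfolding T.nb_def using that by (simp add: T_def nb_eq)
    have "T.conn S"
      unfolding T.conn_def
    proof (intro conjI allI impI)
      show "S \<noteq> {}" by fact
      fix B assume B: "B \<subseteq> S" "B \<noteq> {}" "B \<noteq> S"
      obtain a b where "a \<in> B" "b \<in> S" "b \<notin> B" "b \<in> nb a"
        by (rule connD[OF pure_conn[OF assms(1)] B])
      then show "\<exists>a\<in>B. \<exists>b\<in>S - B. b \<in> T.nb a" using nbT B(1) by blast
    qed
    then show "T.conn (verts T)" by (simp add: T_def)
    have "ecount S + q * (t - 1) \<le> card (edges G)"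
      using pure_ecount_ge[OF assms(1) finite_verts] ecount_verts by (simp add: q_def)
    moreover have "t * q = q * (t - 1) + q" using t_pos by (simp add: algebra_simps diff_mult_distrib2)
    ultimately have "ecount S + 1 \<le> q" using assms(2) by (simp add: q_def)
    then show "card (edges T) + 1 \<le> card (verts T)" by (simp add: T_def ecount_def q_def)
  qed
  have "special_structure k q 0 G"
    unfolding special_structure_def
  proof (rule disjI2, rule conjI[OF q1], rule exI[of _ v], rule exI[of _ "\<lambda>i. U (v i)"],
      rule exI[of _ "\<lambda>i. u (v i)"], rule exI[of _ T], rule exI[of _ "Graph {v q} {}"], intro conjI)
    let ?U = "\<lambda>i. U (v i)" and ?u = "\<lambda>i. u (v i)" and ?T' = "Graph {v q} {} :: 'a graph"
    have vi: "v i \<in> S" if "i \<in> {1..q}" for i using vS(1) that by blast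
    note D = pendantD[OF p vi]
    have cc: "(\<Union>i\<in>{1..q}. verts (clique_constituent (?U i) (?u i) (v i))) = verts G"
    proof -
      have "(\<Union>i\<in>{1..q}. verts (clique_constituent (?U i) (?u i) (v i))) = (\<Union>s\<in>S. U s \<union> {s})"
        unfolding vS(1)[symmetric] by (simp add: clique_constituent_def)
      also have "\<dots> = S \<union> (\<Union>s\<in>S. U s)" by blast
      also have "\<dots> = verts G" using V by (rule sym)
      finally show ?thesis .
    qed
    show "inj_on v {1..q}" by (rule vS(2))
    show "disjoint_family_on ?U {1..q}"
      unfolding disjoint_family_on_def
      using pendantD(8)[OF p] vi vS(2) by (metis inj_on_contraD)
    show "\<forall>i\<in>{1..q}. finite (?U i) \<and> card (?U i) = k \<and> ?U i \<inter> v ` {1..q} = {} \<and> ?u i \<in> ?U i"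
      using clq_finite[OF pendant_clq[OF p]] D vS(1) vi by simp
    show "tree T" by (rule treeT)
    show "verts T = v ` {1..q}" unfolding vS(1) by (simp add: T_def)
    show "tree ?T'" by (rule tree_singleton)
    show "card (edges ?T') = 0" by simp
    have vq: "v q \<in> verts G" using vi[of q] q1 SV by auto
    show "verts ?T' \<inter> (\<Union>i\<in>{1..q}. verts (clique_constituent (?U i) (?u i) (v i))) = {v q}"
      unfolding cc using vq by simp
    show "verts G = verts ?T' \<union> (\<Union>i\<in>{1..q}. verts (clique_constituent (?U i) (?u i) (v i)))"
      unfolding cc using vq by auto
    have ce: "(\<Union>i\<in>{1..q}. edges (clique_constituent (?U i) (?u i) (v i))) = (\<Union>s\<in>S. nsets (U s) 2 \<union> {{u s, s}})"
      unfolding vS(1)[symmetric] by (simp add: clique_constituent_def)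
    have half: "{a, b} \<in> nsets (U s) 2 \<union> {{u s, s}}" if "s \<in> S" "a \<in> U s" "b \<in> nb a" for a b s
    proof -
      have "b \<in> U s - {a} \<union> (if a = u s then {s} else {})"
        using pendantD(7)[OF p that(1,2)] that(3) nb_Int_verts by blast
      then show ?thesis using that(2) by (auto simp: nsets_def split: if_splits)
    qed
    show "edges G = edges T \<union> edges ?T' \<union> (\<Union>i\<in>{1..q}. edges (clique_constituent (?U i) (?u i) (v i)))"
      unfolding ce
    proof (rule equalityI; rule subsetI)
      fix e assume e: "e \<in> edges G"
      then obtain a b where ab: "e = {a, b}" "a \<in> verts G" "b \<in> verts G" "b \<in> nb a" by (rule edgeE)
      consider "a \<in> S" "b \<in> S" | s where "s \<in> S" "a \<in> U s" | s where "s \<in> S" "b \<in> U s"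
        using ab(2,3) V by blast
      then show "e \<in> edges T \<union> edges ?T' \<union> (\<Union>s\<in>S. nsets (U s) 2 \<union> {{u s, s}})"
      proof cases
        case 1
        then show ?thesis using e ab(1) by (simp add: T_def)
      next
        case 2
        then show ?thesis using half[OF 2 ab(4)] ab(1) by blast
      next
        case 3
        have "a \<in> nb b" using ab(4) nb_sym by blast
        then have "{b, a} \<in> nsets (U s) 2 \<union> {{u s, s}}" by (rule half[OF 3])
        moreover have "e = {b, a}" using ab(1) by (simp add: insert_commute)
        ultimately show ?thesis using 3(1) by blast
      qed
    next
      fix e assume "e \<in> edges T \<union> edges ?T' \<union> (\<Union>s\<in>S. nsets (U s) 2 \<union> {{u s, s}})"
      then consider "e \<in> edges T" | s where "s \<in> S" "e \<in> nsets (U s) 2" | s where "s \<in> S" "e = {u s, s}" by auto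
      then show "e \<in> edges G"
      proof cases
        case 1
        then show ?thesis by (simp add: T_def)
      next
        case 2
        then obtain a b where "e = {a, b}" "a \<noteq> b" "a \<in> U s" "b \<in> U s"
          by (auto simp: nsets_def card_2_iff)
        then show ?thesis using clqD[OF pendant_clq[OF p 2(1)]] by (simp add: nb_eq)
      next
        case 3
        have "u s \<in> nb s" using pendant_nb[OF p 3(1)] by blast
        then show ?thesis using 3(2) by (simp add: nb_eq insert_commute)
      qed
    qed
  qed
  moreover have "(card (edges G) + 1) div t = q" "(card (edges G) + 1) mod t = 0"
    unfolding assms(2) q_def using t_pos by simp_all
  ultimately show ?thesis
    unfolding pure_special_graph_def special_graph_def Let_def t_def by simp
qed

end

theorem theorem1p3:
  fixes G :: "'a graph" and k l m :: nat
  assumes "k \<ge> 1"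
    and "l \<in> {1, 2, 3}"
    and "simple_graph G"
    and "connected_graph G"
    and "card (edges G) = m"
    and "\<not> isomorphic G (complete_graph k)"
  shows "real (iota G (family l k :: 'a graph set)) \<le> (real m + 1) / (real (k choose 2) + 2)
    \<and> (real (iota G (family l k :: 'a graph set)) = (real m + 1) / (real (k choose 2) + 2) \<longleftrightarrow>
          pure_special_graph m k G
          \<or> (k = 2 \<and> isomorphic G (cycle_graph 5))
          \<or> (k = 3 \<and> l \<in> {1, 3} \<and> isomorphic G (cycle_graph 4)))
    \<and> (special_graph m k G \<longrightarrow>
          int (iota G (family l k :: 'a graph set))
            = \<lfloor>(real m + 1) / (real (k choose 2) + 2)\<rfloor>)"
proof -
  interpret graph_isolation G k using assms(1,3) by unfold_locales
  define i where "i = iota G (family l k :: 'a graph set)"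
  have nclq: "\<not> clq (verts G)" using isomorphic_complete_if_clq assms(6) by blast
  have good: "good (verts G)" by (rule good_conn[OF finite_verts conn_if_connected[OF assms(4)] nclq])
  have em: "ecount (verts G) = m" using ecount_verts assms(5) by simp
  have "t * i \<le> t * io (verts G)" unfolding i_def using iota_le_io by (rule mult_le_mono2)
  moreover have tio: "t * io (verts G) \<le> m + 1" using good_bound[OF good] em by simp
  ultimately have bound: "t * i \<le> m + 1" by linarith
  have rt: "real (k choose 2) + 2 = real t" by (simp add: t_def)
  have rm: "real m + 1 = real (m + 1)" by simp
  have tpos: "0 < real t" using t_pos by simp
  have le: "real i \<le> real (m + 1) / real t"
    using bound tpos by (simp add: pos_le_divide_eq mult.commute flip: of_nat_mult)
  have eq_iff: "real i = real (m + 1) / real t \<longleftrightarrow> t * i = m + 1"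
  proof -
    have "real i = real (m + 1) / real t \<longleftrightarrow> real (t * i) = real (m + 1)"
      using tpos by (simp add: eq_divide_eq mult.commute)
    then show ?thesis by (simp only: of_nat_eq_iff)
  qed
  \<comment> \<open>The pendant cliques give the lower bound, and the upper bound is the general
    one, rounded down.\<close>
  have special: "i = (m + 1) div t" if "special_graph m k G"
  proof (rule antisym)
    show "(m + 1) div t \<le> i"
      using special_iota_ge that unfolding special_graph_def Let_def i_def t_def by blast
    show "i \<le> (m + 1) div t" using bound t_pos by (simp add: less_eq_div_iff_mult_less_eq mult.commute)
  qed
  have "pure_special_graph m k G \<or> k = 2 \<and> isomorphic G (cycle_graph 5)
      \<or> k = 3 \<and> l \<in> {1, 3} \<and> isomorphic G (cycle_graph 4)" if tight: "t * i = m + 1"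
  proof -
    \<comment> \<open>\<open>io\<close> lies between the isolation number of the family and the
      common upper bound, so equality for the family passes to \<open>io\<close>, for which the
      extremal sets are classified.\<close>
    have tio': "t * io (verts G) = m + 1" using tight tio \<open>t * i \<le> t * io (verts G)\<close> by linarith
    then have "extremal (verts G)" using good em by (simp add: good_def)
    then consider S U u where "pure (verts G) S U u" | "k = 2" "cyc5 (verts G)" | "k = 3" "cyc4 (verts G)"
      unfolding extremal_def by blast
    then show ?thesis
    proof cases
      case 1
      have "card (edges G) + 1 = t * card S"
        using pure_io[OF 1 finite_verts] tio' assms(5) by simp
      then show ?thesis using pure_special_if_pure[OF 1] assms(5) by simp
    next
      case 2
      then show ?thesis using isomorphic_if_cyc5 by blast
    next
      case 3
      have "l \<noteq> 2"
      proof
        assume "l = 2"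
        then have "i = 0" using cyc4_chromatic_iota[OF 3(2,1)] by (simp add: i_def)
        then show False using tight by simp
      qed
      then show ?thesis using isomorphic_if_cyc4[OF 3(2)] 3(1) assms(2) by blast
    qed
  qed
  moreover have "t * i = m + 1" if "pure_special_graph m k G"
  proof -
    have "special_graph m k G" "(m + 1) mod t = 0"
      using that by (simp_all add: pure_special_graph_def t_def)
    then show ?thesis using special by auto
  qed
  moreover have "t * i = m + 1" if h: "k = 2" "isomorphic G (cycle_graph 5)"
  proof -
    have c: "cyc5 (verts G)" by (rule cyc5_if_isomorphic[OF h(2)])
    have "m = 5" using cyc5_ecount[OF c] em by simp
    moreover have "2 \<le> i" unfolding i_def by (rule cyc5_iota_ge[OF c h(1)])
    ultimately show ?thesis using bound t_2[OF h(1)] by simp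
  qed
  moreover have "t * i = m + 1" if h: "k = 3" "l \<in> {1, 3}" "isomorphic G (cycle_graph 4)"
  proof -
    have c: "cyc4 (verts G)" by (rule cyc4_if_isomorphic[OF h(3)])
    have "m = 4" using cyc4_ecount[OF c] em by simp
    moreover have "1 \<le> i" unfolding i_def by (rule cyc4_regular_iota_pos[OF c h(1)]) (use h(2) in auto)
    ultimately show ?thesis using bound t_3[OF h(1)] by simp
  qed
  ultimately have iff: "t * i = m + 1 \<longleftrightarrow> pure_special_graph m k G \<or> k = 2 \<and> isomorphic G (cycle_graph 5)
      \<or> k = 3 \<and> l \<in> {1, 3} \<and> isomorphic G (cycle_graph 4)" by blast
  have floor: "\<lfloor>real (m + 1) / real t\<rfloor> = int ((m + 1) div t)"
    by (rule floor_divide_of_nat_eq)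
  show ?thesis
    unfolding rt rm i_def[symmetric] eq_iff iff floor
    using le special by blast
qed

end
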